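(* Let $A$ and $B$ be $C^{*}$-algebras. (1) If $\varphi:A \to B$ is a completely positive contractive (c.p.c.) order zero map, then the assignment $\varrho_{\varphi}(\mathrm{id}_{(0,1]} \otimes a) := \varphi(a)$ (for $a \in A$) induces a $*$-homomorphism $\varrho_{\varphi}: \mathcal{C}_{0}((0,1]) \otimes A \to B$. (2) Conversely, any $*$-homomorphism $\varrho: \mathcal{C}_{0}((0,1]) \otimes A \to B$ induces a c.p.c. order zero map $\varphi_{\varrho}: A \to B$ via $\varphi_{\varrho}(a):= \varrho(\mathrm{id}_{(0,1]} \otimes a)$. (3) These mutual assignments $\varphi\mapsto\varrho_{\varphi}$ and $\varrho\mapsto\varphi_{\varrho}$ yield a canonical bijection between the set of c.p.c. order zero maps from $A$ to $B$ and the set of $*$-homomorphisms from $\mathcal{C}_{0}((0,1]) \otimes A$ to $B$.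
   Context: Two elements $a,b$ of a $C^{*}$-algebra are orthogonal, written $a \perp b$, if $ab=ba=a^{*}b=ab^{*}=0$. A completely positive map $\varphi:A\to B$ between $C^{*}$-algebras has order zero if, for all $a,b\in A_{+}$, $a\perp b$ implies $\varphi(a)\perp\varphi(b)$. $\mathcal{C}_{0}((0,1])$ is the $C^{*}$-algebra of continuous complex-valued functions on $(0,1]$ vanishing at $0$, and $\mathrm{id}_{(0,1]}\in \mathcal{C}_{0}((0,1])$ is the function $t\mapsto t$. The tensor product $\mathcal{C}_{0}((0,1]) \otimes A$ is the $C^{*}$-algebra tensor product (the $C^*$-norm is unique since $\mathcal{C}_{0}((0,1])$ is commutative), i.e. the cone over $A$. *)

theory Defs
  imports "HOL-Analysis.Analysis" "Jordan_Normal_Form.Matrix"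
begin

section \<open>C*-algebras\<close>

text \<open>Not necessarily unital, and possibly zero. The libraries have no complex normed spaces, so the
  complex structure is laid over the real Banach algebra classes.\<close>

class cstar_algebra = real_normed_algebra + banach +
  fixes scaleC :: "complex \<Rightarrow> 'a \<Rightarrow> 'a" (infixr "*\<^sub>C" 75)
    and star :: "'a \<Rightarrow> 'a"
  assumes scaleC_add_right: "c *\<^sub>C (x + y) = c *\<^sub>C x + c *\<^sub>C y"
    and scaleC_add_left: "(c + d) *\<^sub>C x = c *\<^sub>C x + d *\<^sub>C x"
    and scaleC_scaleC: "c *\<^sub>C d *\<^sub>C x = (c * d) *\<^sub>C x"
    and scaleR_scaleC: "scaleR r x = complex_of_real r *\<^sub>C x"
    and mult_scaleC_left: "(c *\<^sub>C x) * y = c *\<^sub>C (x * y)"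
    and mult_scaleC_right: "x * (c *\<^sub>C y) = c *\<^sub>C (x * y)"
    and norm_scaleC: "norm (c *\<^sub>C x) = cmod c * norm x"
    and star_add: "star (x + y) = star x + star y"
    and star_scaleC: "star (c *\<^sub>C x) = cnj c *\<^sub>C star x"
    and star_mult: "star (x * y) = star y * star x"
    and star_star: "star (star x) = x"
    and cstar_identity: "norm (star x * x) = (norm x)\<^sup>2"
begin

lemma scaleC_one: "1 *\<^sub>C x = x"
  using scaleR_scaleC[of 1 x] local.scaleR_one[of x] by simp

lemma scaleC_zero_left: "0 *\<^sub>C x = 0"
  using scaleC_add_left[of 0 0 x] by simp

lemma scaleC_zero_right: "c *\<^sub>C 0 = 0"
  using scaleC_add_right[of c 0 0] by simp

lemma scaleC_minus_right: "c *\<^sub>C (- x) = - (c *\<^sub>C x)"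
  using scaleC_add_right[of c x "- x"] by (simp add: scaleC_zero_right eq_neg_iff_add_eq_0 add.commute)

lemma scaleC_diff_right: "c *\<^sub>C (x - y) = c *\<^sub>C x - c *\<^sub>C y"
  using scaleC_add_right[of c x "- y"] by (simp add: scaleC_minus_right)

lemma scaleC_minus_left: "(- c) *\<^sub>C x = - (c *\<^sub>C x)"
  using scaleC_add_left[of c "- c" x] by (simp add: scaleC_zero_left eq_neg_iff_add_eq_0 add.commute)

lemma scaleC_diff_left: "(c - d) *\<^sub>C x = c *\<^sub>C x - d *\<^sub>C x"
  using scaleC_add_left[of c "- d" x] by (simp add: scaleC_minus_left)

lemma star_zero: "star 0 = 0"
  using star_add[of 0 0] by simp

lemma star_minus: "star (- x) = - star x"
  using star_add[of x "- x"] by (simp add: star_zero eq_neg_iff_add_eq_0 add.commute)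

lemma star_diff: "star (x - y) = star x - star y"
  using star_add[of x "- y"] by (simp add: star_minus)

lemma norm_star: "norm (star x) = norm x"
proof -
  have le: "norm y \<le> norm (star y)" for y
  proof (cases "norm y = 0")
    case False
    have "norm y * norm y \<le> norm (star y) * norm y"
      using cstar_identity[of y] norm_mult_ineq[of "star y" y] by (simp add: power2_eq_square)
    then show ?thesis using False by (simp add: mult_le_cancel_right)
  qed (simp add: local.norm_ge_zero)
  show ?thesis using le[of x] le[of "star x"] by (simp add: star_star)
qed

end

lemma bounded_bilinear_scaleC:
  "bounded_bilinear (scaleC :: complex \<Rightarrow> 'a::cstar_algebra \<Rightarrow> 'a)"
proof
  show "\<exists>K. \<forall>c (x::'a). norm (c *\<^sub>C x) \<le> norm c * norm x * K"
    by (intro exI[of _ 1]) (simp add: norm_scaleC)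
qed (simp_all add: scaleC_add_right scaleC_add_left scaleR_scaleC scaleC_scaleC scaleR_conv_of_real mult.commute)

lemma bounded_linear_star: "bounded_linear (star :: 'a::cstar_algebra \<Rightarrow> 'a)"
proof
  show "\<exists>K. \<forall>x::'a. norm (star x) \<le> norm x * K"
    by (intro exI[of _ 1]) (simp add: norm_star)
qed (simp_all add: star_add scaleR_scaleC star_scaleC)

lemmas continuous_on_scaleC [continuous_intros] =
  bounded_bilinear.continuous_on[OF bounded_bilinear_scaleC]
lemmas continuous_on_star [continuous_intros] =
  bounded_linear.continuous_on[OF bounded_linear_star]

instantiation complex :: cstar_algebra
begin
definition scaleC_complex :: "complex \<Rightarrow> complex \<Rightarrow> complex" where "scaleC_complex c z = c * z"
definition star_complex :: "complex \<Rightarrow> complex" where "star_complex = cnj"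
instance
  by standard
    (simp_all add: scaleC_complex_def star_complex_def algebra_simps norm_mult power2_eq_square
      scaleR_conv_of_real)
end


section \<open>Completely positive order zero maps\<close>

definition complex_linear :: "('a::cstar_algebra \<Rightarrow> 'b::cstar_algebra) \<Rightarrow> bool" where
  "complex_linear f \<longleftrightarrow> (\<forall>x y. f (x + y) = f x + f y) \<and> (\<forall>c x. f (c *\<^sub>C x) = c *\<^sub>C f x)"

definition star_hom :: "('a::cstar_algebra \<Rightarrow> 'b::cstar_algebra) \<Rightarrow> bool" where
  "star_hom f \<longleftrightarrow> complex_linear f \<and> (\<forall>x y. f (x * y) = f x * f y) \<and> (\<forall>x. f (star x) = star (f x))"

definition positive :: "'a::cstar_algebra \<Rightarrow> bool" where
  "positive a \<longleftrightarrow> (\<exists>b. a = star b * b)"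

definition orth :: "'a::cstar_algebra \<Rightarrow> 'a \<Rightarrow> bool" where
  "orth a b \<longleftrightarrow> a * b = 0 \<and> b * a = 0 \<and> star a * b = 0 \<and> a * star b = 0"

definition mat_star :: "'a::cstar_algebra mat \<Rightarrow> 'a mat" where
  "mat_star X = transpose_mat (map_mat star X)"

text \<open>The positive elements \<open>Y\<^sup>* Y\<close> of the C*-algebra of \<open>n \<times> n\<close> matrices; its norm plays no role.\<close>

definition mat_pos :: "nat \<Rightarrow> 'a::cstar_algebra mat \<Rightarrow> bool" where
  "mat_pos n X \<longleftrightarrow> (\<exists>Y \<in> carrier_mat n n. X = mat_star Y * Y)"

definition completely_positive :: "('a::cstar_algebra \<Rightarrow> 'b::cstar_algebra) \<Rightarrow> bool" where
  "completely_positive f \<longleftrightarrow>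
    complex_linear f \<and> (\<forall>n X. mat_pos n X \<longrightarrow> mat_pos n (map_mat f X))"

definition contractive :: "('a::cstar_algebra \<Rightarrow> 'b::cstar_algebra) \<Rightarrow> bool" where
  "contractive f \<longleftrightarrow> (\<forall>x. norm (f x) \<le> norm x)"

definition order_zero :: "('a::cstar_algebra \<Rightarrow> 'b::cstar_algebra) \<Rightarrow> bool" where
  "order_zero f \<longleftrightarrow> (\<forall>a b. positive a \<longrightarrow> positive b \<longrightarrow> orth a b \<longrightarrow> orth (f a) (f b))"

definition cpc_order_zero :: "('a::cstar_algebra \<Rightarrow> 'b::cstar_algebra) \<Rightarrow> bool" where
  "cpc_order_zero f \<longleftrightarrow> completely_positive f \<and> contractive f \<and> order_zero f"


section \<open>Vector-valued functions on the half-open unit interval vanishing at zero\<close>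

text \<open>\<open>'a c0\<close> is \<open>C\<^sub>0((0,1], 'a)\<close> with the supremum norm and pointwise operations; functions are
  extended by \<open>0\<close> outside \<open>(0,1]\<close>. In particular \<open>complex c0\<close> is the scalar algebra
  \<open>C\<^sub>0((0,1])\<close>, and \<open>'a c0\<close> is the cone over \<open>'a\<close>.\<close>

typedef (overloaded) 'a c0 = "{f :: real \<Rightarrow> 'a::cstar_algebra.
    continuous_on {0<..1} f \<and> (f \<longlongrightarrow> 0) (at_right 0) \<and> (\<forall>t. t \<notin> {0<..1} \<longrightarrow> f t = 0)}"
  morphisms c0_fun Abs_c0
  by (intro exI[of _ "\<lambda>_. 0"]) simp

setup_lifting type_definition_c0

lemma c0_iff:
  fixes f :: "real \<Rightarrow> 'a::cstar_algebra"
  assumes "\<forall>t. t \<notin> {0<..1} \<longrightarrow> f t = 0"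
  shows "continuous_on {0<..1} f \<and> (f \<longlongrightarrow> 0) (at_right 0) \<longleftrightarrow> continuous_on {0..1} f"
proof
  assume L: "continuous_on {0<..1} f \<and> (f \<longlongrightarrow> 0) (at_right 0)"
  have f0: "f 0 = 0" using assms by simp
  show "continuous_on {0..1} f"
    unfolding continuous_on_def
  proof
    fix x :: real assume x: "x \<in> {0..1}"
    show "(f \<longlongrightarrow> f x) (at x within {0..1})"
    proof (cases "x = 0")
      case True
      have "at 0 within {0..1} \<le> at_right (0::real)"
        unfolding at_within_def by (intro inf_mono order_refl) auto
      then show ?thesis using L f0 True tendsto_mono by metis
    next
      case False
      then have "x \<in> {0<..1}" using x by auto
      then have "(f \<longlongrightarrow> f x) (at x within {0<..1})"
        using L unfolding continuous_on_def by blast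
      moreover have "at x within {0..1} = at x within {0<..1}"
        by (rule at_within_nhd[of x "{0<..}"]) (use False x in auto)
      ultimately show ?thesis by simp
    qed
  qed
next
  assume R: "continuous_on {0..1} f"
  have "(f \<longlongrightarrow> f 0) (at 0 within {0..1})"
    using R unfolding continuous_on_def by force
  moreover have "at 0 within {0..1} = at_right (0::real)"
    by (rule at_within_nhd[of 0 "{..<1}"]) auto
  ultimately show "continuous_on {0<..1} f \<and> (f \<longlongrightarrow> 0) (at_right 0)"
    using continuous_on_subset[OF R greaterThanAtMost_subseteq_atLeastAtMost_iff[THEN iffD2]] assms
    by simp
qed

lemma c0_funI:
  fixes f :: "real \<Rightarrow> 'a::cstar_algebra"
  assumes "continuous_on {0..1} f" "\<And>t. t \<notin> {0<..1} \<Longrightarrow> f t = 0"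
  shows "continuous_on {0<..1} f \<and> (f \<longlongrightarrow> 0) (at_right 0) \<and> (\<forall>t. t \<notin> {0<..1} \<longrightarrow> f t = 0)"
  using assms c0_iff[of f] by blast

lemma c0_fun_outside: "t \<notin> {0<..1} \<Longrightarrow> c0_fun f t = 0"
  using c0_fun by blast

lemma c0_fun_continuous: "continuous_on {0..1} (c0_fun f)"
  using c0_fun[of f] c0_iff[of "c0_fun f"] by blast

lemma c0_fun_Abs:
  fixes f :: "real \<Rightarrow> 'a::cstar_algebra"
  assumes "continuous_on {0..1} f" "\<And>t. t \<notin> {0<..1} \<Longrightarrow> f t = 0"
  shows "c0_fun (Abs_c0 f) = f"
  by (rule Abs_c0_inverse) (use c0_funI[OF assms] in simp)

lemma c0_eqI: "(\<And>t. c0_fun f t = c0_fun g t) \<Longrightarrow> f = g"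
  by (metis c0_fun_inject ext)

lemma c0_fun_bounded: "\<exists>K. \<forall>t. norm (c0_fun f t) \<le> K"
proof -
  have "compact (c0_fun f ` {0..1})"
    by (intro compact_continuous_image c0_fun_continuous) auto
  then obtain K where K: "\<forall>y \<in> c0_fun f ` {0..1}. norm y \<le> K"
    using compact_imp_bounded bounded_iff by metis
  have "norm (c0_fun f t) \<le> max K 0" for t
  proof (cases "t \<in> {0<..1}")
    case True
    then have "norm (c0_fun f t) \<le> K" using K by auto
    then show ?thesis by simp
  qed (simp add: c0_fun_outside)
  then show ?thesis by blast
qed

lemma c0_bdd_above: "bdd_above (range (\<lambda>t. norm (c0_fun f t)))"
  using c0_fun_bounded[of f] by (auto simp: bdd_above_def)

instantiation c0 :: (cstar_algebra) real_normed_algebra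
begin

definition zero_c0 :: "'a c0" where "0 = Abs_c0 (\<lambda>_. 0)"
definition plus_c0 :: "'a c0 \<Rightarrow> 'a c0 \<Rightarrow> 'a c0" where
  "f + g = Abs_c0 (\<lambda>t. c0_fun f t + c0_fun g t)"
definition minus_c0 :: "'a c0 \<Rightarrow> 'a c0 \<Rightarrow> 'a c0" where
  "f - g = Abs_c0 (\<lambda>t. c0_fun f t - c0_fun g t)"
definition uminus_c0 :: "'a c0 \<Rightarrow> 'a c0" where
  "- f = Abs_c0 (\<lambda>t. - c0_fun f t)"
definition times_c0 :: "'a c0 \<Rightarrow> 'a c0 \<Rightarrow> 'a c0" where
  "f * g = Abs_c0 (\<lambda>t. c0_fun f t * c0_fun g t)"
definition scaleR_c0 :: "real \<Rightarrow> 'a c0 \<Rightarrow> 'a c0" where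
  "scaleR r f = Abs_c0 (\<lambda>t. scaleR r (c0_fun f t))"
definition norm_c0 :: "'a c0 \<Rightarrow> real" where
  "norm_c0 f = (SUP t. norm (c0_fun f t))"
definition dist_c0 :: "'a c0 \<Rightarrow> 'a c0 \<Rightarrow> real" where
  "dist_c0 f g = norm (f - g)"
definition sgn_c0 :: "'a c0 \<Rightarrow> 'a c0" where
  "sgn_c0 f = scaleR (inverse (norm f)) f"
definition uniformity_c0 :: "('a c0 \<times> 'a c0) filter" where
  "uniformity_c0 = (INF e\<in>{0<..}. principal {(x, y). dist x y < e})"
definition open_c0 :: "'a c0 set \<Rightarrow> bool" where
  "open_c0 S \<longleftrightarrow> (\<forall>x\<in>S. \<forall>\<^sub>F (x', y) in uniformity. x' = x \<longrightarrow> y \<in> S)"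

lemma c0_zero: "c0_fun 0 t = (0::'a)"
  unfolding zero_c0_def by (subst c0_fun_Abs) auto
lemma c0_plus: "c0_fun (f + g) t = c0_fun f t + c0_fun (g :: 'a c0) t"
  unfolding plus_c0_def
  by (subst c0_fun_Abs) (auto intro!: continuous_intros c0_fun_continuous simp: c0_fun_outside)
lemma c0_minus: "c0_fun (f - g) t = c0_fun f t - c0_fun (g :: 'a c0) t"
  unfolding minus_c0_def
  by (subst c0_fun_Abs) (auto intro!: continuous_intros c0_fun_continuous simp: c0_fun_outside)
lemma c0_uminus: "c0_fun (- f) t = - c0_fun (f :: 'a c0) t"
  unfolding uminus_c0_def
  by (subst c0_fun_Abs) (auto intro!: continuous_intros c0_fun_continuous simp: c0_fun_outside)
lemma c0_times: "c0_fun (f * g) t = c0_fun f t * c0_fun (g :: 'a c0) t"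
  unfolding times_c0_def
  by (subst c0_fun_Abs) (auto intro!: continuous_intros c0_fun_continuous simp: c0_fun_outside)
lemma c0_scaleR: "c0_fun (scaleR r f) t = scaleR r (c0_fun (f :: 'a c0) t)"
  unfolding scaleR_c0_def
  by (subst c0_fun_Abs) (auto intro!: continuous_intros c0_fun_continuous simp: c0_fun_outside)

lemmas c0_ops = c0_zero c0_plus c0_minus c0_uminus c0_times c0_scaleR

lemma c0_norm_le: "norm (c0_fun f t) \<le> norm (f :: 'a c0)"
  unfolding norm_c0_def by (intro cSUP_upper c0_bdd_above) simp

lemma c0_norm_leI: "(\<And>t. norm (c0_fun f t) \<le> K) \<Longrightarrow> norm (f :: 'a c0) \<le> K"
  unfolding norm_c0_def by (intro cSUP_least) auto

lemma c0_norm_leI':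
  assumes "\<And>t. t \<in> {0<..1} \<Longrightarrow> norm (c0_fun f t) \<le> K"
  shows "norm (f :: 'a c0) \<le> K"
proof (rule c0_norm_leI)
  fix t
  have "0 \<le> norm (c0_fun f 1)" by simp
  also have "\<dots> \<le> K" using assms[of 1] by simp
  finally show "norm (c0_fun f t) \<le> K"
    using assms[of t] by (cases "t \<in> {0<..1}") (auto simp: c0_fun_outside)
qed

instance
proof
  fix f g h :: "'a c0" and r s :: real
  show "f + g + h = f + (g + h)" "f + g = g + f" "0 + f = f" "- f + f = 0" "f - g = f + - g"
    "f * g * h = f * (g * h)" "(f + g) * h = f * h + g * h" "f * (g + h) = f * g + f * h"
    by (rule c0_eqI; simp add: c0_ops algebra_simps)+
  show "r *\<^sub>R (f + g) = r *\<^sub>R f + r *\<^sub>R g" "(r + s) *\<^sub>R f = r *\<^sub>R f + s *\<^sub>R f"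
    "r *\<^sub>R s *\<^sub>R f = (r * s) *\<^sub>R f" "1 *\<^sub>R f = f" "r *\<^sub>R f * g = r *\<^sub>R (f * g)"
    "f * r *\<^sub>R g = r *\<^sub>R (f * g)"
    by (rule c0_eqI; simp add: c0_ops algebra_simps)+
  show "dist f g = norm (f - g)" by (rule dist_c0_def)
  show "sgn f = inverse (norm f) *\<^sub>R f" by (rule sgn_c0_def)
  show "uniformity = (INF e\<in>{0<..}. principal {(x, y :: 'a c0). dist x y < e})"
    by (rule uniformity_c0_def)
  show "open S \<longleftrightarrow> (\<forall>x\<in>S. \<forall>\<^sub>F (x', y) in uniformity. x' = x \<longrightarrow> y \<in> S)" for S :: "'a c0 set"
    by (rule open_c0_def)
  show "norm f = 0 \<longleftrightarrow> f = 0"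
  proof
    assume "norm f = 0"
    then have "norm (c0_fun f t) \<le> 0" for t using c0_norm_le[of f t] by simp
    then show "f = 0" by (intro c0_eqI) (simp add: c0_zero)
  qed (simp add: norm_c0_def c0_zero)
  show "norm (f + g) \<le> norm f + norm g"
  proof (rule c0_norm_leI)
    fix t show "norm (c0_fun (f + g) t) \<le> norm f + norm g"
      unfolding c0_plus
      by (intro order_trans[OF norm_triangle_ineq] add_mono c0_norm_le)
  qed
  have nn: "0 \<le> norm k" for k :: "'a c0"
    using c0_norm_le[of k 0] by (rule order_trans[OF norm_ge_zero])
  show "norm (r *\<^sub>R f) = \<bar>r\<bar> * norm f"
  proof (rule antisym)
    show "norm (r *\<^sub>R f) \<le> \<bar>r\<bar> * norm f"
      by (rule c0_norm_leI) (simp add: c0_scaleR mult_left_mono c0_norm_le)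
    show "\<bar>r\<bar> * norm f \<le> norm (r *\<^sub>R f)"
    proof (cases "r = 0")
      case False
      have "norm f \<le> norm (r *\<^sub>R f) / \<bar>r\<bar>"
      proof (rule c0_norm_leI)
        fix t
        have "\<bar>r\<bar> * norm (c0_fun f t) \<le> norm (r *\<^sub>R f)"
          using c0_norm_le[of "r *\<^sub>R f" t] by (simp add: c0_scaleR)
        then show "norm (c0_fun f t) \<le> norm (r *\<^sub>R f) / \<bar>r\<bar>"
          using False by (simp add: field_simps)
      qed
      then show ?thesis using False by (simp add: field_simps)
    qed (simp add: nn)
  qed
  show "norm (f * g) \<le> norm f * norm g"
  proof (rule c0_norm_leI)
    fix t show "norm (c0_fun (f * g) t) \<le> norm f * norm g"
      unfolding c0_times
      by (intro order_trans[OF norm_mult_ineq] mult_mono c0_norm_le norm_ge_zero nn)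
  qed
qed

end

instance c0 :: (cstar_algebra) banach
proof
  fix X :: "nat \<Rightarrow> 'a c0"
  assume X: "Cauchy X"
  have dle: "dist (c0_fun (X m) t) (c0_fun (X n) t) \<le> dist (X m) (X n)" for m n t
    using c0_norm_le[of "X m - X n" t] by (simp add: c0_minus dist_norm dist_c0_def)
  have "uniformly_Cauchy_on UNIV (\<lambda>n. c0_fun (X n))"
    unfolding uniformly_Cauchy_on_def
  proof (intro allI impI)
    fix e :: real assume "e > 0"
    then obtain M where "\<forall>m\<ge>M. \<forall>n\<ge>M. dist (X m) (X n) < e"
      using X unfolding Cauchy_altdef by (metis X metric_CauchyD)
    then show "\<exists>M. \<forall>t\<in>UNIV. \<forall>m\<ge>M. \<forall>n\<ge>M. dist (c0_fun (X m) t) (c0_fun (X n) t) < e"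
      using dle le_less_trans by meson
  qed
  then obtain l where l: "uniform_limit UNIV (\<lambda>n. c0_fun (X n)) l sequentially"
    using Cauchy_uniformly_convergent uniformly_convergent_on_def by metis
  have ul: "continuous_on {0..1} l"
    by (rule uniform_limit_theorem[OF _ uniform_limit_on_subset[OF l]])
      (auto simp: c0_fun_continuous)
  have "l t = 0" if "t \<notin> {0<..1}" for t
    using tendsto_uniform_limitI[OF l, of t]
    by (simp add: c0_fun_outside[OF that] LIMSEQ_const_iff)
  then have L: "c0_fun (Abs_c0 l) = l" using ul by (intro c0_fun_Abs)
  have "X \<longlonglongrightarrow> Abs_c0 l"
    unfolding lim_sequentially
  proof (intro allI impI)
    fix e :: real assume e: "e > 0"
    then obtain N where N: "\<forall>n\<ge>N. \<forall>t\<in>UNIV. dist (c0_fun (X n) t) (l t) < e / 2"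
      using l half_gt_zero[OF e] unfolding uniform_limit_sequentially_iff by meson
    have "dist (X n) (Abs_c0 l) < e" if "n \<ge> N" for n
    proof -
      have "norm (X n - Abs_c0 l) \<le> e / 2"
        using N that by (intro c0_norm_leI) (auto simp: c0_minus L dist_norm less_imp_le)
      then show ?thesis using e by (simp add: dist_c0_def)
    qed
    then show "\<exists>N. \<forall>n\<ge>N. dist (X n) (Abs_c0 l) < e" by blast
  qed
  then show "convergent X" by (auto simp: convergent_def)
qed

instantiation c0 :: (cstar_algebra) cstar_algebra
begin

definition scaleC_c0 :: "complex \<Rightarrow> 'a c0 \<Rightarrow> 'a c0" where
  "c *\<^sub>C f = Abs_c0 (\<lambda>t. c *\<^sub>C c0_fun f t)"
definition star_c0 :: "'a c0 \<Rightarrow> 'a c0" where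
  "star f = Abs_c0 (\<lambda>t. star (c0_fun f t))"

lemma c0_scaleC: "c0_fun (c *\<^sub>C f) t = c *\<^sub>C c0_fun (f :: 'a c0) t"
  unfolding scaleC_c0_def
  by (subst c0_fun_Abs)
    (auto intro!: continuous_intros c0_fun_continuous simp: c0_fun_outside scaleC_zero_right)
lemma c0_star: "c0_fun (star f) t = star (c0_fun (f :: 'a c0) t)"
  unfolding star_c0_def
  by (subst c0_fun_Abs)
    (auto intro!: continuous_intros c0_fun_continuous simp: c0_fun_outside star_zero)

instance
proof
  fix f g h :: "'a c0" and r :: real and c d :: complex
  show "c *\<^sub>C (f + g) = c *\<^sub>C f + c *\<^sub>C g" "(c + d) *\<^sub>C f = c *\<^sub>C f + d *\<^sub>C f"
    "c *\<^sub>C d *\<^sub>C f = (c * d) *\<^sub>C f" "r *\<^sub>R f = complex_of_real r *\<^sub>C f"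
    "(c *\<^sub>C f) * g = c *\<^sub>C (f * g)" "f * (c *\<^sub>C g) = c *\<^sub>C (f * g)"
    "star (f + g) = star f + star g" "star (c *\<^sub>C f) = cnj c *\<^sub>C star f"
    "star (f * g) = star g * star f" "star (star f) = f"
    by (rule c0_eqI; simp add: c0_ops c0_scaleC c0_star scaleC_add_right scaleC_add_left scaleC_scaleC
        scaleR_scaleC mult_scaleC_left mult_scaleC_right star_add star_scaleC star_mult star_star)+
  show "norm (c *\<^sub>C f) = cmod c * norm f"
  proof (rule antisym)
    show "norm (c *\<^sub>C f) \<le> cmod c * norm f"
      by (rule c0_norm_leI) (simp add: c0_scaleC norm_scaleC mult_left_mono c0_norm_le)
    show "cmod c * norm f \<le> norm (c *\<^sub>C f)"
    proof (cases "c = 0")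
      case False
      have "norm f \<le> norm (c *\<^sub>C f) / cmod c"
      proof (rule c0_norm_leI)
        fix t
        have "cmod c * norm (c0_fun f t) \<le> norm (c *\<^sub>C f)"
          using c0_norm_le[of "c *\<^sub>C f" t] by (simp add: c0_scaleC norm_scaleC)
        then show "norm (c0_fun f t) \<le> norm (c *\<^sub>C f) / cmod c"
          using False by (simp add: field_simps)
      qed
      then show ?thesis using False by (simp add: field_simps)
    qed simp
  qed
  show "norm (star f * f) = (norm f)\<^sup>2"
  proof (rule antisym)
    show "norm (star f * f) \<le> (norm f)\<^sup>2"
      by (rule c0_norm_leI) (simp add: c0_ops c0_star cstar_identity power_mono c0_norm_le)
    have "norm f \<le> sqrt (norm (star f * f))"
    proof (rule c0_norm_leI)
      fix t
      have "(norm (c0_fun f t))\<^sup>2 \<le> norm (star f * f)"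
        using c0_norm_le[of "star f * f" t] by (simp add: c0_ops c0_star cstar_identity)
      then show "norm (c0_fun f t) \<le> sqrt (norm (star f * f))"
        by (rule real_le_rsqrt)
    qed
    then have "(norm f)\<^sup>2 \<le> (sqrt (norm (star f * f)))\<^sup>2"
      by (intro power_mono norm_ge_zero)
    then show "(norm f)\<^sup>2 \<le> norm (star f * f)" by simp
  qed
qed

end

lemmas c0_pointwise = c0_ops c0_scaleC c0_star


section \<open>The cone as a tensor product\<close>

lift_definition c0_tensor :: "complex c0 \<Rightarrow> 'a::cstar_algebra \<Rightarrow> 'a c0"  (infixr "\<otimes>\<^sub>C" 76)
  is "\<lambda>f a t. f t *\<^sub>C a"
proof (intro c0_funI)
  fix f :: "real \<Rightarrow> complex" and a :: 'a
  assume f: "continuous_on {0<..1} f \<and> (f \<longlongrightarrow> 0) (at_right 0) \<and> (\<forall>t. t \<notin> {0<..1} \<longrightarrow> f t = 0)"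
  then have "continuous_on {0..1} f" using c0_iff[of f] by blast
  then show "continuous_on {0..1} (\<lambda>t. f t *\<^sub>C a)" by (intro continuous_intros)
  show "f t *\<^sub>C a = 0" if "t \<notin> {0<..1}" for t using f that by (simp add: scaleC_zero_left)
qed

lift_definition id_c0 :: "complex c0" is "\<lambda>t. if t \<in> {0<..1} then complex_of_real t else 0"
proof (intro c0_funI)
  have "continuous_on {0..1} complex_of_real" by (intro continuous_intros)
  then show "continuous_on {0..1} (\<lambda>t. if t \<in> {0<..1} then complex_of_real t else 0)"
    by (rule continuous_on_eq) auto
qed simp

text \<open>\<open>tens\<close> exhibits \<open>'t\<close> as the completion of the algebraic tensor product of \<open>'x\<close> and \<open>'y\<close>
  in some C*-norm: it induces a \<open>*\<close>-homomorphism on the algebraic tensor product, which is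
  injective and has dense range.\<close>

definition is_cstar_tensor_product ::
    "('x::cstar_algebra \<Rightarrow> 'y::cstar_algebra \<Rightarrow> 't::cstar_algebra) \<Rightarrow> bool" where
  "is_cstar_tensor_product tens \<longleftrightarrow>
    (\<forall>x. complex_linear (tens x)) \<and> (\<forall>y. complex_linear (\<lambda>x. tens x y)) \<and>
    (\<forall>x y x' y'. tens x y * tens x' y' = tens (x * x') (y * y')) \<and>
    (\<forall>x y. star (tens x y) = tens (star x) (star y)) \<and>
    (\<forall>n x y.
      (\<forall>c. (\<Sum>i<n. c i *\<^sub>C y i) = 0 \<longrightarrow> (\<forall>i<n. c i = 0)) \<longrightarrow>
      (\<Sum>i<n. tens (x i) (y i)) = 0 \<longrightarrow> (\<forall>i<n::nat. x i = 0)) \<and>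
    closure {z. \<exists>n x y. z = (\<Sum>i<n::nat. tens (x i) (y i))} = UNIV"

lemma c0_fun_sum: "c0_fun (\<Sum>i\<in>I. F i) t = (\<Sum>i\<in>I. c0_fun (F i) t)"
  by (induction I rule: infinite_finite_induct) (simp_all add: c0_pointwise)

lemma c0_interpolation:
  fixes F :: "'a::cstar_algebra c0"
  assumes "e > 0"
  shows "\<exists>n (f :: nat \<Rightarrow> complex c0) a. norm (F - (\<Sum>i<n. f i \<otimes>\<^sub>C a i)) \<le> e"
proof -
  have "uniformly_continuous_on {0..1} (c0_fun F)"
    by (intro compact_uniformly_continuous c0_fun_continuous) auto
  then obtain d where d: "d > 0"
    and dF: "\<And>s t. s \<in> {0..1} \<Longrightarrow> t \<in> {0..1} \<Longrightarrow> dist s t < d \<Longrightarrow> dist (c0_fun F s) (c0_fun F t) < e"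
    unfolding uniformly_continuous_on_def using assms by metis
  obtain m where m: "inverse (real (Suc m)) < d" using reals_Archimedean[OF d] by blast
  define N where "N = Suc m"
  have N: "N > 0" "1 / real N < d" using m by (auto simp: N_def inverse_eq_divide)
  define s :: "nat \<Rightarrow> real \<Rightarrow> real" where "s k t = max 0 (min 1 (real N * t - real k))" for k t
  define f where "f k = Abs_c0 (\<lambda>t. if t \<in> {0<..1} then complex_of_real (s k t) else 0)" for k
  define a where "a k = c0_fun F (real (Suc k) / real N) - c0_fun F (real k / real N)" for k
  have f: "c0_fun (f k) t = complex_of_real (s k t)" if "t \<in> {0<..1}" for k t
  proof -
    have "continuous_on {0..1} (\<lambda>t. complex_of_real (s k t))"
      unfolding s_def by (intro continuous_intros)
    then have "continuous_on {0..1} (\<lambda>t. if t \<in> {0<..1} then complex_of_real (s k t) else 0)"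
      by (rule continuous_on_eq) (auto simp: s_def)
    then have "c0_fun (f k) = (\<lambda>t. if t \<in> {0<..1} then complex_of_real (s k t) else 0)"
      unfolding f_def by (rule c0_fun_Abs) auto
    then show ?thesis using that by simp
  qed
  have F0: "c0_fun F 0 = 0" by (simp add: c0_fun_outside)
  have "norm (F - (\<Sum>k<N. f k \<otimes>\<^sub>C a k)) \<le> e"
  proof (rule c0_norm_leI')
    fix t :: real assume t: "t \<in> {0<..1}"
    define p where "p = nat (\<lceil>real N * t\<rceil> - 1)"
    have pos: "0 < real N * t" using t N by simp
    have "1 \<le> \<lceil>real N * t\<rceil>" using pos by linarith
    then have rp: "real p = real_of_int \<lceil>real N * t\<rceil> - 1" unfolding p_def by simp
    have p1: "real p < real N * t" and p2: "real N * t \<le> real p + 1"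
      unfolding rp by linarith+
    have "real N * t \<le> real N" using t N by (simp add: mult_left_le)
    then have pN: "p < N" using p1 by linarith
    define u where "u = real N * t - real p"
    have u: "0 \<le> u" "u \<le> 1" using p1 p2 by (auto simp: u_def)
    have s1: "s k t = 1" if "k < p" for k using p1 that by (simp add: s_def)
    have s2: "s p t = u" using u by (simp add: s_def u_def)
    have s3: "s k t = 0" if "k > p" for k using p2 that by (simp add: s_def)
    have "(\<Sum>k<N. s k t *\<^sub>R a k) = (\<Sum>k<Suc p. s k t *\<^sub>R a k)"
      by (rule sum.mono_neutral_right) (use pN s3 in auto)
    also have "\<dots> = (\<Sum>k<p. a k) + u *\<^sub>R a p" by (simp add: s1 s2)
    also have "(\<Sum>k<p. a k) = c0_fun F (real p / real N)"
      unfolding a_def by (subst sum_lessThan_telescope[of "\<lambda>k. c0_fun F (real k / real N)"]) (simp add: F0)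
    finally have G: "(\<Sum>k<N. s k t *\<^sub>R a k) =
      (1 - u) *\<^sub>R c0_fun F (real p / real N) + u *\<^sub>R c0_fun F (real (Suc p) / real N)"
      by (simp add: a_def algebra_simps)
    have "c0_fun (F - (\<Sum>k<N. f k \<otimes>\<^sub>C a k)) t = c0_fun F t - (\<Sum>k<N. s k t *\<^sub>R a k)"
      using f[OF t] by (simp add: c0_minus c0_fun_sum c0_tensor.rep_eq scaleR_scaleC)
    also have "\<dots> = (1 - u) *\<^sub>R (c0_fun F t - c0_fun F (real p / real N))
        + u *\<^sub>R (c0_fun F t - c0_fun F (real (Suc p) / real N))"
      unfolding G by (simp add: algebra_simps)
    finally have "norm (c0_fun (F - (\<Sum>k<N. f k \<otimes>\<^sub>C a k)) t) \<le>
        (1 - u) * dist (c0_fun F t) (c0_fun F (real p / real N))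
        + u * dist (c0_fun F t) (c0_fun F (real (Suc p) / real N))"
      using norm_triangle_ineq[of "(1 - u) *\<^sub>R (c0_fun F t - c0_fun F (real p / real N))"
        "u *\<^sub>R (c0_fun F t - c0_fun F (real (Suc p) / real N))"] u
      by (simp add: dist_norm)
    also have "\<dots> \<le> (1 - u) * e + u * e"
    proof (intro add_mono mult_left_mono)
      have d1: "t - real p / real N = u / real N" "real (Suc p) / real N - t = (1 - u) / real N"
        using N by (simp_all add: u_def field_simps)
      have "u / real N \<le> 1 / real N" "(1 - u) / real N \<le> 1 / real N"
        using u N by (simp_all add: divide_right_mono)
      moreover have "0 \<le> u / real N" "0 \<le> (1 - u) / real N" using u by simp_all
      ultimately have dd: "dist t (real p / real N) < d" "dist t (real (Suc p) / real N) < d"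
        using d1 N unfolding dist_real_def by linarith+
      have mem: "real p / real N \<in> {0..1}" "real (Suc p) / real N \<in> {0..1}" "t \<in> {0..1}"
        using pN N t by auto
      show "dist (c0_fun F t) (c0_fun F (real p / real N)) \<le> e"
        "dist (c0_fun F t) (c0_fun F (real (Suc p) / real N)) \<le> e"
        using dF[OF mem(3) mem(1) dd(1)] dF[OF mem(3) mem(2) dd(2)] by simp_all
    qed (use u in auto)
    also have "\<dots> = e" by (simp add: algebra_simps)
    finally show "norm (c0_fun (F - (\<Sum>k<N. f k \<otimes>\<^sub>C a k)) t) \<le> e" .
  qed
  then show ?thesis by blast
qed

theorem c0_is_cstar_tensor_product:
  "is_cstar_tensor_product (c0_tensor :: complex c0 \<Rightarrow> 'a::cstar_algebra \<Rightarrow> 'a c0)"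
  unfolding is_cstar_tensor_product_def
proof (intro conjI allI impI)
  show "complex_linear (c0_tensor f :: 'a \<Rightarrow> 'a c0)" for f
    unfolding complex_linear_def
    by (auto intro!: c0_eqI simp: c0_pointwise c0_tensor.rep_eq scaleC_add_right scaleC_scaleC mult.commute)
  show "complex_linear (\<lambda>f. f \<otimes>\<^sub>C a)" for a :: 'a
    unfolding complex_linear_def
    by (auto intro!: c0_eqI simp: c0_pointwise c0_tensor.rep_eq scaleC_add_left scaleC_scaleC scaleC_complex_def)
  show "(f \<otimes>\<^sub>C a) * (g \<otimes>\<^sub>C b) = (f * g) \<otimes>\<^sub>C (a * b)" for f g and a b :: 'a
    by (rule c0_eqI)
      (simp add: c0_pointwise c0_tensor.rep_eq mult_scaleC_left mult_scaleC_right scaleC_scaleC mult.commute)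
  show "star (f \<otimes>\<^sub>C a) = star f \<otimes>\<^sub>C star a" for f and a :: 'a
    by (rule c0_eqI) (simp add: c0_pointwise c0_tensor.rep_eq star_scaleC star_complex_def)
next
  fix n i :: nat and f :: "nat \<Rightarrow> complex c0" and a :: "nat \<Rightarrow> 'a"
  assume ind: "\<forall>c. (\<Sum>i<n. c i *\<^sub>C a i) = 0 \<longrightarrow> (\<forall>i<n. c i = 0)"
    and zero: "(\<Sum>i<n. f i \<otimes>\<^sub>C a i) = 0" and i: "i < n"
  show "f i = 0"
  proof (rule c0_eqI)
    fix t
    have "(\<Sum>i<n. c0_fun (f i) t *\<^sub>C a i) = 0"
      using arg_cong[OF zero, of "\<lambda>F. c0_fun F t"]
      by (simp add: c0_fun_sum c0_tensor.rep_eq c0_zero)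
    then show "c0_fun (f i) t = c0_fun 0 t"
      using ind[rule_format, of "\<lambda>i. c0_fun (f i) t"] i by (simp add: c0_zero)
  qed
next
  let ?S = "{z :: 'a c0. \<exists>n f a. z = (\<Sum>i<n::nat. f i \<otimes>\<^sub>C a i)}"
  have "F \<in> closure ?S" for F
    unfolding closure_approachable
  proof (intro allI impI)
    fix e :: real assume e: "e > 0"
    obtain n f a where "norm (F - (\<Sum>i<n::nat. f i \<otimes>\<^sub>C a i)) \<le> e / 2"
      using c0_interpolation[of "e / 2" F] e by auto
    then have "dist (\<Sum>i<n. f i \<otimes>\<^sub>C a i) F < e"
      using e by (simp add: dist_norm norm_minus_commute)
    then show "\<exists>y\<in>?S. dist y F < e" by blast
  qed
  then show "closure ?S = UNIV" by blast
qed


section \<open>The mutual assignments\<close>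

definition phi_of :: "('a::cstar_algebra c0 \<Rightarrow> 'b::cstar_algebra) \<Rightarrow> 'a \<Rightarrow> 'b" where
  "phi_of \<rho> a = \<rho> (id_c0 \<otimes>\<^sub>C a)"

definition rho_of :: "('a::cstar_algebra \<Rightarrow> 'b::cstar_algebra) \<Rightarrow> 'a c0 \<Rightarrow> 'b" where
  "rho_of \<phi> = (THE \<rho>. star_hom \<rho> \<and> (\<forall>a. \<rho> (id_c0 \<otimes>\<^sub>C a) = \<phi> a))"

end

theory Submission
  imports Defs "HOL-Computational_Algebra.Polynomial"
begin

text \<open>Let \<open>\<phi>\<close> be c.p.c. order zero. Complete positivity upgrades order zero to \<open>ab = 0 \<Longrightarrow> \<phi>(a)\<phi>(b) = 0\<close>, and
  functional calculus with a partition of unity then gives \<open>\<phi>(xc)\<phi>(y) = \<phi>(x)\<phi>(cy)\<close>. Along left approximate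
  units, \<open>\<psi>\<^sub>k\<^sub>+\<^sub>1(c) = lim \<phi>(e)\<psi>\<^sub>k(c)\<close> with \<open>\<psi>\<^sub>0 = \<phi>\<close> exists and sends \<open>a\<^sub>0\<dots>a\<^sub>k\<close> to \<open>\<phi>(a\<^sub>0)\<dots>\<phi>(a\<^sub>k)\<close>, which
  determines the image of \<open>p \<otimes> c\<close> for every polynomial \<open>p\<close> with \<open>p(0) = 0\<close>. A bound by the supremum norm of
  \<open>p\<close> extends this to \<open>f \<otimes> c\<close> with \<open>f\<close> continuous, and piecewise linear interpolation of the elements of
  the cone extends it to the homomorphism. Conversely \<open>\<rho>(id \<otimes> x\<^sup>*y) = \<rho>(\<surd>id \<otimes> x)\<^sup>*\<rho>(\<surd>id \<otimes> y)\<close> makes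
  \<open>\<phi>\<^sub>\<rho>\<close> completely positive.

  Neither spectra nor representations are needed: norm estimates hold first up to a factor that grows
  subexponentially in the degree, which the C*-identity \<open>\<parallel>x\<^sup>2\<parallel> = \<parallel>x\<parallel>\<^sup>2\<close> for self-adjoint \<open>x\<close> removes.\<close>

text \<open>The classical argument writes \<open>\<phi>\<close> as \<open>h \<pi>\<close>, with
  \<open>h\<close> the value of the bidual extension of \<open>\<phi>\<close> at the unit. Here
  \<open>A\<close> may lack a unit and \<open>h\<close> need not lie in \<open>B\<close>, so
  \<open>h\<close> is seen only through its action on the range of \<open>\<phi>\<close>; for the
  same reason a function of an element \<open>c\<close> is only an operator taking \<open>x\<close>
  to \<open>f(c) x\<close>. Two obstacles shape the estimates. Self-adjointness of \<open>c\<close>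
  bounds \<open>p(c)\<close> by the supremum of \<open>p\<close> over [-1,1], while the cone sees
  only [0,1]; the passage between them rests on \<open>star z * z\<close> having no negative part.
  And bounds on single elementary tensors say nothing uniform about sums of them: the supremum norm
  of the cone is reached by splitting the interpolating hats by parity, so that each half is a sum
  of mutually orthogonal terms whose powers do not mix. Exponents are powers of two throughout
  because the C*-identity is applied by repeated squaring.\<close>

lemma le_of_power_two_power_le:
  fixes y M a b :: real
  assumes "0 \<le> y" "0 \<le> M" and le: "\<And>n. y ^ (2 ^ n) \<le> (a * 2 ^ n + b) * M ^ (2 ^ n)"
  shows "y \<le> M"
proof (rule ccontr)
  assume "\<not> y \<le> M"
  then have yM: "M < y" by simp
  have "M \<noteq> 0" using le[of 0] yM assms(1) by auto
  then have M: "M > 0" using assms(2) by simp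
  define r where "r = y / M"
  have r: "r > 1" using yM M by (simp add: r_def)
  have "(\<lambda>m. a * (real m / r ^ m) + b * inverse (r ^ m)) \<longlonglongrightarrow> a * 0 + b * 0"
    using r by (intro tendsto_add tendsto_mult_left lim_n_over_pown LIMSEQ_inverse_realpow_zero) auto
  then have "(\<lambda>m. a * (real m / r ^ m) + b * inverse (r ^ m)) \<longlonglongrightarrow> 0" by simp
  then have "\<forall>\<^sub>F m in sequentially. a * (real m / r ^ m) + b * inverse (r ^ m) < 1"
    by (rule order_tendstoD) simp
  then obtain m0 where m0: "\<And>m. m \<ge> m0 \<Longrightarrow> a * (real m / r ^ m) + b * inverse (r ^ m) < 1"
    unfolding eventually_sequentially by blast
  \<comment> \<open>\<open>2 ^ m0\<close> is at least \<open>m0\<close>, so the eventual inequality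
    can be read off at an exponent to which the hypothesis applies.\<close>
  have "a * (real (2 ^ m0) / r ^ (2 ^ m0)) + b * inverse (r ^ (2 ^ m0)) < 1"
    by (rule m0) (simp add: less_imp_le)
  then have "a * 2 ^ m0 + b < r ^ (2 ^ m0)"
    using r by (simp add: field_simps)
  also have "\<dots> \<le> a * 2 ^ m0 + b"
    using le[of m0] M by (simp add: r_def power_divide divide_le_eq)
  finally show False by simp
qed

lemma star_scaleR: "star (r *\<^sub>R x) = r *\<^sub>R star (x :: 'a::cstar_algebra)"
  by (simp add: scaleR_scaleC star_scaleC)

lemma norm_mult_star: "norm (x * star x) = (norm (x :: 'a::cstar_algebra))\<^sup>2"
  using cstar_identity[of "star x"] by (simp add: star_star norm_star)

lemma scaleC_scaleR: "c *\<^sub>C (r *\<^sub>R x) = r *\<^sub>R (c *\<^sub>C (x :: 'a::cstar_algebra))"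
  by (simp add: scaleR_scaleC scaleC_scaleC mult.commute)

lemma star_sum: "star (\<Sum>i\<in>I. f i) = (\<Sum>i\<in>I. star (f i :: 'a::cstar_algebra))"
  by (rule linear_sum[OF bounded_linear.linear[OF bounded_linear_star]])

lemmas star_simps = star_add star_diff star_minus star_zero star_mult star_star star_scaleC star_scaleR

lemmas scaleC_simps = scaleC_add_right scaleC_add_left scaleC_diff_right scaleC_diff_left
  scaleC_minus_left scaleC_minus_right scaleC_scaleC mult_scaleC_left mult_scaleC_right
  scaleC_one scaleC_zero_left scaleC_zero_right scaleC_scaleR

lemma star_mult_self_eq_0_iff: "star x * x = 0 \<longleftrightarrow> x = (0 :: 'a::cstar_algebra)"
  using cstar_identity[of x] by auto

lemma mult_star_self_eq_0_iff: "x * star x = 0 \<longleftrightarrow> x = (0 :: 'a::cstar_algebra)"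
  using norm_mult_star[of x] by auto

text \<open>The choice y = \<open>star a\<close> reduces this to the C*-identity. With no unit to
  evaluate at, this is how an element is recovered from its left multiplication operator.\<close>

lemma eq_0_if_annihilates: "(\<And>y. a * y = 0) \<Longrightarrow> a = (0 :: 'a::cstar_algebra)"
  using mult_star_self_eq_0_iff by blast

lemma eq_if_mult_eq:
  fixes a b :: "'a::cstar_algebra"
  assumes "\<And>y. a * y = b * y"
  shows "a = b"
  using eq_0_if_annihilates[of "a - b"] assms by (simp add: left_diff_distrib)

lemma closed_subspace_eq_UNIV:
  assumes "closed S" "closure T = UNIV" "T \<subseteq> S"
  shows "S = UNIV"
  using closure_minimal[OF assms(3,1)] assms(2) by auto

section \<open>Contractivity of *-homomorphisms\<close>

abbreviation squaring :: "nat \<Rightarrow> 'a::times \<Rightarrow> 'a" where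
  "squaring n \<equiv> (\<lambda>x. x * x) ^^ n"

lemma star_squaring: "star x = x \<Longrightarrow> star (squaring n x) = squaring n (x :: 'a::cstar_algebra)"
  by (induction n) (simp_all add: star_mult)

lemma norm_squaring:
  fixes x :: "'a::cstar_algebra"
  assumes "star x = x"
  shows "norm (squaring n x) = norm x ^ (2 ^ n)"
proof (induction n)
  case (Suc n)
  have "norm (squaring n x * squaring n x) = (norm (squaring n x))\<^sup>2"
    using cstar_identity[of "squaring n x"] star_squaring[OF assms] by simp
  then show ?case using Suc by (simp add: power_mult[symmetric] mult.commute)
qed simp

text \<open>\<open>1 - s\<close> is a square root of \<open>1 - c\<^sup>2\<close>, written without a unit.\<close>

lemma ex_sqrt_one_minus_square:
  fixes c :: "'a::cstar_algebra"
  assumes c: "star c = c" "norm c < 1"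
  obtains s where "star s = s" "s * c = c * s" "s + s = c * c + s * s"
proof -
  \<comment> \<open>The equation sought makes \<open>s\<close> a fixed point of \<open>f\<close>.
    Banach's theorem applies on the ball of radius \<open>norm c\<close>, with the same number as
    contraction constant; the other two conditions are closed and preserved by \<open>f\<close>, so
    the fixed point inherits them.\<close>
  define S where "S = {s. norm s \<le> norm c \<and> star s = s \<and> s * c = c * s}"
  define f where "f s = (1/2) *\<^sub>R (c * c + s * s)" for s
  have "closed S"
    unfolding S_def
    by (intro closed_Collect_conj closed_Collect_eq closed_Collect_le continuous_intros)
  then have comp: "complete S" by (simp add: complete_eq_closed)
  have ne: "S \<noteq> {}" by (auto simp: S_def star_zero intro!: exI[of _ 0])
  have inv: "f ` S \<subseteq> S"
  proof (rule image_subsetI)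
    fix s assume s: "s \<in> S"
    have "norm (c * c + s * s) \<le> norm c * norm c + norm s * norm s"
      by (meson norm_triangle_le norm_mult_ineq add_mono)
    also have "\<dots> \<le> norm c * norm c + norm c * norm c"
      using s by (intro add_mono mult_mono) (auto simp: S_def)
    also have "norm c * norm c \<le> norm c * 1"
      using c by (intro mult_left_mono) auto
    finally have "norm (f s) \<le> norm c" by (simp add: f_def)
    moreover have "star (f s) = f s" using s c by (simp add: f_def star_simps S_def)
    moreover have "f s * c = c * f s"
    proof -
      have sc: "s * c = c * s" using s by (simp add: S_def)
      have "s * s * c = c * (s * s)" by (simp add: mult.assoc sc) (simp add: sc flip: mult.assoc)
      then show ?thesis by (simp add: f_def distrib_left distrib_right mult.assoc)
    qed
    ultimately show "f s \<in> S" by (simp add: S_def)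
  qed
  have lip: "dist (f s) (f t) \<le> norm c * dist s t" if st: "s \<in> S" "t \<in> S" for s t
  proof -
    have "f s - f t = (1/2) *\<^sub>R (s * (s - t) + (s - t) * t)"
      by (simp add: f_def algebra_simps flip: scaleR_diff_right)
    also have "norm \<dots> \<le> (1/2) * (norm s * norm (s - t) + norm (s - t) * norm t)"
      by simp (meson norm_triangle_le norm_mult_ineq add_mono)
    also have "\<dots> \<le> (1/2) * (norm c * norm (s - t) + norm (s - t) * norm c)"
      using st by (intro mult_left_mono add_mono mult_right_mono) (auto simp: S_def)
    finally show "dist (f s) (f t) \<le> norm c * dist s t" by (simp add: dist_norm)
  qed
  obtain s where s: "s \<in> S" "f s = s"
    using Banach_fix[OF comp ne norm_ge_zero c(2) inv lip] by auto
  have "s + s = 2 *\<^sub>R f s" using s(2) by (simp add: scaleR_2)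
  then have "s + s = c * c + s * s" by (simp add: f_def)
  then show thesis using that s(1) by (auto simp: S_def)
qed

lemma star_homD:
  assumes "star_hom \<rho>"
  shows "\<rho> (x + y) = \<rho> x + \<rho> y" "\<rho> (c *\<^sub>C x) = c *\<^sub>C \<rho> x" "\<rho> (x * y) = \<rho> x * \<rho> y"
    "\<rho> (star x) = star (\<rho> x)" "\<rho> (r *\<^sub>R x) = r *\<^sub>R \<rho> x"
  using assms by (auto simp: star_hom_def complex_linear_def scaleR_scaleC)

text \<open>\<open>star v * v = v + star v\<close> expresses that \<open>1 - v\<close> is an
  isometry. It forces \<open>(norm v)^2 \<le> 2 * norm v\<close>, a bound that presupposes no
  continuity of \<open>\<rho>\<close>, and \<open>\<rho> x\<close> is the imaginary part of
  \<open>v\<close>.\<close>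

lemma star_hom_norm_selfadjoint_lt_1:
  fixes \<rho> :: "'a::cstar_algebra \<Rightarrow> 'b::cstar_algebra"
  assumes \<rho>: "star_hom \<rho>" and x: "star x = x" "norm x < 1"
  shows "norm (\<rho> x) \<le> 2"
proof -
  obtain s where s: "star s = s" "s * x = x * s" "s + s = x * x + s * s"
    using ex_sqrt_one_minus_square[OF x] .
  \<comment> \<open>\<open>1 - v\<close> would be the unitary \<open>\<surd>(1 - b\<^sup>2) - i b\<close> with \<open>b = \<rho> x\<close>\<close>
  define v where "v = \<rho> s + \<i> *\<^sub>C \<rho> x"
  have sv: "star v = \<rho> s - \<i> *\<^sub>C \<rho> x"
    using s(1) x(1) by (simp add: v_def star_simps star_homD(4)[OF \<rho>, symmetric] scaleC_minus_left)
  have comm: "\<rho> s * \<rho> x = \<rho> x * \<rho> s" using s(2) by (metis star_homD(3)[OF \<rho>])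
  have "star v * v = \<rho> s * \<rho> s + \<rho> x * \<rho> x"
    unfolding sv unfolding v_def using comm by (simp add: scaleC_simps algebra_simps)
  also have "\<dots> = v + star v"
    unfolding sv unfolding v_def using arg_cong[OF s(3), of \<rho>] by (simp add: star_homD[OF \<rho>] add.commute)
  finally have "(norm v)\<^sup>2 \<le> norm v + norm v"
    using cstar_identity[of v] norm_triangle_ineq[of v "star v"] by (simp add: norm_star)
  then have v: "norm v \<le> 2"
    by (metis mult_2 mult_le_cancel_right norm_ge_zero order_less_le power2_eq_square zero_le_numeral not_le)
  have "2 * norm (\<rho> x) = norm (v - star v)"
  proof -
    have "v - star v = (2 * \<i>) *\<^sub>C \<rho> x"
      unfolding sv using scaleC_add_left[of \<i> \<i> "\<rho> x"] by (simp add: v_def)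
    then show ?thesis by (simp add: norm_scaleC norm_mult)
  qed
  also have "\<dots> \<le> norm v + norm v" using norm_triangle_ineq4[of v "star v"] by (simp add: norm_star)
  finally show ?thesis using v by simp
qed

lemma star_hom_norm_selfadjoint:
  fixes \<rho> :: "'a::cstar_algebra \<Rightarrow> 'b::cstar_algebra"
  assumes \<rho>: "star_hom \<rho>" and x: "star x = x"
  shows "norm (\<rho> x) \<le> 4 * norm x"
proof (cases "x = 0")
  case True
  then show ?thesis using star_homD(1)[OF \<rho>, of 0 0] by simp
next
  case False
  \<comment> \<open>Norm 1/2 is strictly inside the unit ball; undoing the scaling doubles the
    constant 2.\<close>
  let ?r = "1 / (2 * norm x)"
  have "norm (\<rho> (?r *\<^sub>R x)) \<le> 2"
    by (rule star_hom_norm_selfadjoint_lt_1[OF \<rho>]) (use x False in \<open>simp_all add: star_scaleR\<close>)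
  then show ?thesis using False by (simp add: star_homD(5)[OF \<rho>] divide_le_eq)
qed

text \<open>A homomorphism commutes with squaring, so taking roots of order \<open>2 ^ n\<close>
  wears the constant 4 down to 1 on self-adjoint elements; the C*-identity passes from
  \<open>star x * x\<close> to \<open>x\<close>.\<close>

lemma star_hom_norm_le:
  fixes \<rho> :: "'a::cstar_algebra \<Rightarrow> 'b::cstar_algebra"
  assumes \<rho>: "star_hom \<rho>"
  shows "norm (\<rho> x) \<le> norm x"
proof -
  have sq: "\<rho> (squaring n y) = squaring n (\<rho> y)" for n y
    by (induction n) (simp_all add: star_homD(3)[OF \<rho>])
  have sa: "norm (\<rho> y) \<le> norm y" if y: "star y = y" for y
  proof (rule le_of_power_two_power_le[where a = 0 and b = 4])
    fix n
    have "star (\<rho> y) = \<rho> y" using y by (simp flip: star_homD(4)[OF \<rho>])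
    then have "norm (\<rho> y) ^ 2 ^ n = norm (\<rho> (squaring n y))" by (simp add: norm_squaring sq)
    also have "\<dots> \<le> 4 * norm (squaring n y)"
      by (intro star_hom_norm_selfadjoint[OF \<rho>] star_squaring y)
    finally show "norm (\<rho> y) ^ 2 ^ n \<le> (0 * 2 ^ n + 4) * norm y ^ 2 ^ n"
      by (simp add: norm_squaring y)
  qed simp_all
  have "(norm (\<rho> x))\<^sup>2 = norm (\<rho> (star x * x))"
    by (simp add: star_homD[OF \<rho>] cstar_identity)
  also have "\<dots> \<le> (norm x)\<^sup>2" using sa[of "star x * x"] by (simp add: star_simps cstar_identity)
  finally show ?thesis by (rule power2_le_imp_le) simp
qed

section \<open>Polynomials in a self-adjoint element\<close>

text \<open>Taking for \<open>T\<close> the left multiplication by \<open>c\<close> makes sense of \<open>p(c) x\<close> without a unit.\<close>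

definition opoly :: "('v::real_vector \<Rightarrow> 'v) \<Rightarrow> real poly \<Rightarrow> 'v \<Rightarrow> 'v" where
  "opoly T p x = fold_coeffs (\<lambda>a y. a *\<^sub>R x + T y) p 0"

lemma opoly_0 [simp]: "opoly T 0 x = 0"
  by (simp add: opoly_def)

lemma opoly_pCons [simp]:
  assumes "linear T"
  shows "opoly T (pCons a p) x = a *\<^sub>R x + T (opoly T p x)"
  using linear_0[OF assms] by (cases "p = 0 \<and> a = 0") (auto simp: opoly_def)

lemma opoly_add:
  assumes "linear T"
  shows "opoly T (p + q) x = opoly T p x + opoly T q x"
  by (induction p q rule: poly_induct2)
    (simp_all add: assms linear_add[OF assms] algebra_simps)

lemma opoly_smult:
  assumes "linear T"
  shows "opoly T (Polynomial.smult r p) x = r *\<^sub>R opoly T p x"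
  by (induction p) (simp_all add: assms linear_scale[OF assms] algebra_simps)

lemma opoly_intertwine:
  assumes "linear T" "linear T'" "linear S" "\<And>x. S (T x) = T' (S x)"
  shows "S (opoly T p x) = opoly T' p (S x)"
  by (induction p)
    (simp_all add: assms linear_add[OF assms(3)] linear_scale[OF assms(3)] linear_0[OF assms(3)])

lemma linear_opoly:
  assumes "linear T"
  shows "linear (opoly T p)"
proof (induction p)
  case 0
  then show ?case by (simp add: linear_iff)
next
  case (pCons a p)
  then show ?case
    by (simp add: assms linear_iff linear_add[OF assms] linear_scale[OF assms] algebra_simps)
qed

lemma opoly_mult:
  assumes "linear T"
  shows "opoly T (p * q) x = opoly T p (opoly T q x)"
  by (induction p) (simp_all add: assms opoly_add opoly_smult)

lemma linear_mult_left: "linear ((*) (c :: 'a::real_algebra))"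
  by (simp add: linear_iff algebra_simps)

lemmas linear_mult = linear_mult_left[where 'a = "'a::cstar_algebra"]

lemma opoly_mult_right: "opoly ((*) c) p x * y = opoly ((*) c) p (x * (y :: 'a::cstar_algebra))"
  by (rule opoly_intertwine[where S = "\<lambda>x. x * y"])
    (simp_all add: linear_mult linear_iff algebra_simps)

lemma opoly_mult_commute: "opoly ((*) c) p (c * x) = c * opoly ((*) c) p (x :: 'a::cstar_algebra)"
  by (rule opoly_intertwine[where S = "(*) c", symmetric]) (simp_all add: linear_mult)

text \<open>Real coefficients make p(c) self-adjoint. As p(c) need not be an element of the algebra,
  this is expressed by moving it across the algebra-valued inner product
  \<open>star x * y\<close>.\<close>

lemma opoly_star:
  fixes c :: "'a::cstar_algebra"
  assumes "star c = c"
  shows "star (opoly ((*) c) p x) * y = star x * opoly ((*) c) p y"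
proof (induction p arbitrary: y)
  case (pCons a p)
  have "star (c * opoly ((*) c) p x) * y = star (opoly ((*) c) p x) * (c * y)"
    using assms by (simp add: star_mult mult.assoc)
  also have "\<dots> = star x * (c * opoly ((*) c) p y)"
    by (simp add: pCons.IH opoly_mult_commute)
  finally show ?case
    by (simp add: linear_mult star_simps distrib_left distrib_right)
qed (simp add: star_zero)

section \<open>Sharp supremum norm bounds for polynomials in a self-adjoint contraction\<close>

lemma sum_powers_root_of_unity:
  fixes v :: complex
  assumes "v ^ N = 1" "v \<noteq> 1"
  shows "(\<Sum>k<N. v ^ k) = 0"
  using assms by (simp add: geometric_sum)

text \<open>Cauchy's estimate with the contour integral replaced by an average over the N-th roots
  of unity, which isolates a coefficient exactly once N exceeds the degree.\<close>

lemma coeff_le_bound_on_circle: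
  fixes g :: "complex poly"
  assumes M: "\<And>z. cmod z = 1 \<Longrightarrow> cmod (poly g z) \<le> M"
  shows "cmod (coeff g m) \<le> M"
proof (cases "m \<le> degree g")
  case False
  have "0 \<le> cmod (poly g 1)" by simp
  also have "\<dots> \<le> M" by (rule M) simp
  finally show ?thesis using False by (simp add: coeff_eq_0)
next
  case m: True
  define N where "N = Suc (degree g)"
  define w where "w = cis (2 * pi / real N)"
  have N: "N > 0" "m < N" using m by (auto simp: N_def)
  have wk: "w ^ k = cis (2 * pi * real k / real N)" for k
    unfolding w_def Complex.DeMoivre by (rule arg_cong[where f = cis]) simp
  have wN: "w ^ N = 1" using N by (simp add: wk)
  have w1: "w ^ k \<noteq> 1" if "0 < k" "k < N" for k
  proof
    assume "w ^ k = 1"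
    then have eq: "cis (2 * pi * real k / real N) = cis (2 * pi * real 0 / real N)" by (simp add: wk)
    have "inj_on (\<lambda>k. cis (2 * pi * real k / real N)) {..<N}"
      using Complex.bij_betw_roots_unity[OF N(1)] by (simp add: bij_betw_def)
    from inj_onD[OF this eq] show False using that by simp
  qed
  \<comment> \<open>The exponent \<open>N - m + i\<close> is a natural number that represents
    \<open>i - m\<close> modulo N.\<close>
  have geo: "(\<Sum>k<N. (w ^ (N - m + i)) ^ k) = (if i = m then of_nat N else 0)" if "i < N" for i
  proof (cases "i = m")
    case True
    then show ?thesis using N by (simp add: wN)
  next
    case False
    have "w ^ (N - m + i) \<noteq> 1"
    proof (cases "i < m")
      case True
      then show ?thesis using N by (intro w1) auto
    next
      case i: False
      then have "N - m + i = N + (i - m)" using N by simp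
      then have "w ^ (N - m + i) = w ^ (i - m)" by (simp add: power_add wN)
      then show ?thesis using i False that by (simp add: w1)
    qed
    moreover have "(w ^ (N - m + i)) ^ N = 1"
      by (metis power_mult mult.commute wN power_one)
    ultimately show ?thesis using False by (simp add: sum_powers_root_of_unity)
  qed
  have "(\<Sum>k<N. (w ^ k) ^ (N - m) * poly g (w ^ k))
      = (\<Sum>k<N. \<Sum>i<N. coeff g i * (w ^ (N - m + i)) ^ k)"
    unfolding poly_altdef N_def[symmetric] lessThan_Suc_atMost[symmetric] sum_distrib_left
    by (intro sum.cong refl) (simp add: power_add power_mult[symmetric] mult_ac power_mult_distrib)
  also have "\<dots> = (\<Sum>i<N. coeff g i * (\<Sum>k<N. (w ^ (N - m + i)) ^ k))"
    by (subst sum.swap) (simp add: sum_distrib_left)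
  also have "\<dots> = (\<Sum>i<N. if i = m then coeff g i * of_nat N else 0)"
    by (intro sum.cong refl) (simp add: geo)
  also have "\<dots> = coeff g m * of_nat N" using N by simp
  finally have "cmod (coeff g m) * real N = cmod (\<Sum>k<N. (w ^ k) ^ (N - m) * poly g (w ^ k))"
    by (simp add: norm_mult)
  also have "\<dots> \<le> (\<Sum>k<N. M)"
    by (intro sum_norm_le) (simp add: norm_mult norm_power w_def M)
  finally show ?thesis using N by (simp add: mult.commute)
qed

text \<open>Plain triangle inequality over the n + 1 terms, each of size at most
  \<open>M * norm x\<close>. This is where the factor linear in the degree arises.\<close>

lemma norm_opoly_le_isometry:
  fixes U :: "'v::real_normed_vector \<Rightarrow> 'v"
  assumes U: "linear U" "\<And>x. norm (U x) = norm x"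
  shows "degree g \<le> n \<Longrightarrow> (\<And>i. \<bar>coeff g i\<bar> \<le> M) \<Longrightarrow> norm (opoly U g x) \<le> (n + 1) * M * norm x"
proof (induction n arbitrary: g)
  case 0
  then obtain a where "g = [:a:]" by (metis degree_0_id le_zero_eq)
  then show ?case using 0(2)[of 0] U by (simp add: linear_0 mult_right_mono)
next
  case (Suc n)
  obtain a h where g: "g = pCons a h" by (cases g)
  have "norm (opoly U g x) \<le> \<bar>a\<bar> * norm x + norm (opoly U h x)"
    using norm_triangle_ineq[of "a *\<^sub>R x" "U (opoly U h x)"] U by (simp add: g)
  also have "\<dots> \<le> M * norm x + (real n + 1) * M * norm x"
  proof (rule add_mono)
    show "\<bar>a\<bar> * norm x \<le> M * norm x"
      using Suc.prems(2)[of 0] by (simp add: g mult_right_mono)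
    have "\<bar>coeff h i\<bar> \<le> M" for i using Suc.prems(2)[of "Suc i"] by (simp add: g)
    moreover have "degree h \<le> n" using Suc.prems(1) by (simp add: g split: if_splits)
    ultimately show "norm (opoly U h x) \<le> (real n + 1) * M * norm x" using Suc.IH by blast
  qed
  finally show ?case by (simp add: algebra_simps)
qed

text \<open>\<open>U\<close> is left multiplication by \<open>c + i sqrt(1 - c^2)\<close>, a unitary
  of the unitization with real part \<open>c\<close>, and \<open>V\<close> is its adjoint; the root
  is \<open>1 - s\<close>.\<close>

lemma selfadjoint_unitary:
  fixes c :: "'a::cstar_algebra"
  assumes c: "star c = c" "norm c < 1"
  obtains U V :: "'a \<Rightarrow> 'a" where "linear U" "\<And>x. norm (U x) = norm x"
    "\<And>x. U (V x) = x" "\<And>x. c * x = (1/2) *\<^sub>R (U x + V x)"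
proof -
  obtain s where s: "star s = s" "s * c = c * s" "s + s = c * c + s * s"
    using ex_sqrt_one_minus_square[OF c] .
  define U where "U x = c * x + \<i> *\<^sub>C (x - s * x)" for x
  define V where "V x = c * x - \<i> *\<^sub>C (x - s * x)" for x
  have sc: "s * (c * x) = c * (s * x)" for x using s(2) by (metis mult.assoc)
  have ss: "s * x + s * x = c * (c * x) + s * (s * x)" for x
    using arg_cong[OF s(3), of "\<lambda>y. y * x"] by (simp add: distrib_right mult.assoc)
  have UV: "U (V x) = x" and VU: "V (U x) = x" for x
    using ss[of x] by (simp_all add: U_def V_def scaleC_simps algebra_simps sc)
  have "star (U x) * U x = star x * V (U x)" for x
    using c(1) s(1) by (simp add: U_def V_def scaleC_simps star_simps algebra_simps)
  then have "(norm (U x))\<^sup>2 = (norm x)\<^sup>2" for x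
    using cstar_identity[of "U x"] cstar_identity[of x] by (simp add: VU)
  then have "norm (U x) = norm x" for x by (simp add: power2_eq_iff_nonneg)
  moreover have "linear U" by (simp add: linear_iff U_def scaleC_simps algebra_simps)
  moreover have "c * x = (1/2) *\<^sub>R (U x + V x)" for x
    by (simp add: U_def V_def flip: scaleR_2)
  ultimately show thesis using UV that by blast
qed

text \<open>On the unit circle \<open>z + 1/z = 2 Re z\<close>; multiplying \<open>p((z + 1/z)/2)\<close> by \<open>z\<^sup>n\<close> makes it a polynomial.\<close>

lemma opoly_lift_to_unitary:
  fixes T U V :: "'v::real_vector \<Rightarrow> 'v"
  assumes U: "linear U" "\<And>x. U (V x) = x" and T: "linear T" "\<And>x. T x = (1/2) *\<^sub>R (U x + V x)"
  shows "degree p \<le> n \<Longrightarrow> \<exists>g. degree g \<le> 2 * n \<and> (\<forall>x. opoly U g x = (U ^^ n) (opoly T p x)) \<and>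
    (\<forall>z. cmod z = 1 \<longrightarrow> poly (map_poly complex_of_real g) z = z ^ n * of_real (poly p (Re z)))"
proof (induction n arbitrary: p)
  case 0
  then obtain a where "p = [:a:]" by (metis degree_0_id le_zero_eq)
  then show ?case
    by (intro exI[of _ "[:a:]"])
      (simp add: U(1) T(1) linear_0[OF U(1)] linear_0[OF T(1)] map_poly_pCons)
next
  case (Suc n)
  obtain a q where p: "p = pCons a q" by (cases p)
  have "degree q \<le> n" using Suc.prems by (simp add: p split: if_splits)
  then obtain h where h: "degree h \<le> 2 * n" "\<And>x. opoly U h x = (U ^^ n) (opoly T q x)"
    "\<And>z. cmod z = 1 \<Longrightarrow> poly (map_poly complex_of_real h) z = z ^ n * of_real (poly q (Re z))"
    using Suc.IH by blast
  \<comment> \<open>For p = a + t q the factor \<open>z ^ Suc n\<close> turns \<open>a\<close> into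
    the monomial, while one of its factors z turns t = (z + 1/z)/2 into (1 + z^2)/2; the remaining
    \<open>z ^ n\<close> is already in \<open>h\<close>.\<close>
  define g where "g = monom a (Suc n) + [:1/2, 0, 1/2:] * h"
  have lin: "linear (U ^^ k)" for k
    by (induction k) (simp_all add: U(1) linear_compose linear_id[unfolded id_def] linear_iff linear_add[OF U(1)] linear_scale[OF U(1)])
  have mon: "opoly U (monom a k) x = (U ^^ k) (a *\<^sub>R x)" for k x
    by (induction k) (simp_all add: U monom_Suc monom_0 linear_0)
  have UT: "U (T y) = (1/2) *\<^sub>R (U (U y) + y)" for y
    by (simp add: T(2) linear_scale[OF U(1)] linear_add[OF U(1)] U(2))
  have "opoly U g x = (U ^^ Suc n) (opoly T p x)" for x
  proof -
    have "(U ^^ Suc n) (opoly T p x) = (U ^^ Suc n) (a *\<^sub>R x) + (U ^^ n) (U (T (opoly T q x)))"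
      by (simp add: p T(1) linear_add[OF U(1)] linear_add[OF lin] funpow_swap1)
    also have "(U ^^ n) (U (T (opoly T q x))) = (1/2) *\<^sub>R (U (U (opoly U h x)) + opoly U h x)"
      unfolding UT h(2) by (simp add: linear_scale[OF lin] linear_add[OF lin] funpow_swap1)
    finally show ?thesis
      by (simp only: g_def opoly_add[OF U(1)] mon opoly_mult[OF U(1)])
        (simp add: U(1) linear_0[OF U(1)] linear_scale[OF U(1)] algebra_simps)
  qed
  moreover have "poly (map_poly complex_of_real g) z = z ^ Suc n * of_real (poly p (Re z))"
    if z: "cmod z = 1" for z
  proof -
    have "z * cnj z = 1" using complex_norm_square[of z] z by simp
    then have "1 + z * z = z * (z + cnj z)" by (simp add: distrib_left add.commute)
    then have "1 + z * z = z * of_real (2 * Re z)" by (simp only: complex_add_cnj)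
    then have "poly (map_poly complex_of_real [:1/2, 0, 1/2:]) z = z * of_real (Re z)"
      by (simp add: map_poly_pCons field_simps)
    moreover have "map_poly complex_of_real g
        = monom (of_real a) (Suc n) + map_poly of_real [:1/2, 0, 1/2:] * map_poly of_real h"
      unfolding g_def
      by (rule poly_eqI) (simp add: coeff_map_poly coeff_mult del: mult_pCons_left)
    ultimately show ?thesis
      by (simp add: h(3)[OF z] poly_monom p algebra_simps)
  qed
  moreover have "degree g \<le> 2 * Suc n"
    unfolding g_def
  proof (rule degree_add_le)
    show "degree (monom a (Suc n)) \<le> 2 * Suc n" by (rule order_trans[OF degree_monom_le]) simp
    show "degree ([:1/2, 0, 1/2:] * h) \<le> 2 * Suc n"
      using h(1) degree_mult_le[of "[:1/2, 0, 1/2:]" h] by simp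
  qed
  ultimately show ?case by blast
qed

text \<open>On the unit circle the lifted polynomial has modulus
  \<open>\<bar>poly p (Re z)\<bar>\<close>, so each of its at most 2n + 1 coefficients is bounded by
  M.\<close>

lemma norm_opoly_le_degree:
  fixes c :: "'a::cstar_algebra"
  assumes c: "star c = c" "norm c < 1"
    and p: "degree p \<le> n" "\<And>t. t \<in> {-1..1} \<Longrightarrow> \<bar>poly p t\<bar> \<le> M"
  shows "norm (opoly ((*) c) p x) \<le> (2 * n + 1) * M * norm x"
proof -
  obtain U V :: "'a \<Rightarrow> 'a" where U: "linear U" "\<And>x. norm (U x) = norm x"
    "\<And>x. U (V x) = x" "\<And>x. c * x = (1/2) *\<^sub>R (U x + V x)"
    using selfadjoint_unitary[OF c] by blast
  obtain g where g: "degree g \<le> 2 * n" "\<And>x. opoly U g x = (U ^^ n) (opoly ((*) c) p x)"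
    "\<And>z. cmod z = 1 \<Longrightarrow> poly (map_poly complex_of_real g) z = z ^ n * of_real (poly p (Re z))"
    using opoly_lift_to_unitary[OF U(1,3) linear_mult U(4) p(1)] by blast
  have iso: "norm ((U ^^ k) y) = norm y" for k y by (induction k) (simp_all add: U(2))
  have "\<bar>coeff g i\<bar> \<le> M" for i
  proof -
    have "cmod (poly (map_poly complex_of_real g) z) \<le> M" if "cmod z = 1" for z
      using p(2)[of "Re z"] abs_Re_le_cmod[of z] that
      by (simp add: g(3) norm_mult norm_power abs_le_iff)
    then have "cmod (coeff (map_poly complex_of_real g) i) \<le> M" by (rule coeff_le_bound_on_circle)
    then show ?thesis by (simp add: coeff_map_poly)
  qed
  then have "norm (opoly U g x) \<le> real (2 * n + 1) * M * norm x"
    using norm_opoly_le_isometry[OF U(1,2) g(1), of M x] by (simp add: add.commute)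
  then show ?thesis by (simp add: g(2) iso add.commute)
qed

text \<open>The C*-identity for the vector p(c) x: moving one p(c) across the inner product leaves
  \<open>star x\<close> times p(c)^2 x.\<close>

lemma norm_opoly_square:
  fixes c :: "'a::cstar_algebra"
  assumes "star c = c"
  shows "(norm (opoly ((*) c) p x))\<^sup>2 \<le> norm x * norm (opoly ((*) c) (p * p) x)"
proof -
  have "star (opoly ((*) c) p x) * opoly ((*) c) p x = star x * opoly ((*) c) (p * p) x"
    by (simp add: opoly_star[OF assms] opoly_mult linear_mult)
  then show ?thesis
    using norm_mult_ineq[of "star x" "opoly ((*) c) (p * p) x"]
    by (simp add: norm_star flip: cstar_identity)
qed

text \<open>The bound above is off by a factor linear in the degree, which disappears on passing to high powers
  of \<open>p\<close> by the C*-identity.\<close>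

lemma norm_opoly_le_lt_1:
  fixes c :: "'a::cstar_algebra"
  assumes c: "star c = c" "norm c < 1" and M: "\<And>t. t \<in> {-1..1} \<Longrightarrow> \<bar>poly p t\<bar> \<le> M"
  shows "norm (opoly ((*) c) p x) \<le> M * norm x"
proof (rule le_of_power_two_power_le)
  have "0 \<le> \<bar>poly p 0\<bar>" by simp
  also have "\<dots> \<le> M" by (rule M) simp
  finally show M0: "0 \<le> M * norm x" by simp
  fix n
  \<comment> \<open>The spare factor \<open>norm x\<close> on the left avoids the exponent
    \<open>2 ^ n - 1\<close> on the right and any division in the induction.\<close>
  have *: "norm (opoly ((*) c) p x) ^ (2 ^ n) * norm x \<le> norm x ^ (2 ^ n) * norm (opoly ((*) c) (p ^ (2 ^ n)) x)" for p
  proof (induction n arbitrary: p)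
    case (Suc n)
    have "norm (opoly ((*) c) p x) ^ (2 ^ Suc n) * norm x = ((norm (opoly ((*) c) p x))\<^sup>2) ^ (2 ^ n) * norm x"
      by (simp add: power_mult)
    also have "\<dots> \<le> (norm x * norm (opoly ((*) c) (p * p) x)) ^ (2 ^ n) * norm x"
      by (intro mult_right_mono power_mono norm_opoly_square c) auto
    also have "\<dots> = norm x ^ (2 ^ n) * (norm (opoly ((*) c) (p * p) x) ^ (2 ^ n) * norm x)"
      by (simp add: power_mult_distrib)
    also have "\<dots> \<le> norm x ^ (2 ^ n) * (norm x ^ (2 ^ n) * norm (opoly ((*) c) ((p * p) ^ (2 ^ n)) x))"
      by (intro mult_left_mono Suc.IH) simp
    finally show ?case by (simp add: power_add power2_eq_square mult_2 power_mult_distrib mult.assoc)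
  qed simp
  have "norm (opoly ((*) c) (p ^ (2 ^ n)) x) \<le> (2 * (degree p * 2 ^ n) + 1) * M ^ (2 ^ n) * norm x"
    by (rule order_trans[OF norm_opoly_le_degree[OF c degree_power_le, where M = "M ^ (2 ^ n)"]])
      (use M in \<open>auto simp: power_abs add.commute intro!: power_mono\<close>)
  then have "norm (opoly ((*) c) p x) ^ (2 ^ n) * norm x
      \<le> norm x ^ (2 ^ n) * ((2 * (degree p * 2 ^ n) + 1) * M ^ (2 ^ n) * norm x)"
    by (intro order_trans[OF *] mult_left_mono) auto
  then have "norm (opoly ((*) c) p x) ^ (2 ^ n) * norm x
      \<le> ((2 * real (degree p)) * 2 ^ n + 1) * (M * norm x) ^ (2 ^ n) * norm x"
    by (simp add: power_mult_distrib mult_ac add.commute)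
  then show "norm (opoly ((*) c) p x) ^ (2 ^ n) \<le> ((2 * real (degree p)) * 2 ^ n + 1) * (M * norm x) ^ (2 ^ n)"
    by (cases "norm x = 0") (auto simp: linear_0[OF linear_opoly[OF linear_mult]] mult_le_cancel_right power_0_left)
qed simp

text \<open>The fixed point behind the square root requires \<open>norm c < 1\<close>; the boundary
  case follows by continuity of p(c) x in \<open>c\<close>, along multiples
  \<open>r n *\<^sub>R c\<close> with \<open>r n\<close> tending to 1.\<close>

lemma norm_opoly_le:
  fixes c :: "'a::cstar_algebra"
  assumes c: "star c = c" "norm c \<le> 1" and M: "\<And>t. t \<in> {-1..1} \<Longrightarrow> \<bar>poly p t\<bar> \<le> M"
  shows "norm (opoly ((*) c) p x) \<le> M * norm x"
proof -
  define r where "r n = 1 - inverse (real (Suc n))" for n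
  have r1: "r \<longlonglongrightarrow> 1"
    unfolding r_def using tendsto_diff[OF tendsto_const LIMSEQ_inverse_real_of_nat, of 1] by simp
  have "(\<lambda>n. opoly ((*) (r n *\<^sub>R c)) p x) \<longlonglongrightarrow> opoly ((*) c) p x"
  proof (induction p)
    case (pCons a p)
    have "(\<lambda>n. a *\<^sub>R x + (r n *\<^sub>R c) * opoly ((*) (r n *\<^sub>R c)) p x) \<longlonglongrightarrow> a *\<^sub>R x + (1 *\<^sub>R c) * opoly ((*) c) p x"
      by (intro tendsto_intros r1 pCons.IH)
    then show ?case unfolding opoly_pCons[OF linear_mult] by simp
  qed simp
  moreover have "norm (opoly ((*) (r n *\<^sub>R c)) p x) \<le> M * norm x" for n
  proof (rule norm_opoly_le_lt_1)
    show "star (r n *\<^sub>R c) = r n *\<^sub>R c" using c by (simp add: star_scaleR)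
    have r: "0 \<le> r n" "r n < 1" by (auto simp: r_def field_simps)
    have "norm (r n *\<^sub>R c) \<le> r n * 1" using r c by (simp add: mult_left_le)
    then show "norm (r n *\<^sub>R c) < 1" using r by simp
  qed (rule M)
  ultimately show ?thesis by (intro Lim_bounded[OF tendsto_norm, of _ _ 0]) auto
qed

section \<open>Continuous functional calculus\<close>

definition near_poly :: "(real \<Rightarrow> real) \<Rightarrow> real poly \<Rightarrow> real \<Rightarrow> bool" where
  "near_poly f p e \<longleftrightarrow> (\<forall>t\<in>{-1..1}. \<bar>f t - poly p t\<bar> \<le> e)"

lemma ex_near_poly:
  assumes "continuous_on {-1..1} f" "e > 0"
  shows "\<exists>p. near_poly f p e"
proof -
  obtain g where g: "real_polynomial_function g" "\<And>t. t \<in> {-1..1} \<Longrightarrow> \<bar>f t - g t\<bar> < e"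
    using Stone_Weierstrass_real_polynomial_function[OF compact_Icc assms] by blast
  obtain a n where "g = (\<lambda>x. \<Sum>i\<le>n. a i * x ^ i)"
    using g(1) by (auto simp: real_polynomial_function_iff_sum)
  then have "g t = poly (\<Sum>i\<le>n. monom (a i) i) t" for t by (simp add: poly_sum poly_monom)
  then show ?thesis using g(2) unfolding near_poly_def by (metis less_imp_le)
qed

lemma near_poly_add: "near_poly f p d \<Longrightarrow> near_poly g q e \<Longrightarrow> near_poly (\<lambda>t. f t + g t) (p + q) (d + e)"
  unfolding near_poly_def poly_add by (smt (verit))

lemma near_poly_smult: "near_poly f p e \<Longrightarrow> near_poly (\<lambda>t. r * f t) (Polynomial.smult r p) (\<bar>r\<bar> * e)"
  unfolding near_poly_def poly_smult
  by (auto simp: abs_mult mult_left_mono simp flip: right_diff_distrib)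

lemma near_poly_self: "near_poly (poly p) p 0"
  by (simp add: near_poly_def)

lemma near_poly_bound:
  assumes "near_poly f p e" "\<And>t. t \<in> {-1..1} \<Longrightarrow> \<bar>f t\<bar> \<le> B" "t \<in> {-1..1}"
  shows "\<bar>poly p t\<bar> \<le> B + e"
  using assms(1)[unfolded near_poly_def, rule_format, OF assms(3)] assms(2)[OF assms(3)] by linarith

lemma near_poly_nonneg: "near_poly f p e \<Longrightarrow> 0 \<le> e"
  unfolding near_poly_def by (force dest: bspec[of _ _ 0])

lemma near_poly_mult:
  assumes p: "near_poly f p e" and q: "near_poly g q e"
    and F: "\<And>t. t \<in> {-1..1} \<Longrightarrow> \<bar>poly p t\<bar> \<le> F" and G: "\<And>t. t \<in> {-1..1} \<Longrightarrow> \<bar>g t\<bar> \<le> G"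
  shows "near_poly (\<lambda>t. f t * g t) (p * q) (e * G + F * e)"
  unfolding near_poly_def
proof
  fix t :: real assume t: "t \<in> {-1..1}"
  have e: "0 \<le> e" by (rule near_poly_nonneg[OF p])
  have F0: "0 \<le> F" using F[of 0] by simp
  have "f t * g t - poly (p * q) t = (f t - poly p t) * g t + poly p t * (g t - poly q t)"
    by (simp add: algebra_simps)
  also have "\<bar>\<dots>\<bar> \<le> \<bar>f t - poly p t\<bar> * \<bar>g t\<bar> + \<bar>poly p t\<bar> * \<bar>g t - poly q t\<bar>"
    by (rule order_trans[OF abs_triangle_ineq]) (simp add: abs_mult)
  also have "\<dots> \<le> e * G + F * e"
    using p q t F[OF t] G[OF t] e F0 by (intro add_mono mult_mono) (auto simp: near_poly_def)
  finally show "\<bar>f t * g t - poly (p * q) t\<bar> \<le> e * G + F * e" .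
qed

lemma continuous_bounded_on_Icc:
  fixes f :: "real \<Rightarrow> real"
  assumes "continuous_on {-1..1} f"
  obtains F where "\<And>t. t \<in> {-1..1} \<Longrightarrow> \<bar>f t\<bar> \<le> F"
  using compact_imp_bounded[OF compact_continuous_image[OF assms compact_Icc]]
  unfolding bounded_iff by (metis image_eqI real_norm_def)

text \<open>Dropping the constant term of an e/2-approximation costs at most another e/2, since that
  term approximates f(0) = 0.\<close>

lemma ex_near_poly_vanishing:
  assumes f: "continuous_on {-1..1} f" "f 0 = 0" and e: "e > 0"
  obtains p where "near_poly f (pCons 0 p) e"
proof -
  obtain q where q: "near_poly f q (e / 2)" using ex_near_poly[OF f(1), of "e / 2"] e by auto
  obtain a p where p: "q = pCons a p" by (cases q)
  have "\<bar>f 0 - poly q 0\<bar> \<le> e / 2" using q unfolding near_poly_def by force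
  then have a: "\<bar>a\<bar> \<le> e / 2" by (simp add: f(2) p)
  have "near_poly f (pCons 0 p) e"
    unfolding near_poly_def
  proof
    fix t :: real assume "t \<in> {-1..1}"
    then have "\<bar>f t - (a + t * poly p t)\<bar> \<le> e / 2" using q by (simp add: near_poly_def p)
    then have "\<bar>f t - t * poly p t\<bar> \<le> e" using a by linarith
    then show "\<bar>f t - poly (pCons 0 p) t\<bar> \<le> e" by simp
  qed
  then show thesis by (rule that)
qed

text \<open>The common interface of two calculi: p(c) x as a function of p, and the image of p
  \<otimes> c under the homomorphism under construction.\<close>

definition sup_bounded :: "(real poly \<Rightarrow> 'b::real_normed_vector) \<Rightarrow> real \<Rightarrow> bool" where
  "sup_bounded L M \<longleftrightarrow> (\<forall>p q. L (p + q) = L p + L q) \<and> (\<forall>r p. L (Polynomial.smult r p) = r *\<^sub>R L p) \<and>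
    (\<forall>p B. (\<forall>t\<in>{-1..1}. \<bar>poly p t\<bar> \<le> B) \<longrightarrow> norm (L p) \<le> M * B)"

lemma sup_boundedD:
  assumes "sup_bounded L M"
  shows "L (p + q) = L p + L q" "L (Polynomial.smult r p) = r *\<^sub>R L p"
    "(\<And>t. t \<in> {-1..1} \<Longrightarrow> \<bar>poly p t\<bar> \<le> B) \<Longrightarrow> norm (L p) \<le> M * B" "0 \<le> M" "L (p - q) = L p - L q"
proof -
  show 1: "L (p + q) = L p + L q" "L (Polynomial.smult r p) = r *\<^sub>R L p" for p q r
    using assms by (auto simp: sup_bounded_def)
  show 2: "(\<And>t. t \<in> {-1..1} \<Longrightarrow> \<bar>poly p t\<bar> \<le> B) \<Longrightarrow> norm (L p) \<le> M * B" for p B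
    using assms by (auto simp: sup_bounded_def)
  have "0 \<le> norm (L 0)" by simp
  also have "\<dots> \<le> M * 1" by (rule 2) simp
  finally show "0 \<le> M" by simp
  show "L (p - q) = L p - L q" using 1(1)[of "p - q" q] by simp
qed

text \<open>The extension of \<open>L\<close> by density of polynomials. The chosen approximants are
  immaterial: \<open>cext_near\<close> controls the distance to every approximant, and the
  properties below are drawn from it.\<close>

definition cext :: "(real poly \<Rightarrow> 'b::real_normed_vector) \<Rightarrow> (real \<Rightarrow> real) \<Rightarrow> 'b" where
  "cext L f = lim (\<lambda>n. L (SOME p. near_poly f p (1 / Suc n)))"

lemma cext_near:
  fixes L :: "real poly \<Rightarrow> 'b::banach"
  assumes L: "sup_bounded L M" and f: "continuous_on {-1..1} f" and p: "near_poly f p e"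
  shows "norm (cext L f - L p) \<le> M * e"
proof -
  have LL: "norm (L p - L q) \<le> M * (d + e)" if "near_poly f p d" "near_poly f q e" for p q d e
    unfolding sup_boundedD(5)[OF L, symmetric]
    by (rule sup_boundedD(3)[OF L]) (use that in \<open>force simp: near_poly_def dest!: bspec\<close>)
  define P where "P n = (SOME p. near_poly f p (1 / Suc n))" for n
  have P: "near_poly f (P n) (1 / Suc n)" for n
    unfolding P_def by (rule someI_ex, rule ex_near_poly[OF f]) simp
  have lim0: "(\<lambda>n. M * (1 / Suc n + e)) \<longlonglongrightarrow> M * (0 + e)" for e
    by (intro tendsto_mult tendsto_add tendsto_const LIMSEQ_Suc lim_1_over_n[where 'a = real, simplified])
  have "Cauchy (\<lambda>n. L (P n))"
  proof (rule CauchyI)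
    fix \<epsilon> :: real assume \<epsilon>: "\<epsilon> > 0"
    have "\<forall>\<^sub>F n in sequentially. M * (1 / Suc n + 0) < \<epsilon> / 2"
      using order_tendstoD(2)[OF lim0[of 0], of "\<epsilon> / 2"] \<epsilon> by simp
    then obtain n0 where n0: "\<And>n. n \<ge> n0 \<Longrightarrow> M * (1 / Suc n + 0) < \<epsilon> / 2"
      unfolding eventually_sequentially by blast
    have "norm (L (P m) - L (P n)) < \<epsilon>" if "m \<ge> n0" "n \<ge> n0" for m n
      using LL[OF P P, of m n] n0[OF that(1)] n0[OF that(2)] unfolding distrib_left by linarith
    then show "\<exists>n0. \<forall>m\<ge>n0. \<forall>n\<ge>n0. norm (L (P m) - L (P n)) < \<epsilon>" by blast
  qed
  then have "(\<lambda>n. L (P n)) \<longlonglongrightarrow> cext L f"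
    unfolding cext_def P_def[symmetric] by (simp add: Cauchy_convergent_iff convergent_LIMSEQ_iff)
  then have "(\<lambda>n. norm (L (P n) - L p)) \<longlonglongrightarrow> norm (cext L f - L p)"
    by (intro tendsto_intros)
  then show ?thesis
    using LIMSEQ_le[OF _ lim0[of e]] LL[OF P p] by fastforce
qed

text \<open>Having e < 1 at hand lets a bound such as F + e be replaced by F + 1, which keeps
  \<open>K\<close> independent of e.\<close>

lemma eq_if_norm_diff_small:
  fixes x y :: "'b::real_normed_vector"
  assumes "\<And>e. 0 < e \<Longrightarrow> e < 1 \<Longrightarrow> norm (x - y) \<le> K * e"
  shows "x = y"
proof (rule ccontr)
  assume "x \<noteq> y"
  then have pos: "norm (x - y) > 0" by simp
  define e where "e = min (1/2) (norm (x - y) / (2 * (\<bar>K\<bar> + 1)))"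
  have e: "0 < e" "e < 1" using pos by (auto simp: e_def)
  have "K * e \<le> (\<bar>K\<bar> + 1) * e" using e by (intro mult_right_mono) auto
  also have "\<dots> \<le> (\<bar>K\<bar> + 1) * (norm (x - y) / (2 * (\<bar>K\<bar> + 1)))"
    by (intro mult_left_mono) (auto simp: e_def)
  also have "\<dots> = norm (x - y) / 2" by (simp add: field_simps)
  finally show False using assms[OF e] pos by linarith
qed

lemma cext_eqI:
  fixes L :: "real poly \<Rightarrow> 'b::banach"
  assumes L: "sup_bounded L M" and f: "continuous_on {-1..1} f"
    and y: "\<And>p e. near_poly f p e \<Longrightarrow> norm (y - L p) \<le> K * e"
  shows "cext L f = y"
proof (rule eq_if_norm_diff_small)
  fix e :: real assume "0 < e"
  then obtain p where p: "near_poly f p e" using ex_near_poly[OF f] by blast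
  have "norm (cext L f - y) \<le> norm (cext L f - L p) + norm (y - L p)"
    using norm_triangle_ineq4[of "cext L f - L p" "y - L p"] by simp
  also have "\<dots> \<le> (M + K) * e"
    using cext_near[OF L f p] y[OF p] by (simp add: distrib_right)
  finally show "norm (cext L f - y) \<le> (M + K) * e" .
qed

lemma cext_cong:
  assumes "\<And>t. t \<in> {-1..1} \<Longrightarrow> f t = g t"
  shows "cext L f = cext L g"
  using assms by (simp add: cext_def near_poly_def)

lemma cext_poly:
  fixes L :: "real poly \<Rightarrow> 'b::banach"
  assumes "sup_bounded L M"
  shows "cext L (poly p) = L p"
  using cext_near[OF assms, of "poly p" p 0] by (simp add: near_poly_self continuous_intros)

lemma cext_bound:
  fixes L :: "real poly \<Rightarrow> 'b::banach"
  assumes L: "sup_bounded L M" and f: "continuous_on {-1..1} f"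
    and B: "\<And>t. t \<in> {-1..1} \<Longrightarrow> \<bar>f t\<bar> \<le> B"
  shows "norm (cext L f) \<le> M * B"
proof (rule field_le_epsilon)
  fix \<epsilon> :: real assume \<epsilon>: "\<epsilon> > 0"
  have M: "0 \<le> M" using sup_boundedD(4)[OF L] .
  define e where "e = \<epsilon> / (2 * (M + 1))"
  have e: "e > 0" using M \<epsilon> by (simp add: e_def)
  obtain p where p: "near_poly f p e" using ex_near_poly[OF f e] by blast
  have "norm (L p) \<le> M * (B + e)" by (intro sup_boundedD(3)[OF L] near_poly_bound[OF p B])
  then have "norm (cext L f) \<le> M * B + 2 * M * e"
    using cext_near[OF L f p] norm_triangle_ineq2[of "cext L f" "L p"] by (simp add: distrib_left)
  also have "2 * M * e \<le> \<epsilon>" using M \<epsilon> by (simp add: e_def field_simps)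
  finally show "norm (cext L f) \<le> M * B + \<epsilon>" by simp
qed

lemma cext_add:
  fixes L :: "real poly \<Rightarrow> 'b::banach"
  assumes L: "sup_bounded L M" and f: "continuous_on {-1..1} f" and g: "continuous_on {-1..1} g"
  shows "cext L (\<lambda>t. f t + g t) = cext L f + cext L g"
proof (rule eq_if_norm_diff_small)
  fix e :: real assume e: "0 < e"
  obtain p q where pq: "near_poly f p e" "near_poly g q e"
    using ex_near_poly[OF f e] ex_near_poly[OF g e] by blast
  have fg: "continuous_on {-1..1} (\<lambda>t. f t + g t)" by (intro continuous_intros f g)
  have "cext L (\<lambda>t. f t + g t) - (cext L f + cext L g)
      = (cext L (\<lambda>t. f t + g t) - L (p + q)) - (cext L f - L p) - (cext L g - L q)"
    by (simp add: sup_boundedD(1)[OF L])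
  also have "norm \<dots> \<le> M * (e + e) + M * e + M * e"
    by (intro norm_triangle_le_diff add_mono cext_near[OF L] fg f g pq near_poly_add)
  finally show "norm (cext L (\<lambda>t. f t + g t) - (cext L f + cext L g)) \<le> (4 * M) * e"
    by simp
qed

lemma cext_scale:
  fixes L :: "real poly \<Rightarrow> 'b::banach"
  assumes L: "sup_bounded L M" and f: "continuous_on {-1..1} f"
  shows "cext L (\<lambda>t. r * f t) = r *\<^sub>R cext L f"
proof (rule eq_if_norm_diff_small)
  fix e :: real assume e: "0 < e"
  obtain p where p: "near_poly f p e"
    using ex_near_poly[OF f e] by blast
  have rf: "continuous_on {-1..1} (\<lambda>t. r * f t)" by (intro continuous_intros f)
  have "cext L (\<lambda>t. r * f t) - r *\<^sub>R cext L f
      = (cext L (\<lambda>t. r * f t) - L (Polynomial.smult r p)) - r *\<^sub>R (cext L f - L p)"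
    by (simp add: sup_boundedD(2)[OF L] scaleR_diff_right)
  also have "norm \<dots> \<le> M * (\<bar>r\<bar> * e) + \<bar>r\<bar> * (M * e)"
    by (intro norm_triangle_le_diff add_mono cext_near[OF L] rf near_poly_smult p)
      (simp add: mult_left_mono cext_near[OF L f p])
  finally show "norm (cext L (\<lambda>t. r * f t) - r *\<^sub>R cext L f) \<le> (2 * M * \<bar>r\<bar>) * e"
    by (simp add: mult_ac)
qed

lemma cext_diff:
  fixes L :: "real poly \<Rightarrow> 'b::banach"
  assumes L: "sup_bounded L M" and f: "continuous_on {-1..1} f" and g: "continuous_on {-1..1} g"
  shows "cext L (\<lambda>t. f t - g t) = cext L f - cext L g"
  using cext_add[OF L, of f "\<lambda>t. -1 * g t"] cext_scale[OF L g, of "-1"] f g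
  by (simp add: continuous_intros)

lemma cext_zero:
  fixes L :: "real poly \<Rightarrow> 'b::banach"
  assumes "sup_bounded L M"
  shows "cext L (\<lambda>_. 0) = 0"
  using cext_bound[OF assms, of "\<lambda>_. 0" 0] by simp

lemma cext_sum:
  fixes L :: "real poly \<Rightarrow> 'b::banach"
  assumes L: "sup_bounded L M" and f: "\<And>k. k \<in> K \<Longrightarrow> continuous_on {-1..1} (f k)"
  shows "cext L (\<lambda>t. \<Sum>k\<in>K. w k * f k t) = (\<Sum>k\<in>K. w k *\<^sub>R cext L (f k))"
  using f
proof (induction K rule: infinite_finite_induct)
  case (insert k K)
  then have "cext L (\<lambda>t. w k * f k t + (\<Sum>k\<in>K. w k * f k t))
      = cext L (\<lambda>t. w k * f k t) + cext L (\<lambda>t. \<Sum>k\<in>K. w k * f k t)"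
    by (intro cext_add[OF L] continuous_intros) auto
  then show ?case using insert by (simp add: cext_scale[OF L])
qed (simp_all add: cext_zero[OF L])

section \<open>The calculus f(c) x of a self-adjoint contraction\<close>

locale selfadjoint_contraction =
  fixes c :: "'a::cstar_algebra"
  assumes selfadjoint: "star c = c" and norm_le_1: "norm c \<le> 1"
begin

text \<open>\<open>fc f x\<close> stands for f(c) x. The argument \<open>x\<close> stays because
  f(c) alone would live in the unitization when f(0) is not 0.\<close>

definition fc :: "(real \<Rightarrow> real) \<Rightarrow> 'a \<Rightarrow> 'a" where
  "fc f x = cext (\<lambda>p. opoly ((*) c) p x) f"

lemma sup_bounded_opoly: "sup_bounded (\<lambda>p. opoly ((*) c) p x) (norm x)"
  unfolding sup_bounded_def
  using norm_opoly_le[OF selfadjoint norm_le_1, of _ _ x]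
  by (auto simp: opoly_add opoly_smult linear_mult mult.commute)

lemmas fc_add = cext_add[OF sup_bounded_opoly, folded fc_def]
  and fc_diff = cext_diff[OF sup_bounded_opoly, folded fc_def]
  and fc_scale = cext_scale[OF sup_bounded_opoly, folded fc_def]
  and fc_sum = cext_sum[OF sup_bounded_opoly, folded fc_def]
  and fc_poly = cext_poly[OF sup_bounded_opoly, folded fc_def]
  and fc_zero = cext_zero[OF sup_bounded_opoly, folded fc_def]
  and fc_near = cext_near[OF sup_bounded_opoly, folded fc_def]
  and fc_eqI = cext_eqI[OF sup_bounded_opoly, folded fc_def]

lemma fc_cong: "(\<And>t. t \<in> {-1..1} \<Longrightarrow> f t = g t) \<Longrightarrow> fc f x = fc g x"
  unfolding fc_def by (rule cext_cong)

lemma fc_bound: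
  "continuous_on {-1..1} f \<Longrightarrow> (\<And>t. t \<in> {-1..1} \<Longrightarrow> \<bar>f t\<bar> \<le> B) \<Longrightarrow> norm (fc f x) \<le> B * norm x"
  using cext_bound[OF sup_bounded_opoly, folded fc_def] by (simp add: mult.commute)

lemma fc_id: "fc (\<lambda>t. t) x = c * x"
  using fc_poly[of "[:0, 1:]" x] fc_cong[of "\<lambda>t. t" "poly [:0, 1:]" x] by (simp add: linear_mult)

lemma fc_one: "fc (\<lambda>_. 1) x = x"
  using fc_poly[of "[:1:]" x] fc_cong[of "\<lambda>_. 1" "poly [:1:]" x] by (simp add: linear_mult)

lemma fc_mult_right:
  assumes f: "continuous_on {-1..1} f"
  shows "fc f (x * y) = fc f x * y"
proof (rule fc_eqI[OF f])
  fix p e assume p: "near_poly f p e"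
  have "norm (fc f x * y - opoly ((*) c) p (x * y)) \<le> norm (fc f x - opoly ((*) c) p x) * norm y"
    using norm_mult_ineq[of "fc f x - opoly ((*) c) p x" y]
    by (simp add: left_diff_distrib opoly_mult_right)
  also have "\<dots> \<le> (norm x * e) * norm y"
    by (intro mult_right_mono fc_near f p) simp
  finally show "norm (fc f x * y - opoly ((*) c) p (x * y)) \<le> (norm x * norm y) * e"
    by (simp add: mult_ac)
qed

lemma fc_zero_right: "continuous_on {-1..1} f \<Longrightarrow> fc f 0 = 0"
  using fc_mult_right[of f 0 0] by simp

lemma fc_star:
  assumes f: "continuous_on {-1..1} f"
  shows "star (fc f x) * y = star x * fc f y"
proof (rule eq_if_norm_diff_small)
  fix e :: real assume "0 < e"
  then obtain p where p: "near_poly f p e" using ex_near_poly[OF f] by blast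
  have "star (fc f x) * y - star x * fc f y
      = star (fc f x - opoly ((*) c) p x) * y - star x * (fc f y - opoly ((*) c) p y)"
    by (simp add: star_diff left_diff_distrib right_diff_distrib opoly_star[OF selfadjoint])
  also have "norm \<dots> \<le> (norm x * e) * norm y + norm x * (norm y * e)"
    by (intro norm_triangle_le_diff add_mono order_trans[OF norm_mult_ineq] mult_mono
        fc_near[OF f p] norm_ge_zero order_refl)
      (simp_all add: norm_star fc_near[OF f p] near_poly_nonneg[OF p])
  finally show "norm (star (fc f x) * y - star x * fc f y) \<le> (2 * norm x * norm y) * e"
    by (simp add: mult_ac)
qed

lemma fc_mult:
  assumes f: "continuous_on {-1..1} f" and g: "continuous_on {-1..1} g"
  shows "fc (\<lambda>t. f t * g t) x = fc f (fc g x)"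
proof -
  obtain F G where FG: "\<And>t. t \<in> {-1..1} \<Longrightarrow> \<bar>f t\<bar> \<le> F" "\<And>t. t \<in> {-1..1} \<Longrightarrow> \<bar>g t\<bar> \<le> G"
    using continuous_bounded_on_Icc[OF f] continuous_bounded_on_Icc[OF g] by metis
  have fg: "continuous_on {-1..1} (\<lambda>t. f t * g t)" by (intro continuous_intros f g)
  let ?P = "opoly ((*) c)"
  show ?thesis
  proof (rule eq_if_norm_diff_small)
    fix e :: real assume e: "0 < e" "e < 1"
    obtain p q where p: "near_poly f p e" and q: "near_poly g q e"
      using ex_near_poly[OF f e(1)] ex_near_poly[OF g e(1)] by blast
    have pF: "\<bar>poly p t\<bar> \<le> F + 1" if "t \<in> {-1..1}" for t
      using near_poly_bound[OF p FG(1) that] e by simp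
    have F: "0 \<le> F + 1" using pF[of 0] by simp
    have pq: "near_poly (\<lambda>t. f t * g t) (p * q) (e * G + (F + 1) * e)"
      by (rule near_poly_mult[OF p q pF FG(2)])
    have "fc (\<lambda>t. f t * g t) x - fc f (fc g x) = (fc (\<lambda>t. f t * g t) x - ?P (p * q) x)
        - (fc f (fc g x) - ?P p (fc g x)) - ?P p (fc g x - ?P q x)"
      by (simp add: opoly_mult linear_mult linear_diff[OF linear_opoly[OF linear_mult]])
    also have "norm \<dots> \<le> norm x * (e * G + (F + 1) * e) + norm (fc g x) * e + (F + 1) * (norm x * e)"
      by (intro norm_triangle_le_diff add_mono fc_near[OF fg pq] fc_near[OF f p]
          order_trans[OF norm_opoly_le[OF selfadjoint norm_le_1 pF] mult_left_mono[OF fc_near[OF g q] F]])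
    finally show "norm (fc (\<lambda>t. f t * g t) x - fc f (fc g x))
        \<le> (norm x * G + 2 * (F + 1) * norm x + norm (fc g x)) * e"
      by (simp add: algebra_simps)
  qed
qed

lemma fc_mult_left: "continuous_on {-1..1} f \<Longrightarrow> fc f (c * x) = fc (\<lambda>t. f t * t) x"
  by (subst fc_mult) (simp_all add: fc_id continuous_intros)

lemma mult_fc: "continuous_on {-1..1} f \<Longrightarrow> c * fc f x = fc (\<lambda>t. f t * t) x"
  using fc_mult[of "\<lambda>t. t" f x] by (simp add: fc_id continuous_intros mult.commute)

text \<open>\<open>fc k c\<close> is the element obtained by inserting \<open>c\<close> into t k(t),
  a function that vanishes at 0; this is how functions of \<open>c\<close> inside the algebra are
  produced.\<close>

lemma fc_elem_mult: "continuous_on {-1..1} k \<Longrightarrow> fc k c * x = fc (\<lambda>t. k t * t) x"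
  using fc_mult_right[of k c x] by (simp add: fc_mult_left)

lemma star_fc_elem:
  assumes "continuous_on {-1..1} k"
  shows "star (fc k c) = fc k c"
  by (rule eq_if_mult_eq) (simp add: fc_star[OF assms] selfadjoint mult_fc[OF assms] fc_elem_mult[OF assms])

lemma fc_eq_0_if_square_eq_0:
  assumes f: "continuous_on {-1..1} f" and 0: "\<And>x. fc (\<lambda>t. f t * f t) x = 0"
  shows "fc f x = 0"
proof -
  have "star (fc f x) * fc f x = 0"
    using 0 by (simp add: fc_star[OF f] fc_mult[OF f f])
  then show ?thesis by (simp add: star_mult_self_eq_0_iff)
qed

end

lemma norm_le_if_mult_le:
  fixes u :: "'a::cstar_algebra"
  assumes "\<And>x. norm (u * x) \<le> B * norm x" "0 \<le> B"
  shows "norm u \<le> B"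
proof (cases "norm u = 0")
  case False
  have "norm u * norm u \<le> B * norm u"
    using assms(1)[of "star u"] by (simp add: norm_mult_star norm_star power2_eq_square)
  then show ?thesis using False by (simp add: mult_le_cancel_right)
qed (use assms in simp)

section \<open>Positivity\<close>

abbreviation neg_part :: "real \<Rightarrow> real" where
  "neg_part t \<equiv> max 0 (- t)"

lemma pow_ge_mult: "0 \<le> u \<Longrightarrow> real n * u \<le> (1 + u) ^ n"
  using Bernoulli_inequality[of u n] by simp

text \<open>If \<open>c = z\<^sup>*z\<close> had a negative part, a suitable multiple \<open>y\<close> of \<open>z\<close> would satisfy
  \<open>y\<^sup>*y = -V\<close> with \<open>V \<ge> 0\<close>. Then \<open>p = yy\<^sup>*\<close> is \<open>2a\<^sup>2 + 2b\<^sup>2 + V\<close>, so \<open>1 - p/6\<close> is a contraction,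
  while \<open>y\<close> intertwines it with \<open>1 + V/6\<close>, whose powers grow.\<close>

lemma fc_neg_part_eq_0:
  fixes z :: "'a::cstar_algebra"
  assumes c: "c = star z * z" and z: "norm z \<le> 1"
  shows "selfadjoint_contraction.fc c neg_part x = 0"
proof -
  interpret selfadjoint_contraction c
  proof
    show "star c = c" by (simp add: c star_simps)
    show "norm c \<le> 1" using z by (simp add: c cstar_identity power_le_one)
  qed
  let ?\<tau> = neg_part
  have \<tau>: "continuous_on A ?\<tau>" for A by (intro continuous_intros)
  have \<tau>1: "?\<tau> t \<le> 1" "0 \<le> ?\<tau> t" if "t \<in> {-1..1}" for t using that by auto
  \<comment> \<open>The exponent 5 comes from \<open>e * c * e\<close>, which is t^3 \<tau>(t)^2 at
    \<open>c\<close>, together with t \<tau>(t) = - \<tau>(t)^2.\<close>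
  define V where "V x = fc (\<lambda>t. ?\<tau> t ^ 5) x" for x
  define e where "e = fc ?\<tau> c"
  define y where "y = z * e"
  have e: "star e = e" "e * x = fc (\<lambda>t. ?\<tau> t * t) x" for x
    unfolding e_def by (simp_all add: star_fc_elem fc_elem_mult \<tau>)
  have yy: "star y * (y * x) = - V x" for x
  proof -
    have "star y * (y * x) = e * (c * (e * x))"
      by (simp add: y_def star_mult e(1) c mult.assoc)
    also have "\<dots> = fc (\<lambda>t. (?\<tau> t * t) * ((?\<tau> t * t) * t)) x"
      unfolding e(2) by (simp add: mult_fc fc_mult[symmetric] continuous_intros)
    also have "\<dots> = fc (\<lambda>t. - 1 * ?\<tau> t ^ 5) x"
      by (rule fc_cong) (auto simp: max_def eval_nat_numeral)
    also have "\<dots> = - V x"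
      by (subst fc_scale) (auto intro!: continuous_intros simp: V_def)
    finally show ?thesis .
  qed
  have ny: "norm y \<le> 1"
  proof -
    have "norm (e * x) \<le> 1 * norm x" for x
      unfolding e(2) by (intro fc_bound continuous_intros) (auto simp: abs_mult intro!: mult_le_one)
    then have "norm e \<le> 1" by (rule norm_le_if_mult_le) simp
    then have "norm z * norm e \<le> 1" using z by (intro mult_le_one) auto
    then show ?thesis using norm_mult_ineq[of z e] by (simp add: y_def)
  qed
  define a where "a = (1/2) *\<^sub>R (y + star y)"
  define b where "b = (- \<i> / 2) *\<^sub>C (y - star y)"
  have sum_squares: "y * star y = 2 *\<^sub>R (a * a) + 2 *\<^sub>R (b * b) - star y * y"
  proof -
    define P Q where "P = y * y + star y * star y" and "Q = y * star y + star y * y"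
    have "a * a = (1/4) *\<^sub>R (P + Q)" by (simp add: a_def P_def Q_def algebra_simps)
    moreover have "b * b = (1/4) *\<^sub>R (Q - P)"
      by (simp add: b_def P_def Q_def scaleC_simps scaleR_scaleC algebra_simps)
    ultimately have "2 *\<^sub>R (a * a) + 2 *\<^sub>R (b * b) = (1/2) *\<^sub>R (P + Q) + (1/2) *\<^sub>R (Q - P)"
      by simp
    also have "\<dots> = (1/2) *\<^sub>R ((P + Q) + (Q - P))" by (simp only: scaleR_add_right)
    also have "\<dots> = Q" by (simp flip: scaleR_2)
    finally show ?thesis by (simp add: Q_def)
  qed
  have sa: "star a = a" "star b = b"
    by (simp_all add: a_def b_def star_simps scaleC_simps algebra_simps)
  have na: "norm a \<le> 1" "norm b \<le> 1"
    using norm_triangle_ineq[of y "star y"] norm_triangle_ineq4[of y "star y"] ny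
    by (simp_all add: a_def b_def norm_star norm_scaleC norm_divide)
  have contr: "norm (x - h * (h * x)) \<le> norm x" if "star h = h" "norm h \<le> 1" for h x :: 'a
  proof -
    have "norm (opoly ((*) h) [:1, 0, -1:] x) \<le> 1 * norm x"
      by (rule norm_opoly_le[OF that]) (auto simp: abs_le_iff abs_square_le_1 power2_eq_square[symmetric])
    then show ?thesis by (simp add: linear_mult)
  qed
  have contrV: "norm (x - (1/2) *\<^sub>R V x) \<le> norm x" for x
  proof -
    have "x - (1/2) *\<^sub>R V x = fc (\<lambda>t. 1 - (1/2) * ?\<tau> t ^ 5) x"
      unfolding V_def
      by (subst fc_diff, (intro continuous_intros)+, subst fc_scale) (auto intro!: continuous_intros simp: fc_one)
    moreover have "\<bar>1 - (1/2) * ?\<tau> t ^ 5\<bar> \<le> 1" if "t \<in> {-1..1}" for t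
      using \<tau>1[OF that] power_le_one[of "?\<tau> t" 5] zero_le_power[of "?\<tau> t" 5] by (simp add: abs_le_iff)
    ultimately show ?thesis
      using fc_bound[of "\<lambda>t. 1 - (1/2) * ?\<tau> t ^ 5" 1 x] by (simp add: continuous_intros)
  qed
  define p where "p = y * star y"
  \<comment> \<open>The factor 1/6 makes \<open>R\<close> the average of the three contractions 1 -
    a^2, 1 - b^2 and 1 - V/2.\<close>
  define R where "R x = x - (1/6) *\<^sub>R (p * x)" for x
  define S where "S x = x + (1/6) *\<^sub>R V x" for x
  have R: "norm (R x) \<le> norm x" for x
  proof -
    have "R x = (1/3) *\<^sub>R (x - a * (a * x)) + (1/3) *\<^sub>R (x - b * (b * x)) + (1/3) *\<^sub>R (x - (1/2) *\<^sub>R V x)"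
      unfolding R_def p_def sum_squares using yy[of x]
      by (simp add: algebra_simps flip: scaleR_2 scaleR_add_left)
    also have "norm \<dots> \<le> (1/3) * norm x + (1/3) * norm x + (1/3) * norm x"
      by (intro norm_triangle_le add_mono) (simp_all add: contr sa na contrV)
    finally show ?thesis by simp
  qed
  have Rn: "norm ((R ^^ n) x) \<le> norm x" for n x
    by (induction n) (auto intro: order_trans[OF R])
  have RS: "R (y * x) = y * S x" for x
    using yy[of x] by (simp add: R_def S_def p_def mult.assoc distrib_left)
  then have RSn: "(R ^^ n) (y * x) = y * (S ^^ n) x" for n x
    by (induction n) simp_all
  \<comment> \<open>V^2 = (y* y)^2 = y* p y, so the growing powers of \<open>S\<close> can be traded
    for powers of the contraction \<open>R\<close>.\<close>
  have VVS: "norm (V (V ((S ^^ n) x))) \<le> norm x" for n x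
  proof -
    have "V (V ((S ^^ n) x)) = star y * (p * (R ^^ n) (y * x))"
      unfolding RSn p_def using yy by (simp add: mult.assoc)
    also have "norm \<dots> \<le> norm (star y) * (norm p * norm ((R ^^ n) (y * x)))"
      by (meson mult_left_mono norm_ge_zero norm_mult_ineq order_trans)
    also have "\<dots> \<le> 1 * (1 * norm (y * x))"
      by (intro mult_mono Rn) (use ny in \<open>simp_all add: norm_star p_def norm_mult_star power_le_one\<close>)
    also have "\<dots> \<le> norm x"
      using norm_mult_ineq[of y x] mult_right_mono[OF ny, of "norm x"] by simp
    finally show ?thesis .
  qed
  have Sn: "(S ^^ n) x = fc (\<lambda>t. (1 + (1/6) * ?\<tau> t ^ 5) ^ n) x" for n x
  proof (induction n)
    case (Suc n)
    have S: "S x = fc (\<lambda>t. 1 + (1/6) * ?\<tau> t ^ 5) x" for x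
      unfolding S_def V_def
      by (subst fc_add, (intro continuous_intros)+, subst fc_scale) (auto intro!: continuous_intros simp: fc_one)
    have "(S ^^ Suc n) x = S (fc (\<lambda>t. (1 + (1/6) * ?\<tau> t ^ 5) ^ n) x)" by (simp only: funpow.simps comp_def Suc)
    also have "\<dots> = fc (\<lambda>t. (1 + (1/6) * ?\<tau> t ^ 5) ^ Suc n) x"
      unfolding S power_Suc by (subst fc_mult) (auto intro!: continuous_intros)
    finally show ?case .
  qed (simp add: fc_one)
  have V3: "V (V (V x)) = 0" for x
  proof (rule eq_if_norm_diff_small)
    fix \<epsilon> :: real assume \<epsilon>: "\<epsilon> > 0"
    obtain n where n: "1 / \<epsilon> < real n" using reals_Archimedean2 by blast
    have n0: "n > 0" using n \<epsilon> by (cases n) (auto simp: divide_less_0_iff)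
    \<comment> \<open>\<open>g\<close> is V S^(-n) as a function of t: applying the uniform bound to
      g(c) x returns V^3 x on the left, while Bernoulli's inequality makes \<open>g\<close> of size
      6/n.\<close>
    define g where "g t = ?\<tau> t ^ 5 / (1 + (1/6) * ?\<tau> t ^ 5) ^ n" for t
    have pos: "1 + (1/6) * ?\<tau> t ^ 5 > 0" for t by (simp add: add_pos_nonneg)
    have g: "continuous_on {-1..1} g"
      unfolding g_def by (intro continuous_intros) (use pos in \<open>auto simp: less_imp_neq[THEN not_sym]\<close>)
    have gb: "\<bar>g t\<bar> \<le> 6 / real n" for t
    proof -
      define u where "u = (1/6) * ?\<tau> t ^ 5"
      have u: "0 \<le> u" by (simp add: u_def)
      have "g t = 6 * u / (1 + u) ^ n" by (simp add: g_def u_def)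
      then have "\<bar>g t\<bar> = 6 * (u / (1 + u) ^ n)" using u by simp
      also have "u / (1 + u) ^ n \<le> 1 / real n"
        using pow_ge_mult[OF u, of n] u n0 by (simp add: field_simps)
      finally show ?thesis by simp
    qed
    have "(S ^^ n) (fc g x) = V x"
      unfolding Sn V_def
      by (subst fc_mult[symmetric], intro continuous_intros, rule g, rule fc_cong)
        (use pos in \<open>auto simp: g_def less_imp_neq[THEN not_sym]\<close>)
    then have "norm (V (V (V x))) \<le> norm (fc g x)" using VVS[of n "fc g x"] by simp
    also have "\<dots> \<le> 6 / real n * norm x" by (rule fc_bound[OF g gb])
    also have "\<dots> \<le> (6 * \<epsilon>) * norm x"
      using n n0 \<epsilon> by (intro mult_right_mono) (auto simp: field_simps)
    finally show "norm (V (V (V x)) - 0) \<le> (6 * norm x) * \<epsilon>" by (simp add: mult_ac)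
  qed
  \<comment> \<open>V^3 is \<tau>^15; one more factor \<tau> gives a power of two, from which
    repeated halving of the exponent descends to \<tau> itself.\<close>
  have 16: "fc (\<lambda>t. ?\<tau> t ^ 16) x = 0" for x
  proof -
    have "fc (\<lambda>t. ?\<tau> t ^ 16) x = fc (\<lambda>t. ?\<tau> t * (?\<tau> t ^ 5 * (?\<tau> t ^ 5 * ?\<tau> t ^ 5))) x"
      by (rule fc_cong) (simp add: power_add[symmetric] flip: power_Suc)
    also have "\<dots> = fc ?\<tau> (fc (\<lambda>t. ?\<tau> t ^ 5 * (?\<tau> t ^ 5 * ?\<tau> t ^ 5)) x)"
      by (rule fc_mult) (intro continuous_intros)+
    also have "fc (\<lambda>t. ?\<tau> t ^ 5 * (?\<tau> t ^ 5 * ?\<tau> t ^ 5)) x = V (fc (\<lambda>t. ?\<tau> t ^ 5 * ?\<tau> t ^ 5) x)"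
      unfolding V_def by (rule fc_mult) (intro continuous_intros)+
    also have "fc (\<lambda>t. ?\<tau> t ^ 5 * ?\<tau> t ^ 5) x = V (V x)"
      unfolding V_def by (rule fc_mult) (intro continuous_intros)+
    finally show ?thesis by (simp add: V3 fc_zero_right \<tau>)
  qed
  have half: "fc (\<lambda>t. ?\<tau> t ^ k) x = 0" if "\<And>x. fc (\<lambda>t. ?\<tau> t ^ (2 * k)) x = 0" for k x
    by (rule fc_eq_0_if_square_eq_0)
      (use that in \<open>auto intro!: continuous_intros simp: mult_2 power_add\<close>)
  have "fc (\<lambda>t. ?\<tau> t ^ 8) x = 0" for x by (rule half) (simp add: 16)
  then have "fc (\<lambda>t. ?\<tau> t ^ 4) x = 0" for x by - (rule half, simp)
  then have "fc (\<lambda>t. ?\<tau> t ^ 2) x = 0" for x by - (rule half, simp)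
  then have "fc (\<lambda>t. ?\<tau> t ^ 1) x = 0" for x by - (rule half, simp)
  then show ?thesis by simp
qed

text \<open>Writing q = q(0) + t r(t), the function q differs from its constant continuation to the
  left of 0 by r times the negative part, which vanishes at \<open>star z * z\<close>.\<close>

lemma norm_opoly_le_positive:
  fixes z :: "'a::cstar_algebra"
  assumes z: "norm z \<le> 1" and M: "\<And>t. t \<in> {0..1} \<Longrightarrow> \<bar>poly q t\<bar> \<le> M"
  shows "norm (opoly ((*) (star z * z)) q x) \<le> M * norm x"
proof -
  define c where "c = star z * z"
  interpret selfadjoint_contraction c
  proof
    show "star c = c" by (simp add: c_def star_simps)
    show "norm c \<le> 1" using z by (simp add: c_def cstar_identity power_le_one)
  qed
  obtain q0 r where q: "q = pCons q0 r" by (cases q)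
  have f: "continuous_on {-1..1} (\<lambda>t. poly q (max 0 t))" by (intro continuous_intros)
  have "fc (poly q) x = fc (\<lambda>t. poly q (max 0 t) - poly r t * neg_part t) x"
    by (rule fc_cong) (auto simp: q max_def)
  also have "\<dots> = fc (\<lambda>t. poly q (max 0 t)) x - fc (\<lambda>t. poly r t * neg_part t) x"
    by (rule fc_diff) (intro continuous_intros)+
  also have "fc (\<lambda>t. poly r t * neg_part t) x = fc (poly r) (fc neg_part x)"
    by (rule fc_mult) (intro continuous_intros)+
  also have "\<dots> = 0"
    using fc_neg_part_eq_0[OF c_def z] by (simp add: fc_zero_right continuous_intros)
  finally have "opoly ((*) c) q x = fc (\<lambda>t. poly q (max 0 t)) x" by (simp add: fc_poly)
  moreover have "norm (fc (\<lambda>t. poly q (max 0 t)) x) \<le> M * norm x"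
    by (rule fc_bound[OF f]) (auto intro!: M)
  ultimately show ?thesis by (simp add: c_def)
qed

lemma opoly_uminus:
  "opoly ((*) (- c)) p x = opoly ((*) c) (p \<circ>\<^sub>p [:0, -1:]) (x :: 'a::cstar_algebra)"
proof (induction p)
  case (pCons a p)
  have "opoly ((*) (- c)) (pCons a p) x = a *\<^sub>R x - c * opoly ((*) c) (p \<circ>\<^sub>p [:0, -1:]) x"
    unfolding opoly_pCons[OF linear_mult] pCons.IH by simp
  also have "\<dots> = opoly ((*) c) (pCons a p \<circ>\<^sub>p [:0, -1:]) x"
    by (simp only: pcompose_pCons opoly_add opoly_mult linear_mult) (simp add: linear_mult)
  finally show ?case .
qed simp

text \<open>After scaling, both c = \<open>star u * u\<close> and -c = \<open>star v * v\<close>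
  have zero negative part, so c = 0.\<close>

lemma sum_star_mult_self_eq_0:
  fixes x y :: "'a::cstar_algebra"
  assumes xy: "star x * x + star y * y = 0"
  shows "x = 0"
proof -
  define r where "r = 1 / (1 + norm x + norm y)"
  have r: "r > 0" by (simp add: r_def add_pos_nonneg)
  define u v where "u = r *\<^sub>R x" and "v = r *\<^sub>R y"
  have uv: "norm u \<le> 1" "norm v \<le> 1"
    by (simp_all add: u_def v_def r_def abs_of_nonneg field_simps add_pos_nonneg)
  define c where "c = star u * u"
  have cv: "- c = star v * v"
    using arg_cong[OF xy, of "\<lambda>s. (r * r) *\<^sub>R s"]
    by (simp add: c_def u_def v_def star_scaleR scaleR_add_right minus_unique)
  interpret c: selfadjoint_contraction c
    by standard (use uv in \<open>simp_all add: c_def star_simps cstar_identity power_le_one\<close>)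
  interpret c': selfadjoint_contraction "- c"
    by standard (use c.selfadjoint c.norm_le_1 in \<open>simp_all add: star_simps\<close>)
  have "c * w = 0" for w
  proof -
    have neg: "continuous_on {-1..1} neg_part" by (intro continuous_intros)
    \<comment> \<open>The negative part of -c is the positive part of c.\<close>
    have "c'.fc neg_part w = c.fc (\<lambda>t. neg_part (- t)) w"
    proof (rule c'.fc_eqI[OF neg])
      fix p e assume "near_poly neg_part p e"
      then have "near_poly (\<lambda>t. neg_part (- t)) (p \<circ>\<^sub>p [:0, -1:]) e"
        by (auto simp: near_poly_def poly_pcompose dest: bspec[of _ _ "- _"])
      then show "norm (c.fc (\<lambda>t. neg_part (- t)) w - opoly ((*) (- c)) p w) \<le> norm w * e"
        unfolding opoly_uminus by (intro c.fc_near continuous_intros)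
    qed
    then have "c.fc (\<lambda>t. neg_part (- t)) w = 0"
      using fc_neg_part_eq_0[OF cv uv(2)] by simp
    moreover have "c.fc neg_part w = 0" by (rule fc_neg_part_eq_0[OF c_def uv(1)])
    moreover have "c.fc (\<lambda>t. t) w = c.fc (\<lambda>t. neg_part (- t) - neg_part t) w"
      by (rule c.fc_cong) auto
    moreover have "\<dots> = c.fc (\<lambda>t. neg_part (- t)) w - c.fc neg_part w"
      by (rule c.fc_diff) (intro continuous_intros)+
    ultimately show ?thesis by (simp add: c.fc_id)
  qed
  then have "c = 0" by (rule eq_0_if_annihilates)
  then have "u = 0" by (simp add: c_def star_mult_self_eq_0_iff)
  then show ?thesis using r by (simp add: u_def)
qed

lemma sum_star_mult_self_eq_0':
  fixes x y :: "'a::cstar_algebra"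
  assumes "star x * x + star y * y = 0"
  shows "x = 0" "y = 0"
  using sum_star_mult_self_eq_0[of x y] sum_star_mult_self_eq_0[of y x] assms by (simp_all add: add.commute)

section \<open>Approximate units\<close>

text \<open>\<open>e\<close> is d^2 / (d^2 + \<eta>^2) with \<open>d\<close> a multiple of
  \<open>c * star c\<close>; the squares keep the function continuous on all of [-1,1]. The
  factorization of \<open>e\<close> transports zero products from \<open>c\<close> to
  \<open>e\<close>, and contractivity of the complement lets such units be combined.\<close>

lemma approx_unit:
  fixes c :: "'a::cstar_algebra"
  assumes \<epsilon>: "\<epsilon> > 0"
  obtains e r where "star e = e" "norm e \<le> 1" "e = (c * star c) * r" "norm (c - e * c) \<le> \<epsilon>"
    "\<And>x. norm (x - e * x) \<le> norm x"
proof -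
  define s where "s = 1 / (1 + norm c)"
  have s: "s > 0" by (simp add: s_def add_pos_nonneg)
  define b where "b = s *\<^sub>R c"
  have b: "norm b \<le> 1" by (simp add: b_def s_def field_simps add_pos_nonneg)
  define d where "d = b * star b"
  interpret selfadjoint_contraction d
    by standard (use b in \<open>simp_all add: d_def star_simps norm_mult_star power_le_one\<close>)
  \<comment> \<open>With h = 1 - e as functions of d, the squared norm of \<open>b - e * b\<close>
    is that of t h(t)^2 at \<open>d\<close>, hence at most \<eta> because t h(t) is at most \<eta>
    in modulus.\<close>
  define \<eta> where "\<eta> = (s * \<epsilon>)\<^sup>2"
  have \<eta>: "\<eta> > 0" using s \<epsilon> by (simp add: \<eta>_def)
  have pos: "t\<^sup>2 + \<eta>\<^sup>2 > 0" for t using \<eta> by (simp add: add_nonneg_pos)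
  have pos': "t\<^sup>2 + \<eta>\<^sup>2 \<noteq> 0" for t using pos[of t] by (rule less_imp_neq[THEN not_sym])
  define m where "m t = 1 / (t\<^sup>2 + \<eta>\<^sup>2)" for t
  define h where "h t = \<eta>\<^sup>2 / (t\<^sup>2 + \<eta>\<^sup>2)" for t
  have m: "continuous_on {-1..1} m" unfolding m_def using pos' by (intro continuous_intros) auto
  have h: "continuous_on {-1..1} h" unfolding h_def using pos' by (intro continuous_intros) auto
  have mt: "continuous_on {-1..1} (\<lambda>t. m t * t)" by (intro continuous_intros m)
  have hm: "1 - m t * t * t = h t" for t
    using pos'[of t] by (simp add: m_def h_def field_simps power2_eq_square)
  have h01: "0 \<le> h t" "h t \<le> 1" for t using pos[of t] by (simp_all add: h_def)
  define e where "e = fc (\<lambda>t. m t * t) d"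
  have e_mult: "e * x = fc (\<lambda>t. m t * t * t) x" for x
    unfolding e_def by (rule fc_elem_mult[OF mt])
  have e_compl: "x - e * x = fc h x" for x
  proof -
    have "fc h x = fc (\<lambda>t. 1 - m t * t * t) x" by (simp add: hm)
    also have "\<dots> = fc (\<lambda>_. 1) x - fc (\<lambda>t. m t * t * t) x"
      by (rule fc_diff) (intro continuous_intros m)+
    finally show ?thesis by (simp add: e_mult fc_one)
  qed
  have "norm (b - e * b) \<le> s * \<epsilon>"
  proof (rule power2_le_imp_le)
    have "norm ((fc h b * star (fc h b)) * x) \<le> \<eta> * norm x" for x
    proof -
      have "(fc h b * star (fc h b)) * x = fc h (b * (star (fc h b) * x))"
        by (simp only: mult.assoc fc_mult_right[OF h])
      also have "\<dots> = fc h (d * fc h x)"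
        by (simp only: fc_star[OF h] d_def[symmetric] flip: mult.assoc)
      also have "\<dots> = fc (\<lambda>t. h t * t * h t) x"
        by (simp add: fc_mult_left h fc_mult[symmetric] continuous_intros)
      also have "norm \<dots> \<le> \<eta> * norm x"
      proof (rule fc_bound)
        fix t :: real
        have "0 \<le> (\<bar>t\<bar> - \<eta>)\<^sup>2" by simp
        then have "2 * (\<bar>t\<bar> * \<eta>) \<le> t\<^sup>2 + \<eta>\<^sup>2" by (simp add: power2_diff)
        moreover have "0 \<le> \<bar>t\<bar> * \<eta>" using \<eta> by simp
        ultimately have "\<bar>t\<bar> * \<eta> \<le> t\<^sup>2 + \<eta>\<^sup>2" by linarith
        then have "\<eta> * (\<bar>t\<bar> * \<eta>) \<le> \<eta> * (t\<^sup>2 + \<eta>\<^sup>2)" using \<eta> by (intro mult_left_mono) auto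
        then have ht: "h t * \<bar>t\<bar> \<le> \<eta>"
          using pos[of t] by (simp add: h_def divide_le_eq power2_eq_square mult_ac)
        have "\<bar>h t * t * h t\<bar> = h t * \<bar>t\<bar> * h t" using h01 by (simp add: abs_mult)
        also have "\<dots> \<le> h t * \<bar>t\<bar> * 1" using h01[of t] by (intro mult_left_mono) auto
        finally show "\<bar>h t * t * h t\<bar> \<le> \<eta>" using ht by simp
      qed (intro continuous_intros h)
      finally show ?thesis .
    qed
    then have "norm (fc h b * star (fc h b)) \<le> \<eta>"
      by (rule norm_le_if_mult_le) (use \<eta> in simp)
    then show "(norm (b - e * b))\<^sup>2 \<le> (s * \<epsilon>)\<^sup>2" by (simp add: e_compl norm_mult_star \<eta>_def)
  qed (use s \<epsilon> in simp)
  moreover have "b - e * b = s *\<^sub>R (c - e * c)" by (simp add: b_def scaleR_diff_right)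
  ultimately have 4: "norm (c - e * c) \<le> \<epsilon>" using s by simp
  have "norm (e * x) \<le> 1 * norm x" for x
    unfolding e_mult
  proof (rule fc_bound)
    fix t show "\<bar>m t * t * t\<bar> \<le> 1" using hm[of t] h01[of t] by linarith
  qed (intro continuous_intros m)
  then have 2: "norm e \<le> 1" by (rule norm_le_if_mult_le) simp
  have 3: "e = (c * star c) * ((s * s) *\<^sub>R fc m d)"
    unfolding e_def mult_fc[OF m, symmetric] by (simp add: d_def b_def star_simps)
  have 5: "norm (x - e * x) \<le> norm x" for x
    using fc_bound[OF h, of 1 x] h01 by (simp add: e_compl abs_of_nonneg)
  show thesis
    by (rule that[OF _ 2 3 4 5]) (simp add: e_def star_fc_elem[OF mt])
qed

text \<open>An approximate unit makes the products \<open>e * x\<close> dense. In this form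
  identities known only on products extend to the whole algebra.\<close>

lemma bounded_linear_eq_if_eq_on_products:
  fixes f g :: "'a::cstar_algebra \<Rightarrow> 'b::real_normed_vector"
  assumes f: "bounded_linear f" and g: "bounded_linear g" and eq: "\<And>x y. f (x * y) = g (x * y)"
  shows "f x = g x"
proof -
  have d: "bounded_linear (\<lambda>x. f x - g x)" by (rule bounded_linear_sub[OF f g])
  obtain K where K: "\<And>x. norm (f x - g x) \<le> norm x * K" "K \<ge> 0"
    using bounded_linear.nonneg_bounded[OF d] by blast
  show ?thesis
  proof (rule eq_if_norm_diff_small)
    fix \<epsilon> :: real assume "\<epsilon> > 0"
    then obtain e where e: "norm (x - e * x) \<le> \<epsilon>" using approx_unit[of \<epsilon> x] by metis
    have "f x - g x = f (x - e * x) - g (x - e * x)"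
      by (simp add: linear_diff[OF bounded_linear.linear[OF f]] linear_diff[OF bounded_linear.linear[OF g]] eq)
    also have "norm \<dots> \<le> \<epsilon> * K"
      using K(1)[of "x - e * x"] mult_right_mono[OF e K(2)] by linarith
    finally show "norm (f x - g x) \<le> K * \<epsilon>" by (simp add: mult.commute)
  qed
qed

section \<open>Piecewise linear partitions of unity\<close>

definition hat :: "nat \<Rightarrow> int \<Rightarrow> real \<Rightarrow> real" where
  "hat N k t = max 0 (1 - \<bar>real N * t - of_int k\<bar>)"

lemma hat_nonneg: "0 \<le> hat N k t"
  by (simp add: hat_def)

lemma continuous_hat: "continuous_on A (hat N k)"
  unfolding hat_def by (intro continuous_intros)

lemma hat_eq_0: "1 \<le> \<bar>real N * t - of_int k\<bar> \<Longrightarrow> hat N k t = 0"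
  by (simp add: hat_def)

lemma hat_mult_hat: "2 \<le> \<bar>k - l\<bar> \<Longrightarrow> hat N k t * hat N l t = 0"
proof -
  assume "2 \<le> \<bar>k - l\<bar>"
  then have "2 \<le> \<bar>of_int k - of_int l :: real\<bar>" by linarith
  then show ?thesis by (auto simp: hat_def max_def)
qed

text \<open>Only the two nodes around \<open>t\<close> contribute, with weights 1 - u and u. The
  index set may be any finite superset of the nodes in [-1,1], which leaves room for shifted
  neighbours in \<open>local_bilinear_balanced\<close>.\<close>

lemma hat_sum:
  assumes N: "N > 0" and t: "t \<in> {-1..1}" and K: "finite K" "{- int N..int N} \<subseteq> K"
  shows "(\<Sum>k\<in>K. hat N k t) = 1" "(\<Sum>k\<in>K. of_int k / real N * hat N k t) = t"
proof -
  define m where "m = \<lfloor>real N * t\<rfloor>"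
  define u where "u = real N * t - of_int m"
  have u: "0 \<le> u" "u < 1" unfolding u_def m_def by linarith+
  have zero: "hat N k t = 0" if "k \<notin> {m, m + 1}" for k
  proof (rule hat_eq_0)
    have "k \<le> m - 1 \<or> k \<ge> m + 2" using that by auto
    then have "of_int k \<le> (of_int m - 1 :: real) \<or> of_int k \<ge> (of_int m + 2 :: real)" by linarith
    then show "1 \<le> \<bar>real N * t - of_int k\<bar>" using u unfolding u_def by linarith
  qed
  have zero': "hat N k t = 0" if "k \<notin> K" for k
  proof (rule hat_eq_0)
    have "\<bar>real N * t\<bar> \<le> real N * 1" unfolding abs_mult using t by (intro mult_mono) auto
    moreover have "k < - int N \<or> k > int N"
      using K(2) that by (meson atLeastAtMost_iff linorder_not_le subsetD)
    then have "of_int k \<le> - real N - 1 \<or> of_int k \<ge> real N + 1" by linarith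
    ultimately show "1 \<le> \<bar>real N * t - of_int k\<bar>" by linarith
  qed
  have "hat N m t = 1 - u" "hat N (m + 1) t = u"
    using u by (auto simp: hat_def u_def)
  moreover have "(\<Sum>k\<in>K. w k * hat N k t) = (\<Sum>k\<in>{m, m + 1}. w k * hat N k t)" for w :: "int \<Rightarrow> real"
    by (rule sum.mono_neutral_cong) (use K zero zero' in auto)
  ultimately have *: "(\<Sum>k\<in>K. w k * hat N k t) = w m * (1 - u) + w (m + 1) * u" for w :: "int \<Rightarrow> real"
    by simp
  show "(\<Sum>k\<in>K. hat N k t) = 1" using *[of "\<lambda>_. 1"] by simp
  have "of_int m / real N * (1 - u) + of_int (m + 1) / real N * u = (of_int m + u) / real N"
    by (simp add: add_divide_distrib diff_divide_distrib algebra_simps)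
  then show "(\<Sum>k\<in>K. of_int k / real N * hat N k t) = t"
    using N unfolding * by (simp add: u_def)
qed

lemma hat_sum_le_1:
  assumes N: "N > 0" and t: "t \<in> {-1..1}" and K: "finite K"
  shows "(\<Sum>k\<in>K. hat N k t) \<le> 1"
proof -
  have "(\<Sum>k\<in>K. hat N k t) \<le> (\<Sum>k\<in>K \<union> {- int N..int N}. hat N k t)"
    using K by (intro sum_mono2) (auto simp: hat_nonneg)
  also have "\<dots> = 1" using K by (intro hat_sum[OF N t]) auto
  finally show ?thesis .
qed

lemma hat_interpolation:
  assumes f: "continuous_on {-1..1} f" and e: "e > 0"
  shows "\<exists>N0>0. \<forall>N\<ge>N0. \<forall>t\<in>{-1..1}. \<bar>f t - (\<Sum>k=-int N..int N. f (of_int k / real N) * hat N k t)\<bar> \<le> e"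
proof -
  obtain d where d: "d > 0"
    and df: "\<And>s t. s \<in> {-1..1} \<Longrightarrow> t \<in> {-1..1} \<Longrightarrow> dist s t < d \<Longrightarrow> dist (f s) (f t) < e"
    using compact_uniformly_continuous[OF f compact_Icc] e unfolding uniformly_continuous_on_def by metis
  obtain N0 where N0: "1 / d < real N0" using reals_Archimedean2 by blast
  have N00: "N0 > 0" using N0 d by (cases N0) (auto simp: divide_less_0_iff)
  have "\<bar>f t - (\<Sum>k=-int N..int N. f (of_int k / real N) * hat N k t)\<bar> \<le> e"
    if N: "N \<ge> N0" and t: "t \<in> {-1..1}" for N t
  proof -
    have Np: "N > 0" using N N00 by simp
    have "1 / d < real N" using N0 N by linarith
    then have Nd: "1 / real N < d" using d Np by (simp add: field_simps)
    have "f t - (\<Sum>k=-int N..int N. f (of_int k / real N) * hat N k t)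
        = (\<Sum>k=-int N..int N. (f t - f (of_int k / real N)) * hat N k t)"
      using hat_sum(1)[OF Np t, of "{-int N..int N}"]
      by (simp add: left_diff_distrib sum_subtractf flip: sum_distrib_left)
    also have "\<bar>\<dots>\<bar> \<le> (\<Sum>k=-int N..int N. e * hat N k t)"
    proof (intro order_trans[OF sum_abs] sum_mono)
      fix k assume k: "k \<in> {-int N..int N}"
      show "\<bar>(f t - f (of_int k / real N)) * hat N k t\<bar> \<le> e * hat N k t"
      proof (cases "hat N k t = 0")
        case False
        then have "\<bar>real N * t - of_int k\<bar> < 1" using hat_eq_0[of N t k] by fastforce
        moreover have "real N * \<bar>t - of_int k / real N\<bar> = \<bar>real N * t - of_int k\<bar>"
          using Np by (simp add: abs_if field_simps)
        ultimately have "\<bar>t - of_int k / real N\<bar> < 1 / real N" using Np by (simp add: field_simps)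
        then have "dist t (of_int k / real N) < d" using Nd by (simp add: dist_real_def)
        moreover have "of_int k / real N \<in> {-1..1}"
          using k Np by (auto simp: field_simps)
        ultimately have "\<bar>f t - f (of_int k / real N)\<bar> \<le> e"
          using df[OF t] by (force simp: dist_real_def)
        then show ?thesis by (simp add: abs_mult hat_nonneg mult_right_mono)
      qed simp
    qed
    also have "\<dots> = e"
      using hat_sum(1)[OF Np t, of "{-int N..int N}"] by (simp flip: sum_distrib_left)
    finally show ?thesis .
  qed
  then show ?thesis using N00 by blast
qed

text \<open>Abstracts from f(c) acting next to \<open>\<phi>\<close>: finite combinations,
  dependence on [-1,1] only, and boundedness on the unit ball. Index sets are integers because the
  sums run over hats.\<close>

definition cont_linear :: "((real \<Rightarrow> real) \<Rightarrow> 'b::real_normed_vector) \<Rightarrow> real \<Rightarrow> bool" where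
  "cont_linear X C \<longleftrightarrow>
    (\<forall>(K :: int set) w f. (\<forall>k\<in>K. continuous_on {-1..1} (f k)) \<longrightarrow>
      X (\<lambda>t. \<Sum>k\<in>K. w k * f k t) = (\<Sum>k\<in>K. w k *\<^sub>R X (f k))) \<and>
    (\<forall>f g. (\<forall>t\<in>{-1..1}. f t = g t) \<longrightarrow> X f = X g) \<and>
    (\<forall>f. continuous_on {-1..1} f \<longrightarrow> (\<forall>t\<in>{-1..1}. \<bar>f t\<bar> \<le> 1) \<longrightarrow> norm (X f) \<le> C)"

lemma cont_linearD:
  assumes "cont_linear X C"
  shows "(\<And>k. k \<in> K \<Longrightarrow> continuous_on {-1..1} (f k)) \<Longrightarrow>
      X (\<lambda>t. \<Sum>k\<in>(K :: int set). w k * f k t) = (\<Sum>k\<in>K. w k *\<^sub>R X (f k))"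
    "(\<And>t. t \<in> {-1..1} \<Longrightarrow> f' t = g t) \<Longrightarrow> X f' = X g"
    "continuous_on {-1..1} g \<Longrightarrow> (\<And>t. t \<in> {-1..1} \<Longrightarrow> \<bar>g t\<bar> \<le> 1) \<Longrightarrow> norm (X g) \<le> C"
  using assms by (auto simp: cont_linear_def)

text \<open>Expanded in hats, only neighbours contribute to the difference of the two sides, with weight \<open>1/N\<close>,
  and the neighbouring pairs fall into three classes on each of which the sum is a single product.\<close>

lemma local_bilinear_balanced:
  fixes X Y :: "(real \<Rightarrow> real) \<Rightarrow> 'b::real_normed_algebra"
  assumes X: "cont_linear X C" and Y: "cont_linear Y C"
    and loc: "\<And>f g. continuous_on {-1..1} f \<Longrightarrow> continuous_on {-1..1} g \<Longrightarrow> (\<And>t. f t * g t = 0) \<Longrightarrow> X f * Y g = 0"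
  shows "X (\<lambda>t. t) * Y (\<lambda>_. 1) = X (\<lambda>_. 1) * Y (\<lambda>t. t)"
proof (rule eq_if_norm_diff_small)
  fix e :: real assume e: "e > 0"
  obtain N where "1 / e < real N" using reals_Archimedean2 by blast
  then have N: "N > 0" "1 / real N \<le> e"
    using e by (cases "N = 0"; auto simp: divide_less_0_iff field_simps)+
  have C: "0 \<le> C" using cont_linearD(3)[OF X, of "\<lambda>_. 0"] order_trans[OF norm_ge_zero] by simp
  \<comment> \<open>\<open>L\<close> exceeds \<open>K\<close> by one node at each end, so both
    neighbours of every index in \<open>K\<close> belong to \<open>L\<close>.\<close>
  define K L where "K = {- int N - 1..int N + 1}" and "L = {- int N - 2..int N + 2}"
  have expand: "Z (\<lambda>_. 1) = (\<Sum>k\<in>J. Z (hat N k))" "Z (\<lambda>t. t) = (\<Sum>k\<in>J. (of_int k / real N) *\<^sub>R Z (hat N k))"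
    if Z: "cont_linear Z C" and J: "finite J" "{- int N..int N} \<subseteq> J" for Z :: "(real \<Rightarrow> real) \<Rightarrow> 'b" and J
  proof -
    have "Z (\<lambda>_. 1) = Z (\<lambda>t. \<Sum>k\<in>J. 1 * hat N k t)"
      by (rule cont_linearD(2)[OF Z]) (simp add: hat_sum(1)[OF N(1) _ J])
    also have "\<dots> = (\<Sum>k\<in>J. 1 *\<^sub>R Z (hat N k))" by (rule cont_linearD(1)[OF Z continuous_hat])
    finally show "Z (\<lambda>_. 1) = (\<Sum>k\<in>J. Z (hat N k))" by simp
    have "Z (\<lambda>t. t) = Z (\<lambda>t. \<Sum>k\<in>J. of_int k / real N * hat N k t)"
      by (rule cont_linearD(2)[OF Z]) (rule hat_sum(2)[OF N(1) _ J, symmetric])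
    then show "Z (\<lambda>t. t) = (\<Sum>k\<in>J. (of_int k / real N) *\<^sub>R Z (hat N k))"
      by (simp only: cont_linearD(1)[OF Z continuous_hat])
  qed
  have far: "X (hat N k) * Y (hat N l) = 0" if "2 \<le> \<bar>k - l\<bar>" for k l
    by (rule loc[OF continuous_hat continuous_hat]) (rule hat_mult_hat[OF that])
  have neighbours: "norm (\<Sum>k\<in>K. X (hat N k) * Y (hat N (k + s))) \<le> 3 * (C * C)" if s: "\<bar>s\<bar> \<le> 1" for s
  proof -
    \<comment> \<open>Distinct indices with equal residue modulo 3 differ by at least 3, and a shift
      by at most 1 still leaves a gap of 2. Hence all cross terms vanish, and the diagonal sum is
      one product of two values at functions bounded by 1.\<close>
    have residue: "norm (\<Sum>k\<in>{k\<in>K. k mod 3 = r}. X (hat N k) * Y (hat N (k + s))) \<le> C * C" for r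
    proof -
      define J where "J = {k\<in>K. k mod 3 = r}"
      have J: "finite J" unfolding J_def K_def by (rule finite_subset[of _ "{- int N - 1..int N + 1}"]) auto
      have cross: "X (hat N k) * Y (hat N (l + s)) = 0" if "k \<in> J" "l \<in> J" "k \<noteq> l" for k l
      proof (rule far)
        have "k mod 3 = l mod 3" using that by (simp add: J_def)
        then have "3 dvd k - l" using mod_eq_dvd_iff by blast
        then have "3 \<le> \<bar>k - l\<bar>" using that(3) by (intro zdvd_imp_le) auto
        then show "2 \<le> \<bar>k - (l + s)\<bar>" using s by linarith
      qed
      have "X (\<lambda>t. \<Sum>k\<in>J. 1 * hat N k t) * Y (\<lambda>t. \<Sum>l\<in>J. 1 * hat N (l + s) t)
          = (\<Sum>k\<in>J. X (hat N k)) * (\<Sum>l\<in>J. Y (hat N (l + s)))"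
        by (simp only: cont_linearD(1)[OF X continuous_hat] cont_linearD(1)[OF Y continuous_hat] scaleR_one)
      also have "\<dots> = (\<Sum>k\<in>J. \<Sum>l\<in>J. X (hat N k) * Y (hat N (l + s)))"
        by (simp add: sum_product)
      also have "\<dots> = (\<Sum>k\<in>J. \<Sum>l\<in>{k}. X (hat N k) * Y (hat N (l + s)))"
        by (intro sum.cong refl sum.mono_neutral_right J) (auto simp: cross)
      finally have eq: "(\<Sum>k\<in>J. X (hat N k) * Y (hat N (k + s)))
          = X (\<lambda>t. \<Sum>k\<in>J. 1 * hat N k t) * Y (\<lambda>t. \<Sum>l\<in>J. 1 * hat N (l + s) t)" by simp
      have "norm (X (\<lambda>t. \<Sum>k\<in>J. 1 * hat N k t)) \<le> C"
        using hat_sum_le_1[OF N(1) _ J] by (intro cont_linearD(3)[OF X])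
          (auto intro!: continuous_intros continuous_hat simp: abs_of_nonneg sum_nonneg hat_nonneg)
      moreover have "norm (Y (\<lambda>t. \<Sum>k\<in>J. 1 * hat N (k + s) t)) \<le> C"
      proof (rule cont_linearD(3)[OF Y])
        fix t :: real assume t: "t \<in> {-1..1}"
        have "(\<Sum>k\<in>J. 1 * hat N (k + s) t) = (\<Sum>k\<in>(\<lambda>k. k + s) ` J. hat N k t)"
          by (subst sum.reindex) auto
        then show "\<bar>\<Sum>k\<in>J. 1 * hat N (k + s) t\<bar> \<le> 1"
          using hat_sum_le_1[OF N(1) t, of "(\<lambda>k. k + s) ` J"] J
          by (simp add: abs_of_nonneg sum_nonneg hat_nonneg)
      qed (auto intro!: continuous_intros continuous_hat)
      ultimately show ?thesis
        unfolding J_def[symmetric] eq by (meson C mult_mono norm_ge_zero norm_mult_ineq order_trans)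
    qed
    have "(\<Sum>k\<in>K. X (hat N k) * Y (hat N (k + s)))
        = (\<Sum>r\<in>{0, 1, 2}. \<Sum>k\<in>{k\<in>K. k mod 3 = r}. X (hat N k) * Y (hat N (k + s)))"
      by (rule sum.group[symmetric]) (auto simp: K_def)
    also have "norm \<dots> \<le> (\<Sum>r\<in>{0, 1, 2 :: int}. C * C)"
      by (intro sum_norm_le residue)
    finally show ?thesis by simp
  qed
  have "X (\<lambda>t. t) * Y (\<lambda>_. 1) - X (\<lambda>_. 1) * Y (\<lambda>t. t)
      = (\<Sum>k\<in>K. \<Sum>l\<in>L. ((of_int k - of_int l) / real N) *\<^sub>R (X (hat N k) * Y (hat N l)))"
    using expand[OF X, of K] expand[OF Y, of L]
    by (simp add: K_def L_def sum_product sum_subtractf[symmetric] diff_divide_distrib scaleR_diff_left)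
  also have "\<dots> = (\<Sum>k\<in>K. (1 / real N) *\<^sub>R (X (hat N k) * Y (hat N (k + -1)) - X (hat N k) * Y (hat N (k + 1))))"
  proof (rule sum.cong[OF refl])
    fix k assume k: "k \<in> K"
    have "(\<Sum>l\<in>L. ((of_int k - of_int l) / real N) *\<^sub>R (X (hat N k) * Y (hat N l)))
        = (\<Sum>l\<in>{k - 1, k, k + 1}. ((of_int k - of_int l) / real N) *\<^sub>R (X (hat N k) * Y (hat N l)))"
      by (rule sum.mono_neutral_right) (use k in \<open>auto simp: K_def L_def intro!: far\<close>)
    then show "(\<Sum>l\<in>L. ((of_int k - of_int l) / real N) *\<^sub>R (X (hat N k) * Y (hat N l)))
        = (1 / real N) *\<^sub>R (X (hat N k) * Y (hat N (k + -1)) - X (hat N k) * Y (hat N (k + 1)))"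
      by (simp add: scaleR_diff_right)
  qed
  also have "\<dots> = (1 / real N) *\<^sub>R ((\<Sum>k\<in>K. X (hat N k) * Y (hat N (k + -1))) - (\<Sum>k\<in>K. X (hat N k) * Y (hat N (k + 1))))"
    by (simp only: sum_subtractf scaleR_sum_right[symmetric])
  also have "norm \<dots> \<le> (1 / real N) * (3 * (C * C) + 3 * (C * C))"
    using N(1) by (simp only: norm_scaleR) (intro mult_mono norm_triangle_le_diff add_mono neighbours, auto)
  also have "\<dots> \<le> e * (3 * (C * C) + 3 * (C * C))"
    using N C by (intro mult_right_mono) auto
  finally show "norm (X (\<lambda>t. t) * Y (\<lambda>_. 1) - X (\<lambda>_. 1) * Y (\<lambda>t. t)) \<le> (6 * (C * C)) * e"
    by (simp add: mult_ac)
qed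

section \<open>Order zero maps\<close>

lemma mat_star_mult_entry:
  assumes "Z \<in> carrier_mat n n" "i < n" "j < n"
  shows "(mat_star Z * Z) $$ (i, j) = (\<Sum>k<n. star (Z $$ (k, i)) * Z $$ (k, j))"
  using assms by (simp add: mat_star_def scalar_prod_def atLeast0LessThan)

text \<open>The matrix of all \<open>star (x i) * x j\<close> is \<open>mat_star Y * Y\<close> for
  \<open>Y\<close> with first row \<open>x\<close> and zeros below.\<close>

lemma completely_positive_gram:
  fixes \<phi> :: "'a::cstar_algebra \<Rightarrow> 'b::cstar_algebra"
  assumes \<phi>: "completely_positive \<phi>" and n: "(n :: nat) > 0"
  obtains z where "\<And>i j. i < n \<Longrightarrow> j < n \<Longrightarrow> \<phi> (star (x i) * x j) = (\<Sum>k<n. star (z k i) * z k j)"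
proof -
  define Y where "Y = mat n n (\<lambda>(k, j). if k = 0 then x j else 0)"
  have Y: "Y \<in> carrier_mat n n" by (simp add: Y_def)
  have "mat_pos n (mat_star Y * Y)" using Y by (auto simp: mat_pos_def)
  then obtain Z where Z: "Z \<in> carrier_mat n n" "map_mat \<phi> (mat_star Y * Y) = mat_star Z * Z"
    using \<phi> unfolding completely_positive_def mat_pos_def by blast
  have "\<phi> (star (x i) * x j) = (\<Sum>k<n. star (Z $$ (k, i)) * Z $$ (k, j))" if "i < n" "j < n" for i j
  proof -
    have "(mat_star Y * Y) $$ (i, j) = (\<Sum>k<n. if k = 0 then star (x i) * x j else 0)"
      unfolding mat_star_mult_entry[OF Y that] by (rule sum.cong) (use that in \<open>auto simp: Y_def star_zero\<close>)
    also have "\<dots> = star (x i) * x j" using n by simp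
    finally have "map_mat \<phi> (mat_star Y * Y) $$ (i, j) = \<phi> (star (x i) * x j)"
      using that Y by (simp add: mat_star_def)
    then show ?thesis unfolding Z(2) mat_star_mult_entry[OF Z(1) that] ..
  qed
  then show thesis using that[of "\<lambda>k j. Z $$ (k, j)"] by blast
qed

lemma cont_linear_star:
  fixes X :: "(real \<Rightarrow> real) \<Rightarrow> 'b::cstar_algebra"
  shows "cont_linear X C \<Longrightarrow> cont_linear (\<lambda>f. star (X f)) C"
  unfolding cont_linear_def by (simp add: star_sum star_scaleR norm_star) metis

locale cpc_order_zero_map =
  fixes \<phi> :: "'a::cstar_algebra \<Rightarrow> 'b::cstar_algebra"
  assumes cpc_order_zero: "cpc_order_zero \<phi>"
begin

lemma completely_positive: "completely_positive \<phi>"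
  and contraction: "norm (\<phi> x) \<le> norm x"
  and order_zero: "positive a \<Longrightarrow> positive b \<Longrightarrow> orth a b \<Longrightarrow> orth (\<phi> a) (\<phi> b)"
  using cpc_order_zero by (auto simp: cpc_order_zero_def contractive_def order_zero_def)

lemma \<phi>_add: "\<phi> (x + y) = \<phi> x + \<phi> y"
  and \<phi>_scaleC: "\<phi> (c *\<^sub>C x) = c *\<^sub>C \<phi> x"
  and \<phi>_scaleR: "\<phi> (r *\<^sub>R x) = r *\<^sub>R \<phi> x"
  using completely_positive by (auto simp: completely_positive_def complex_linear_def scaleR_scaleC)

lemma \<phi>_bounded_linear: "bounded_linear \<phi>"
  by (rule bounded_linear_intro[of _ 1]) (simp_all add: \<phi>_add \<phi>_scaleR contraction)

lemma \<phi>_diff: "\<phi> (x - y) = \<phi> x - \<phi> y"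
  and \<phi>_zero: "\<phi> 0 = 0"
  using linear_diff[OF bounded_linear.linear[OF \<phi>_bounded_linear]]
    linear_0[OF bounded_linear.linear[OF \<phi>_bounded_linear]] by auto

lemma \<phi>_square:
  obtains z where "\<phi> (star x * x) = star z * z"
proof -
  obtain z where "\<And>i j :: nat. i < 1 \<Longrightarrow> j < 1 \<Longrightarrow> \<phi> (star x * x) = (\<Sum>k<1::nat. star (z k i) * z k j)"
    by (rule completely_positive_gram[OF completely_positive, of 1 "\<lambda>_. x"]) simp_all
  from this[of 0 0] show thesis by (intro that[of "z 0 0"]) simp
qed

lemma \<phi>_gram2:
  obtains x0 x1 y0 y1 where
    "\<phi> (star x * x) = star x0 * x0 + star x1 * x1" "\<phi> (star x * y) = star x0 * y0 + star x1 * y1"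
    "\<phi> (star y * x) = star y0 * x0 + star y1 * x1" "\<phi> (star y * y) = star y0 * y0 + star y1 * y1"
proof -
  obtain z where z: "\<And>i j :: nat. i < 2 \<Longrightarrow> j < 2 \<Longrightarrow>
      \<phi> (star ((\<lambda>i. if i = 0 then x else y) i) * (\<lambda>i. if i = 0 then x else y) j)
      = (\<Sum>k<2::nat. star (z k i) * z k j)"
    by (rule completely_positive_gram[OF completely_positive, of 2 "\<lambda>i. if i = 0 then x else y"]) simp_all
  show thesis
    using z[of 0 0] z[of 0 1] z[of 1 0] z[of 1 1]
    by (intro that[of "z 0 0" "z 1 0" "z 0 1" "z 1 1"]) (simp_all add: numeral_2_eq_2)
qed

text \<open>The two off-diagonal entries of a 2 \<times> 2 Gram matrix are adjoint to each other,
  which settles products; density does the rest.\<close>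

lemma \<phi>_star: "\<phi> (star x) = star (\<phi> x)"
proof -
  have *: "\<phi> (star (x * y)) = star (\<phi> (x * y))" for x y
  proof -
    obtain x0 x1 y0 y1 where
      "\<phi> (star (star x) * y) = star x0 * y0 + star x1 * y1"
      "\<phi> (star y * star x) = star y0 * x0 + star y1 * x1"
      by (rule \<phi>_gram2)
    then show ?thesis by (simp add: star_simps)
  qed
  have "bounded_linear (\<lambda>x. \<phi> (star x))" "bounded_linear (\<lambda>x. star (\<phi> x))"
    using bounded_linear_compose[OF \<phi>_bounded_linear bounded_linear_star]
      bounded_linear_compose[OF bounded_linear_star \<phi>_bounded_linear] .
  then show ?thesis by (rule bounded_linear_eq_if_eq_on_products) (rule *)
qed

text \<open>Complete positivity enters here, through \<open>2 \<times> 2\<close> Gram matrices: order zero alone only covers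
  zero products of positive elements.\<close>

lemma zero_product:
  assumes ab: "a * b = 0"
  shows "\<phi> a * \<phi> b = 0"
proof (rule eq_if_norm_diff_small)
  fix \<epsilon> :: real assume \<epsilon>: "\<epsilon> > 0"
  obtain e r where e: "star e = e" "norm e \<le> 1" "e = (star a * star (star a)) * r"
    "norm (star a - e * star a) \<le> \<epsilon>" using approx_unit[OF \<epsilon>, of "star a"] by metis
  obtain f s where f: "star f = f" "norm f \<le> 1" "f = (b * star b) * s"
    "norm (b - f * b) \<le> \<epsilon>" using approx_unit[OF \<epsilon>, of b] by metis
  have "a - a * e = star (star a - e * star a)" by (simp add: star_simps e(1))
  then have ae: "norm (a - a * e) \<le> \<epsilon>" using e(4) by (simp add: norm_star)
  \<comment> \<open>The factorizations of the two units put \<open>a * b\<close> in the middle of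
    their product.\<close>
  have "star e * f = star r * star a * (a * b) * star b * s"
    unfolding e(3) f(3) by (simp add: star_simps mult.assoc)
  then have ef: "e * f = 0" by (simp add: ab e(1))
  have fe: "f * e = 0" using ef e(1) f(1) by (metis star_mult star_zero)
  have z1: "(e * e) * (f * f) = 0" by (metis ef mult.assoc mult_zero_left mult_zero_right)
  have z2: "(f * f) * (e * e) = 0" by (metis fe mult.assoc mult_zero_left mult_zero_right)
  \<comment> \<open>Order zero is applied to the squares, whose positivity is evident from
    self-adjointness.\<close>
  have "positive (e * e)" "positive (f * f)"
    unfolding positive_def using e(1) f(1) by metis+
  then have "orth (\<phi> (e * e)) (\<phi> (f * f))"
    by (rule order_zero) (simp add: orth_def star_simps e(1) f(1) z1 z2)
  then have PQ: "\<phi> (e * e) * \<phi> (f * f) = 0" by (simp add: orth_def)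
  obtain x0 x1 y0 y1 where y: "\<phi> (a * e) = star x0 * y0 + star x1 * y1"
    "\<phi> (e * e) = star y0 * y0 + star y1 * y1"
    by (rule \<phi>_gram2[of "star a" e]) (simp add: e(1) star_star)
  obtain w0 w1 v0 v1 where w: "\<phi> (f * f) = star w0 * w0 + star w1 * w1"
    "\<phi> (f * b) = star w0 * v0 + star w1 * v1"
    by (rule \<phi>_gram2[of f b]) (simp add: f(1))
  define Q where "Q = \<phi> (f * f)"
  have Q: "star Q = Q" by (simp add: Q_def star_simps f(1) flip: \<phi>_star)
  \<comment> \<open>Orthogonality of the diagonal entries descends to the Gram vectors: a vanishing
    sum of squares gives y Q = 0 for the vectors y belonging to \<open>e\<close>, then y Q y* = 0
    makes every w y* vanish. The product of the off-diagonal entries is built from such factors y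
    w*.\<close>
  have "star (y0 * Q) * (y0 * Q) + star (y1 * Q) * (y1 * Q) = Q * (\<phi> (e * e) * Q)"
    by (simp add: star_simps Q y(2) algebra_simps)
  then have yQ: "star (y0 * Q) * (y0 * Q) + star (y1 * Q) * (y1 * Q) = 0"
    by (simp add: Q_def PQ)
  have yw: "y * star w0 = 0 \<and> y * star w1 = 0" if "y * Q = 0" for y
  proof -
    have "star (w0 * star y) * (w0 * star y) + star (w1 * star y) * (w1 * star y) = (y * Q) * star y"
      by (simp add: star_simps Q_def w(1) algebra_simps)
    then have "star (w0 * star y) * (w0 * star y) + star (w1 * star y) * (w1 * star y) = 0"
      by (simp add: that)
    from sum_star_mult_self_eq_0'[OF this] have "w0 * star y = 0" "w1 * star y = 0" .
    then show ?thesis by (metis star_mult star_star star_zero)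
  qed
  have 1: "y0 * star w0 = 0" "y0 * star w1 = 0" "y1 * star w0 = 0" "y1 * star w1 = 0"
    using yw sum_star_mult_self_eq_0'[OF yQ] by auto
  have 2: "y0 * (star w0 * v) = 0" "y0 * (star w1 * v) = 0" "y1 * (star w0 * v) = 0"
    "y1 * (star w1 * v) = 0" for v
    using 1 by (metis mult.assoc mult_zero_left)+
  have 0: "\<phi> (a * e) * \<phi> (f * b) = 0"
    unfolding y(1) w(2) by (simp add: distrib_left distrib_right mult.assoc 2)
  have "\<phi> a * \<phi> b = \<phi> (a - a * e) * \<phi> b + \<phi> (a * e) * \<phi> (b - f * b)"
    using 0 by (simp add: \<phi>_diff algebra_simps)
  also have "norm \<dots> \<le> \<epsilon> * norm b + norm a * \<epsilon>"
  proof (intro norm_triangle_le add_mono)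
    show "norm (\<phi> (a - a * e) * \<phi> b) \<le> \<epsilon> * norm b"
      using ae \<epsilon> by (intro order_trans[OF norm_mult_ineq] mult_mono order_trans[OF contraction]) auto
    have "norm (a * e) \<le> norm a * 1"
      using e(2) by (intro order_trans[OF norm_mult_ineq] mult_left_mono) auto
    then have "norm (\<phi> (a * e)) \<le> norm a" using contraction[of "a * e"] by simp
    then show "norm (\<phi> (a * e) * \<phi> (b - f * b)) \<le> norm a * \<epsilon>"
      using f(4) contraction[of "b - f * b"] by (intro order_trans[OF norm_mult_ineq] mult_mono) auto
  qed
  finally show "norm (\<phi> a * \<phi> b - 0) \<le> (norm b + norm a) * \<epsilon>"
    by (simp add: algebra_simps)
qed

text \<open>The two maps sending \<open>f\<close> to \<phi>(x f(c)) and to \<phi>(f(c) y) have zero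
  product on functions with f g = 0, since then x f(c) g(c) y = 0. As the calculus acts from the
  left, x f(c) is written as an adjoint.\<close>

lemma balanced_selfadjoint_contraction:
  assumes c: "star c = c" "norm c \<le> 1"
  shows "\<phi> (x * c) * \<phi> y = \<phi> x * \<phi> (c * y)"
proof -
  interpret selfadjoint_contraction c by standard (use c in auto)
  define C where "C = max (norm x) (norm y)"
  have lin: "cont_linear (\<lambda>f. \<phi> (fc f y)) C" if "norm y \<le> C" for y
    unfolding cont_linear_def
  proof (intro conjI allI impI)
    fix K :: "int set" and w and f :: "int \<Rightarrow> real \<Rightarrow> real" assume f: "\<forall>k\<in>K. continuous_on {-1..1} (f k)"
    show "\<phi> (fc (\<lambda>t. \<Sum>k\<in>K. w k * f k t) y) = (\<Sum>k\<in>K. w k *\<^sub>R \<phi> (fc (f k) y))"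
      using f by (simp add: fc_sum linear_sum[OF bounded_linear.linear[OF \<phi>_bounded_linear]] \<phi>_scaleR)
  next
    fix f g :: "real \<Rightarrow> real" assume "\<forall>t\<in>{-1..1}. f t = g t"
    then show "\<phi> (fc f y) = \<phi> (fc g y)" using fc_cong[of f g y] by simp
  next
    fix f :: "real \<Rightarrow> real" assume "continuous_on {-1..1} f" "\<forall>t\<in>{-1..1}. \<bar>f t\<bar> \<le> 1"
    then have "norm (fc f y) \<le> 1 * norm y" by (intro fc_bound) auto
    then show "norm (\<phi> (fc f y)) \<le> C" using contraction[of "fc f y"] that by simp
  qed
  have "cont_linear (\<lambda>f. star (\<phi> (fc f (star x)))) C"
    by (rule cont_linear_star[OF lin]) (simp add: C_def norm_star)
  then have X: "cont_linear (\<lambda>f. \<phi> (star (fc f (star x)))) C" by (simp add: \<phi>_star)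
  have Y: "cont_linear (\<lambda>f. \<phi> (fc f y)) C" by (rule lin) (simp add: C_def)
  have "\<phi> (star (fc (\<lambda>t. t) (star x))) * \<phi> (fc (\<lambda>_. 1) y) = \<phi> (star (fc (\<lambda>_. 1) (star x))) * \<phi> (fc (\<lambda>t. t) y)"
  proof (rule local_bilinear_balanced[OF X Y])
    fix f g :: "real \<Rightarrow> real"
    assume fg: "continuous_on {-1..1} f" "continuous_on {-1..1} g" "\<And>t. f t * g t = 0"
    have "star (fc f (star x)) * fc g y = x * fc (\<lambda>t. f t * g t) y"
      by (simp only: fc_star[OF fg(1)] fc_mult[OF fg(1,2)] star_star)
    also have "\<dots> = 0" by (simp add: fg(3) fc_zero)
    finally show "\<phi> (star (fc f (star x))) * \<phi> (fc g y) = 0" by (rule zero_product)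
  qed
  then show ?thesis by (simp add: fc_id fc_one star_simps c(1))
qed

lemma balanced_selfadjoint:
  assumes c: "star c = c"
  shows "\<phi> (x * c) * \<phi> y = \<phi> x * \<phi> (c * y)"
proof (cases "c = 0")
  case False
  have "\<phi> (x * ((1 / norm c) *\<^sub>R c)) * \<phi> y = \<phi> x * \<phi> (((1 / norm c) *\<^sub>R c) * y)"
    by (rule balanced_selfadjoint_contraction) (use c False in \<open>simp_all add: star_scaleR\<close>)
  then show ?thesis using False by (simp add: \<phi>_scaleR)
qed (simp add: \<phi>_zero)

lemma balanced: "\<phi> (x * c) * \<phi> y = \<phi> x * \<phi> (c * y)"
proof -
  define a where "a = (1/2) *\<^sub>R (c + star c)"
  define b where "b = (- \<i> / 2) *\<^sub>C (c - star c)"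
  have ab: "star a = a" "star b = b"
    by (simp_all add: a_def b_def star_simps scaleC_simps algebra_simps)
  have "\<i> *\<^sub>C b = (1/2) *\<^sub>R (c - star c)"
    by (simp add: b_def scaleC_scaleC scaleR_scaleC)
  then have c: "c = a + \<i> *\<^sub>C b"
    by (simp add: a_def flip: scaleR_add_right)
  show ?thesis
    unfolding c using balanced_selfadjoint[OF ab(1), of x y] balanced_selfadjoint[OF ab(2), of x y]
    by (simp add: distrib_left distrib_right \<phi>_add \<phi>_scaleC scaleC_simps)
qed

end

section \<open>The powers of an order zero map\<close>

text \<open>The limits at points \<open>d n\<close> approaching \<open>c\<close> form a Cauchy
  sequence by the common Lipschitz constant, and their limit serves at \<open>c\<close>. A general
  filter covers both the left units and sequences.\<close>

lemma tendsto_exists_on_dense: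
  fixes T :: "'e \<Rightarrow> 'a::real_normed_vector \<Rightarrow> 'b::banach"
  assumes F: "F \<noteq> bot" and lip: "\<forall>\<^sub>F e in F. \<forall>x y. norm (T e x - T e y) \<le> K * norm (x - y)"
    and D: "closure D = UNIV" and conv: "\<And>d. d \<in> D \<Longrightarrow> \<exists>y. ((\<lambda>e. T e d) \<longlongrightarrow> y) F"
  shows "\<exists>y. ((\<lambda>e. T e c) \<longlongrightarrow> y) F"
proof -
  have "\<exists>d\<in>D. norm (c - d) < 1 / Suc n" for n
    using closure_approachable[of c D] D by (force simp: dist_norm norm_minus_commute)
  then obtain d where d: "\<And>n. d n \<in> D" "\<And>n. norm (c - d n) < 1 / Suc n" by metis
  obtain y where y: "\<And>n. ((\<lambda>e. T e (d n)) \<longlongrightarrow> y n) F" using conv[OF d(1)] by metis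
  have K: "norm (T e x - T e z) \<le> max K 0 * norm (x - z)"
    if "\<forall>x y. norm (T e x - T e y) \<le> K * norm (x - y)" for e x z
    using that by (meson max.cobounded1 mult_right_mono norm_ge_zero order_trans)
  have yy: "norm (y m - y n) \<le> max K 0 * norm (d m - d n)" for m n
  proof (rule tendsto_upperbound[OF _ _ F])
    show "((\<lambda>e. norm (T e (d m) - T e (d n))) \<longlongrightarrow> norm (y m - y n)) F"
      by (intro tendsto_intros y)
    show "\<forall>\<^sub>F e in F. norm (T e (d m) - T e (d n)) \<le> max K 0 * norm (d m - d n)"
      using lip by eventually_elim (rule K)
  qed
  have dn: "(\<lambda>n. 1 / real (Suc n)) \<longlonglongrightarrow> 0"
    using LIMSEQ_inverse_real_of_nat by (simp add: inverse_eq_divide)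
  have small: "\<exists>n. max K 0 * (1 / Suc n) < r" if "r > 0" for r
    using order_tendstoD(2)[OF tendsto_mult_right_zero[OF dn, of "max K 0"] that]
    unfolding eventually_sequentially by blast
  have "Cauchy y"
  proof (rule CauchyI)
    fix r :: real assume "r > 0"
    then obtain n0 where n0: "max K 0 * (1 / Suc n0) < r / 2" using small[of "r / 2"] by auto
    have "norm (y m - y n) < r" if "m \<ge> n0" "n \<ge> n0" for m n
    proof -
      have *: "norm (c - d k) \<le> 1 / Suc n0" if "k \<ge> n0" for k
      proof -
        have "1 / real (Suc k) \<le> 1 / real (Suc n0)" using that by (simp add: frac_le)
        then show ?thesis using d(2)[of k] by linarith
      qed
      have "norm (d m - d n) \<le> norm (c - d m) + norm (c - d n)"
        using norm_triangle_ineq4[of "c - d n" "c - d m"] by simp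
      then have "norm (d m - d n) \<le> 1 / Suc n0 + 1 / Suc n0"
        using *[OF that(1)] *[OF that(2)] by linarith
      then have "norm (y m - y n) \<le> max K 0 * (1 / Suc n0 + 1 / Suc n0)"
        by (intro order_trans[OF yy] mult_left_mono) auto
      then show ?thesis using n0 unfolding distrib_left by linarith
    qed
    then show "\<exists>n0. \<forall>m\<ge>n0. \<forall>n\<ge>n0. norm (y m - y n) < r" by blast
  qed
  then obtain l where l: "y \<longlonglongrightarrow> l" by (auto simp: Cauchy_convergent_iff convergent_def)
  have "((\<lambda>e. T e c) \<longlongrightarrow> l) F"
  proof (rule tendstoI)
    fix r :: real assume r: "r > 0"
    have "\<forall>\<^sub>F n in sequentially. dist (y n) l < r / 3"
      using tendstoD[OF l, of "r / 3"] r by simp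
    moreover have "\<forall>\<^sub>F n in sequentially. max K 0 * (1 / real (Suc n)) < r / 3"
      using order_tendstoD(2)[OF tendsto_mult_right_zero[OF dn, of "max K 0"], of "r / 3"] r by simp
    ultimately obtain n where n: "dist (y n) l < r / 3" "max K 0 * (1 / real (Suc n)) < r / 3"
      using eventually_conj eventually_happens sequentially_bot by (metis (mono_tags, lifting))
    have cn: "max K 0 * norm (c - d n) < r / 3"
      using n(2) mult_left_mono[OF less_imp_le[OF d(2)[of n]], of "max K 0"] by linarith
    have "\<forall>\<^sub>F e in F. dist (T e (d n)) (y n) < r / 3"
      using tendstoD[OF y[of n], of "r / 3"] r by simp
    then show "\<forall>\<^sub>F e in F. dist (T e c) l < r"
      using lip
    proof eventually_elim
      case (elim e)
      have "dist (T e c) (T e (d n)) < r / 3"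
        using K[OF elim(2), of c "d n"] cn by (simp add: dist_norm)
      then show ?case
        using elim(1) n(1) dist_triangle[of "T e c" l "T e (d n)"] dist_triangle[of "T e (d n)" l "y n"]
        by linarith
    qed
  qed
  then show ?thesis ..
qed

text \<open>A further element is handled by a unit \<open>f\<close> for the residue
  \<open>c - e * c\<close>. The complement of the combined unit is (1 - f)(1 - e), and contractivity
  of 1 - f preserves the errors already achieved.\<close>

lemma ex_left_unit_finite:
  fixes F :: "'a::cstar_algebra set"
  assumes "finite F" "\<epsilon> > 0"
  shows "\<exists>e. (\<forall>x. norm (x - e * x) \<le> norm x) \<and> (\<forall>c\<in>F. norm (c - e * c) \<le> \<epsilon>)"
  using assms(1)
proof (induction F)
  case empty
  show ?case by (intro exI[of _ 0]) simp
next
  case (insert c F)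
  then obtain e where e: "\<And>x. norm (x - e * x) \<le> norm x" "\<And>c. c \<in> F \<Longrightarrow> norm (c - e * c) \<le> \<epsilon>" by blast
  obtain f where f: "norm ((c - e * c) - f * (c - e * c)) \<le> \<epsilon>" "\<And>x. norm (x - f * x) \<le> norm x"
    using approx_unit[OF assms(2), of "c - e * c"] by metis
  have eq: "x - (e + f - f * e) * x = (x - e * x) - f * (x - e * x)" for x
    by (simp add: algebra_simps)
  have "norm (x - (e + f - f * e) * x) \<le> norm (x - e * x)" for x
    unfolding eq by (rule f(2))
  then show ?case
    using e f(1) by (intro exI[of _ "e + f - f * e"]) (auto intro: order_trans simp: eq)
qed

text \<open>A filter replaces the usual net, since the algebra need not be separable. The bound 2 is
  what contractivity of the complement gives for \<open>e\<close>.\<close>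

definition left_units :: "'a::cstar_algebra filter" where
  "left_units = (INF (c, \<epsilon>)\<in>UNIV \<times> {0<..}. principal {e. norm e \<le> 2 \<and> norm (c - e * c) \<le> \<epsilon>})"

lemma left_units_not_bot: "left_units \<noteq> (bot :: 'a::cstar_algebra filter)"
  unfolding left_units_def
proof (rule INF_filter_not_bot)
  fix X :: "('a \<times> real) set" assume X: "X \<subseteq> UNIV \<times> {0<..}" "finite X"
  define \<epsilon> where "\<epsilon> = Min (insert 1 (snd ` X))"
  have "\<epsilon> \<le> d" if "(c, d) \<in> X" for c d
    unfolding \<epsilon>_def using X(2) that by (intro Min_le) force+
  moreover have "\<epsilon> > 0" using X by (auto simp: \<epsilon>_def)
  ultimately have \<epsilon>: "\<epsilon> > 0" "\<And>c d. (c, d) \<in> X \<Longrightarrow> \<epsilon> \<le> d" by blast+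
  obtain e :: 'a where e: "\<And>x. norm (x - e * x) \<le> norm x" "\<And>c. c \<in> fst ` X \<Longrightarrow> norm (c - e * c) \<le> \<epsilon>"
    using ex_left_unit_finite[of "fst ` X" \<epsilon>] X(2) \<epsilon>(1) by blast
  have "norm (e * x) \<le> 2 * norm x" for x
    using e(1)[of x] norm_triangle_ineq4[of x "x - e * x"] by simp
  then have "norm e \<le> 2" by (rule norm_le_if_mult_le) simp
  moreover have "norm (c - e * c) \<le> d" if "(c, d) \<in> X" for c d
    using e(2)[of c] \<epsilon>(2)[OF that] image_eqI[of c fst "(c, d)" X] that by simp
  ultimately have "e \<in> (\<Inter>(c, d)\<in>X. {e. norm e \<le> 2 \<and> norm (c - e * c) \<le> d})" by blast
  moreover have "(INF (c, d)\<in>X. principal {e. norm e \<le> 2 \<and> norm (c - e * c) \<le> d})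
      = principal (\<Inter>(c, d)\<in>X. {e. norm e \<le> 2 \<and> norm (c - e * c) \<le> d})"
    unfolding case_prod_beta by (rule INF_principal_finite[OF X(2)])
  ultimately show "(INF (c, d)\<in>X. principal {e. norm e \<le> 2 \<and> norm (c - e * c) \<le> d}) \<noteq> bot"
    by (auto simp: principal_eq_bot_iff)
qed

lemma eventually_left_units:
  assumes "\<epsilon> > 0"
  shows "\<forall>\<^sub>F e in left_units. norm e \<le> 2 \<and> norm (c - e * c) \<le> \<epsilon>"
  unfolding left_units_def
  by (rule eventually_INF1[of "(c, \<epsilon>)"]) (use assms in \<open>auto simp: eventually_principal\<close>)

lemma left_units_norm: "\<forall>\<^sub>F e in left_units. norm e \<le> 2"
  using eventually_left_units[of 1 0] by simp

lemma left_units_tendsto: "((\<lambda>e. e * c) \<longlongrightarrow> c) left_units"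
proof (rule tendstoI)
  fix \<epsilon> :: real assume "\<epsilon> > 0"
  then have "\<forall>\<^sub>F e in left_units. norm e \<le> 2 \<and> norm (c - e * c) \<le> \<epsilon> / 2"
    by (intro eventually_left_units) simp
  then show "\<forall>\<^sub>F e in left_units. dist (e * c) c < \<epsilon>"
    by eventually_elim (use \<open>\<epsilon> > 0\<close> in \<open>auto simp: dist_norm norm_minus_commute\<close>)
qed

lemma products_dense: "closure {x * y |x y :: 'a::cstar_algebra. True} = UNIV"
proof -
  have "c \<in> closure {x * y |x y. True}" for c :: 'a
    unfolding closure_approachable
  proof (intro allI impI)
    fix r :: real assume r: "r > 0"
    obtain e where "norm (c - e * c) \<le> r / 2" using approx_unit[of "r / 2" c] r by auto
    then have "dist (e * c) c < r" using r by (simp add: dist_norm norm_minus_commute)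
    then show "\<exists>y\<in>{x * y |x y. True}. dist y c < r" by blast
  qed
  then show ?thesis by blast
qed

context cpc_order_zero_map
begin

text \<open>If \<open>\<phi> = h \<pi>\<close> as in the structure theorem, then \<open>\<psi> k = h\<^bsup>k+1\<^esup> \<pi>\<close>.\<close>

primrec \<psi> :: "nat \<Rightarrow> 'a \<Rightarrow> 'b" where
  "\<psi> 0 = \<phi>"
| "\<psi> (Suc k) = (\<lambda>c. Lim left_units (\<lambda>e. \<phi> e * \<psi> k c))"

text \<open>The claims support each other: boundedness extends the limit from products to all
  elements, and the balanced identity evaluates it on products and is in turn inherited by the next
  level.\<close>

lemma \<psi>_invariant:
  "bounded_linear (\<psi> k) \<and> (\<forall>x a b. \<phi> (x * a) * \<psi> k b = \<phi> x * \<psi> k (a * b)) \<and>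
    (\<forall>a b. \<psi> (Suc k) (a * b) = \<phi> a * \<psi> k b) \<and>
    (\<forall>c. ((\<lambda>e. \<phi> e * \<psi> k c) \<longlongrightarrow> \<psi> (Suc k) c) left_units)"
proof (induction k)
  have step: "(\<forall>a b. \<psi> (Suc k) (a * b) = \<phi> a * \<psi> k b) \<and>
      (\<forall>c. ((\<lambda>e. \<phi> e * \<psi> k c) \<longlongrightarrow> \<psi> (Suc k) c) left_units)"
    if bl: "bounded_linear (\<psi> k)" and bal: "\<And>x a b. \<phi> (x * a) * \<psi> k b = \<phi> x * \<psi> k (a * b)" for k
  proof -
    \<comment> \<open>By balance the product equals \<phi>(e a) \<psi>(b), where the unit acts
      inside \<phi>.\<close>
    have prod: "((\<lambda>e. \<phi> e * \<psi> k (a * b)) \<longlongrightarrow> \<phi> a * \<psi> k b) left_units" for a b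
      unfolding bal[symmetric]
      by (intro tendsto_mult tendsto_const bounded_linear.tendsto[OF \<phi>_bounded_linear] left_units_tendsto)
    obtain K where K: "\<And>x. norm (\<psi> k x) \<le> norm x * K" "K \<ge> 0"
      using bounded_linear.nonneg_bounded[OF bl] by blast
    have lip: "\<forall>\<^sub>F e in left_units. \<forall>x y. norm (\<phi> e * \<psi> k x - \<phi> e * \<psi> k y) \<le> (2 * K) * norm (x - y)"
      using left_units_norm
    proof eventually_elim
      case (elim e)
      show ?case
      proof (intro allI)
        fix x y
        have "norm (\<phi> e * \<psi> k x - \<phi> e * \<psi> k y) = norm (\<phi> e * \<psi> k (x - y))"
          by (simp add: right_diff_distrib linear_diff[OF bounded_linear.linear[OF bl]])
        also have "\<dots> \<le> 2 * (norm (x - y) * K)"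
          using K elim contraction[of e]
          by (intro order_trans[OF norm_mult_ineq] mult_mono) auto
        finally show "norm (\<phi> e * \<psi> k x - \<phi> e * \<psi> k y) \<le> (2 * K) * norm (x - y)"
          by (simp add: mult_ac)
      qed
    qed
    have "\<exists>y. ((\<lambda>e. \<phi> e * \<psi> k c) \<longlongrightarrow> y) left_units" for c
      by (rule tendsto_exists_on_dense[OF left_units_not_bot lip products_dense]) (use prod in blast)
    then have lim: "((\<lambda>e. \<phi> e * \<psi> k c) \<longlongrightarrow> \<psi> (Suc k) c) left_units" for c
      using tendsto_Lim[OF left_units_not_bot] by (metis \<psi>.simps(2))
    then show ?thesis using tendsto_unique[OF left_units_not_bot lim prod] by blast
  qed
  case 0
  show ?case using step[of 0] \<phi>_bounded_linear balanced by simp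
  case (Suc k)
  then have bl: "bounded_linear (\<psi> k)" and bal: "\<And>x a b. \<phi> (x * a) * \<psi> k b = \<phi> x * \<psi> k (a * b)"
    and prod: "\<And>a b. \<psi> (Suc k) (a * b) = \<phi> a * \<psi> k b"
    and lim: "\<And>c. ((\<lambda>e. \<phi> e * \<psi> k c) \<longlongrightarrow> \<psi> (Suc k) c) left_units" by blast+
  have bl': "bounded_linear (\<psi> (Suc k))"
  proof -
    obtain K where K: "\<And>x. norm (\<psi> k x) \<le> norm x * K" "K \<ge> 0"
      using bounded_linear.nonneg_bounded[OF bl] by blast
    have lin: "\<psi> k (x + y) = \<psi> k x + \<psi> k y" "\<psi> k (r *\<^sub>R x) = r *\<^sub>R \<psi> k x" for x y r
      using bounded_linear.linear[OF bl] by (simp_all add: linear_add linear_scale)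
    show ?thesis
    proof (rule bounded_linear_intro)
      fix x y r
      have "((\<lambda>e. \<phi> e * \<psi> k x + \<phi> e * \<psi> k y) \<longlongrightarrow> \<psi> (Suc k) x + \<psi> (Suc k) y) left_units"
        by (intro tendsto_add lim)
      then show "\<psi> (Suc k) (x + y) = \<psi> (Suc k) x + \<psi> (Suc k) y"
        using tendsto_unique[OF left_units_not_bot lim[of "x + y"]] by (simp add: lin distrib_left)
      have "((\<lambda>e. r *\<^sub>R (\<phi> e * \<psi> k x)) \<longlongrightarrow> r *\<^sub>R \<psi> (Suc k) x) left_units"
        by (intro tendsto_scaleR tendsto_const lim)
      then show "\<psi> (Suc k) (r *\<^sub>R x) = r *\<^sub>R \<psi> (Suc k) x"
        using tendsto_unique[OF left_units_not_bot lim[of "r *\<^sub>R x"]] by (simp add: lin)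
      show "norm (\<psi> (Suc k) x) \<le> norm x * (2 * K)"
      proof (rule tendsto_upperbound[OF tendsto_norm[OF lim] _ left_units_not_bot])
        show "\<forall>\<^sub>F e in left_units. norm (\<phi> e * \<psi> k x) \<le> norm x * (2 * K)"
          using left_units_norm
        proof eventually_elim
          case (elim e)
          have "norm (\<phi> e * \<psi> k x) \<le> 2 * (norm x * K)"
            using K elim contraction[of e]
            by (intro order_trans[OF norm_mult_ineq] mult_mono) auto
          then show ?case by (simp add: mult_ac)
        qed
      qed
    qed
  qed
  have bal': "\<phi> (x * a) * \<psi> (Suc k) b = \<phi> x * \<psi> (Suc k) (a * b)" for x a b
  proof -
    \<comment> \<open>Balance is used to move \<open>a\<close> to the right of \<open>x\<close> and
      then \<open>e\<close> into the argument of \<psi>, so that the unit can be removed by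
      continuity.\<close>
    have eq: "\<phi> (x * a) * (\<phi> e * \<psi> k b) = \<phi> x * (\<phi> a * \<psi> k (e * b))" for e
      by (simp add: balanced bal flip: mult.assoc) (simp add: mult.assoc bal)
    have "((\<lambda>e. \<phi> (x * a) * (\<phi> e * \<psi> k b)) \<longlongrightarrow> \<phi> (x * a) * \<psi> (Suc k) b) left_units"
      by (intro tendsto_mult tendsto_const lim)
    moreover have "((\<lambda>e. \<phi> x * (\<phi> a * \<psi> k (e * b))) \<longlongrightarrow> \<phi> x * (\<phi> a * \<psi> k b)) left_units"
      by (intro tendsto_mult tendsto_const bounded_linear.tendsto[OF bl] left_units_tendsto)
    ultimately show ?thesis
      unfolding eq prod by (rule tendsto_unique[OF left_units_not_bot])
  qed
  show ?case using step[OF bl' bal'] bl' bal' by blast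
qed

lemma \<psi>_bounded_linear: "bounded_linear (\<psi> k)"
  and \<psi>_Suc_mult: "\<psi> (Suc k) (a * b) = \<phi> a * \<psi> k b"
  and \<psi>_lim: "((\<lambda>e. \<phi> e * \<psi> k c) \<longlongrightarrow> \<psi> (Suc k) c) left_units"
  using \<psi>_invariant[of k] by blast+

text \<open>In the picture h^(k+1) \<pi>, with h commuting with \<pi>, the exponents i + 1 and j + 1
  add up to \<open>Suc (i + j)\<close> + 1.\<close>

lemma \<psi>_mult: "\<psi> i a * \<psi> j b = \<psi> (Suc (i + j)) (a * b)"
proof (induction i arbitrary: a)
  case 0
  then show ?case by (simp only: \<psi>.simps(1) \<psi>_Suc_mult add_0)
next
  case (Suc i)
  have "bounded_linear (\<lambda>a. \<psi> (Suc i) a * \<psi> j b)"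
    by (rule bounded_linear_compose[OF bounded_linear_mult_left \<psi>_bounded_linear])
  moreover have "bounded_linear (\<lambda>a. \<psi> (Suc (Suc i + j)) (a * b))"
    by (rule bounded_linear_compose[OF \<psi>_bounded_linear bounded_linear_mult_left])
  ultimately show ?case
  proof (rule bounded_linear_eq_if_eq_on_products)
    fix x y
    have "\<psi> (Suc i) (x * y) * \<psi> j b = \<phi> x * \<psi> (Suc (i + j)) (y * b)"
      unfolding \<psi>_Suc_mult mult.assoc Suc ..
    then show "\<psi> (Suc i) (x * y) * \<psi> j b = \<psi> (Suc (Suc i + j)) (x * y * b)"
      by (simp only: \<psi>_Suc_mult mult.assoc add_Suc)
  qed
qed

text \<open>The adjoint reverses products, so a factor must be split off at the right end instead of
  the left; \<open>\<psi>_mult\<close> permits both.\<close>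

lemma \<psi>_star: "\<psi> k (star a) = star (\<psi> k a)"
proof (induction k arbitrary: a)
  case 0
  then show ?case by (simp add: \<phi>_star)
next
  case (Suc k)
  show ?case
  proof (rule bounded_linear_eq_if_eq_on_products[where f = "\<lambda>a. \<psi> (Suc k) (star a)"])
    show "bounded_linear (\<lambda>a. \<psi> (Suc k) (star a))"
      by (rule bounded_linear_compose[OF \<psi>_bounded_linear bounded_linear_star])
    show "bounded_linear (\<lambda>a. star (\<psi> (Suc k) a))"
      by (rule bounded_linear_compose[OF bounded_linear_star \<psi>_bounded_linear])
    fix x y
    have "\<psi> (Suc k) (star (x * y)) = \<psi> k (star y) * \<psi> 0 (star x)"
      unfolding \<psi>_mult by (simp add: star_mult)
    also have "\<dots> = star (\<psi> (Suc k) (x * y))"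
      unfolding \<psi>_Suc_mult by (simp add: Suc \<phi>_star star_mult)
    finally show "\<psi> (Suc k) (star (x * y)) = star (\<psi> (Suc k) (x * y))" .
  qed
qed

lemma \<psi>_scaleC: "\<psi> k (c *\<^sub>C a) = c *\<^sub>C \<psi> k a"
proof (induction k arbitrary: a)
  case 0
  then show ?case by (simp add: \<phi>_scaleC)
next
  case (Suc k)
  have "((\<lambda>e. c *\<^sub>C (\<phi> e * \<psi> k a)) \<longlongrightarrow> c *\<^sub>C \<psi> (Suc k) a) left_units"
    by (intro bounded_bilinear.tendsto[OF bounded_bilinear_scaleC] tendsto_const \<psi>_lim)
  then have "((\<lambda>e. \<phi> e * \<psi> k (c *\<^sub>C a)) \<longlongrightarrow> c *\<^sub>C \<psi> (Suc k) a) left_units"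
    by (simp add: Suc mult_scaleC_right)
  then show ?case using tendsto_unique[OF left_units_not_bot \<psi>_lim] by blast
qed

end

section \<open>Functional calculus of an order zero map\<close>

context cpc_order_zero_map
begin

text \<open>\<open>\<Lambda> q c\<close> is the image of \<open>t q(t) \<otimes> c\<close>.\<close>

definition \<Lambda> :: "real poly \<Rightarrow> 'a \<Rightarrow> 'b" where
  "\<Lambda> q c = (\<Sum>i\<le>degree q. coeff q i *\<^sub>R \<psi> i c)"

lemma \<Lambda>_eq: "degree q \<le> n \<Longrightarrow> \<Lambda> q c = (\<Sum>i\<le>n. coeff q i *\<^sub>R \<psi> i c)"
  unfolding \<Lambda>_def by (rule sum.mono_neutral_left) (auto simp: coeff_eq_0)

lemma \<Lambda>_add: "\<Lambda> (p + q) c = \<Lambda> p c + \<Lambda> q c"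
proof -
  let ?n = "max (degree p) (degree q)"
  show ?thesis
    by (simp add: \<Lambda>_eq[of "p + q" ?n] \<Lambda>_eq[of p ?n] \<Lambda>_eq[of q ?n] degree_add_le
        scaleR_add_left sum.distrib)
qed

lemma \<Lambda>_smult: "\<Lambda> (Polynomial.smult r p) c = r *\<^sub>R \<Lambda> p c"
  by (simp add: \<Lambda>_eq[OF degree_smult_le] scaleR_sum_right \<Lambda>_def[of p])

lemma \<Lambda>_monom: "\<Lambda> (monom a n) c = a *\<^sub>R \<psi> n c"
  by (simp add: \<Lambda>_eq[OF degree_monom_le] if_distrib[of "\<lambda>r. r *\<^sub>R _"] cong: if_cong)

lemma \<Lambda>_0: "\<Lambda> 0 c = 0"
  by (simp add: \<Lambda>_def)

lemma \<Lambda>_sum: "\<Lambda> (\<Sum>i\<in>I. p i) c = (\<Sum>i\<in>I. \<Lambda> (p i) c)"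
  by (induction I rule: infinite_finite_induct) (simp_all add: \<Lambda>_0 \<Lambda>_add)

lemma \<Lambda>_bounded_linear: "bounded_linear (\<Lambda> q)"
  unfolding \<Lambda>_def
  by (intro bounded_linear_sum bounded_linear_compose[OF bounded_linear_scaleR_right] \<psi>_bounded_linear)

lemma \<Lambda>_scaleC: "\<Lambda> q (z *\<^sub>C c) = z *\<^sub>C \<Lambda> q c"
proof -
  have "linear ((*\<^sub>C) z :: 'b \<Rightarrow> 'b)" by (simp add: linear_iff scaleC_add_right scaleC_scaleR)
  then show ?thesis unfolding \<Lambda>_def by (simp add: \<psi>_scaleC scaleC_scaleR linear_sum)
qed

lemma \<Lambda>_star: "\<Lambda> q (star c) = star (\<Lambda> q c)"
  by (simp add: \<Lambda>_def \<psi>_star star_sum star_scaleR)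

text \<open>The \<open>pCons\<close> is bookkeeping: t q(t) times t r(t) is t times t q(t)
  r(t).\<close>

lemma \<Lambda>_mult: "\<Lambda> q a * \<Lambda> r b = \<Lambda> (pCons 0 (q * r)) (a * b)"
proof -
  have "q * r = (\<Sum>i\<le>degree q. monom (coeff q i) i) * (\<Sum>j\<le>degree r. monom (coeff r j) j)"
    by (simp only: poly_as_sum_of_monoms)
  also have "\<dots> = (\<Sum>i\<le>degree q. \<Sum>j\<le>degree r. monom (coeff q i * coeff r j) (i + j))"
    by (simp add: sum_product mult_monom)
  finally have "monom 1 1 * (q * r) = (\<Sum>i\<le>degree q. \<Sum>j\<le>degree r. monom (coeff q i * coeff r j) (Suc (i + j)))"
    by (simp add: sum_distrib_left mult_monom)
  moreover have "pCons 0 (q * r) = monom 1 1 * (q * r)" by (simp add: monom_Suc monom_0)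
  ultimately have "\<Lambda> (pCons 0 (q * r)) (a * b)
      = (\<Sum>i\<le>degree q. \<Sum>j\<le>degree r. (coeff q i * coeff r j) *\<^sub>R \<psi> (Suc (i + j)) (a * b))"
    by (simp only: \<Lambda>_sum \<Lambda>_monom)
  then show ?thesis
    by (simp add: \<Lambda>_def sum_product \<psi>_mult mult.commute del: \<psi>.simps)
qed

text \<open>Each application of \<phi>(e) raises the level of \<psi> by one and puts a factor
  \<open>e\<close> in front of \<open>c\<close>; this ties \<Lambda> to polynomials in a genuine
  element of \<open>B\<close>.\<close>

lemma opoly_\<phi>:
  "degree q \<le> n \<Longrightarrow> opoly ((*) (\<phi> e)) q (\<psi> k c) = (\<Sum>i\<le>n. coeff q i *\<^sub>R \<psi> (k + i) (((*) e ^^ i) c))"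
proof (induction n arbitrary: q k c)
  case 0
  then obtain a where "q = [:a:]" by (metis degree_0_id le_zero_eq)
  then show ?case by (simp add: linear_mult)
next
  case (Suc n)
  obtain a r where q: "q = pCons a r" by (cases q)
  have r: "degree r \<le> n" using Suc.prems by (simp add: q split: if_splits)
  have "opoly ((*) (\<phi> e)) q (\<psi> k c) = a *\<^sub>R \<psi> k c + opoly ((*) (\<phi> e)) r (\<phi> e * \<psi> k c)"
    by (simp add: q linear_mult opoly_mult_commute)
  also have "\<phi> e * \<psi> k c = \<psi> (Suc k) (e * c)" by (simp only: \<psi>_Suc_mult)
  also have "a *\<^sub>R \<psi> k c + opoly ((*) (\<phi> e)) r (\<psi> (Suc k) (e * c))
      = (\<Sum>i\<le>Suc n. coeff q i *\<^sub>R \<psi> (k + i) (((*) e ^^ i) c))"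
    unfolding Suc.IH[OF r]
    by (subst sum.atMost_Suc_shift) (simp add: q funpow_swap1 del: \<psi>.simps)
  finally show ?case .
qed

text \<open>With \<open>e\<close> running through squares of an approximate unit, \<open>\<Lambda> q c\<close> is the limit of \<open>q(\<phi>(e)) \<phi>(c)\<close>,
  and \<open>\<phi>(e)\<close> is a positive contraction.\<close>

lemma norm_\<Lambda>_le_quotient:
  assumes M: "\<And>t. t \<in> {0..1} \<Longrightarrow> \<bar>poly q t\<bar> \<le> M"
  shows "norm (\<Lambda> q c) \<le> M * norm c"
proof -
  have "\<exists>u. star u = u \<and> norm u \<le> 1 \<and> norm (c - u * c) \<le> 1 / Suc n" for n
    using approx_unit[of "1 / Suc n" c] by (metis of_nat_0_less_iff zero_less_Suc zero_less_divide_1_iff)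
  then obtain u where u: "\<And>n. star (u n) = u n" "\<And>n. norm (u n) \<le> 1"
    "\<And>n. norm (c - u n * c) \<le> 1 / Suc n" by metis
  \<comment> \<open>A square, so that \<open>\<phi>_square\<close> presents \<phi>(e) as
    \<open>star z * z\<close>.\<close>
  define e where "e n = u n * u n" for n
  have ue: "norm (u n * x) \<le> norm x" for n x
    using norm_mult_ineq[of "u n" x] mult_right_mono[OF u(2), of "norm x" n] by simp
  \<comment> \<open>Every factor \<open>e n\<close> consists of two contractions \<open>u n\<close>,
    each adding an error of at most 1 / (n + 1).\<close>
  have ec: "norm (((*) (e n) ^^ i) c - c) \<le> real i * (2 / Suc n)" for i n
  proof (induction i)
    case (Suc i)
    let ?x = "((*) (e n) ^^ i) c"
    have "((*) (e n) ^^ Suc i) c - c = u n * (u n * (?x - c)) + (u n * (u n * c - c) + (u n * c - c))"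
      by (simp add: e_def algebra_simps)
    also have "norm \<dots> \<le> real i * (2 / Suc n) + (1 / Suc n + 1 / Suc n)"
      using Suc ue[of n "u n * (?x - c)"] ue[of n "?x - c"] ue[of n "u n * c - c"] u(3)[of n]
      by (intro norm_triangle_le add_mono norm_triangle_le[of "u n * (u n * c - c)"])
        (auto simp: norm_minus_commute)
    finally show ?case by (simp add: algebra_simps add_divide_distrib)
  qed simp
  have lim: "(\<lambda>n. ((*) (e n) ^^ i) c) \<longlonglongrightarrow> c" for i
  proof (rule LIM_zero_cancel, rule Lim_null_comparison)
    show "\<forall>\<^sub>F n in sequentially. norm (((*) (e n) ^^ i) c - c) \<le> real i * (2 / Suc n)"
      by (intro always_eventually allI ec)
    have "(\<lambda>n. real i * 2 * inverse (real (Suc n))) \<longlonglongrightarrow> real i * 2 * 0"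
      by (intro tendsto_mult tendsto_const LIMSEQ_inverse_real_of_nat)
    then show "(\<lambda>n. real i * (2 / real (Suc n))) \<longlonglongrightarrow> 0" by (simp add: divide_inverse mult_ac)
  qed
  have "(\<lambda>n. \<Sum>i\<le>degree q. coeff q i *\<^sub>R \<psi> i (((*) (e n) ^^ i) c)) \<longlonglongrightarrow> \<Lambda> q c"
    unfolding \<Lambda>_def
    by (intro tendsto_sum tendsto_scaleR tendsto_const bounded_linear.tendsto[OF \<psi>_bounded_linear] lim)
  moreover have "norm (\<Sum>i\<le>degree q. coeff q i *\<^sub>R \<psi> i (((*) (e n) ^^ i) c)) \<le> M * norm c" for n
  proof -
    obtain z where z: "\<phi> (star (u n) * u n) = star z * z" by (rule \<phi>_square)
    have "(norm z)\<^sup>2 \<le> norm (star (u n) * u n)"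
      using contraction[of "star (u n) * u n"] by (simp add: z cstar_identity)
    also have "\<dots> \<le> 1" using u(2)[of n] by (simp add: cstar_identity power_le_one)
    finally have "norm z \<le> 1" by (simp add: abs_square_le_1)
    then have "norm (opoly ((*) (star z * z)) q (\<phi> c)) \<le> M * norm (\<phi> c)"
      by (rule norm_opoly_le_positive[OF _ M])
    also have "\<dots> \<le> M * norm c"
      using M[of 0] by (intro mult_left_mono contraction) auto
    finally show ?thesis
      using opoly_\<phi>[OF order_refl, of "e n" q 0 c] z by (simp add: e_def u(1))
  qed
  ultimately show ?thesis by (intro Lim_bounded[OF tendsto_norm, of _ _ 0]) auto
qed

text \<open>Squaring repeatedly trades the bound on \<open>q\<close> for one on \<open>t q(t)\<close>.\<close>

lemma norm_\<Lambda>_selfadjoint_le: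
  assumes a: "star a = a" and M: "M > 0" "\<And>t. t \<in> {0..1} \<Longrightarrow> \<bar>t * poly q t\<bar> \<le> M"
  shows "norm (\<Lambda> q a) \<le> M * norm a"
proof -
  define r where "r = pCons 0 q"
  \<comment> \<open>The power of t q(t) with exponent \<open>2 ^ n\<close> is t times q(t) (t
    q(t))^(2^n - 1). Only the single factor q meets the crude bound Q; this leaves the constant Q /
    M, which the roots remove.\<close>
  have sq: "squaring n (\<Lambda> q a) = \<Lambda> (q * r ^ (2 ^ n - 1)) (squaring n a)" for n
  proof (induction n)
    case (Suc n)
    have "pCons 0 (q * r ^ (2 ^ n - 1) * (q * r ^ (2 ^ n - 1))) = q * (r * r ^ (2 ^ n - 1) * r ^ (2 ^ n - 1))"
      by (simp add: r_def algebra_simps)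
    also have "r * r ^ (2 ^ n - 1) * r ^ (2 ^ n - 1) = r ^ (Suc (2 ^ n - 1) + (2 ^ n - 1))"
      by (simp only: power_add power_Suc)
    also have "Suc (2 ^ n - 1) + (2 ^ n - 1) = (2 ^ Suc n - 1 :: nat)"
      using one_le_power[of "2::nat" n] by simp
    finally show ?case by (simp add: Suc \<Lambda>_mult)
  qed simp
  have qc: "continuous_on {-1..1} (poly q)" by (intro continuous_intros)
  obtain Q where Q: "\<And>t. t \<in> {-1..1} \<Longrightarrow> \<bar>poly q t\<bar> \<le> Q"
    using continuous_bounded_on_Icc[OF qc] by metis
  have Q0: "0 \<le> Q" using Q[of 0] by simp
  show ?thesis
  proof (rule le_of_power_two_power_le[where a = 0 and b = "Q / M"])
    fix n
    have "norm (\<Lambda> q a) ^ 2 ^ n = norm (\<Lambda> (q * r ^ (2 ^ n - 1)) (squaring n a))"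
      using norm_squaring[of "\<Lambda> q a" n] a by (simp add: sq \<Lambda>_star[symmetric])
    also have "\<dots> \<le> (Q * M ^ (2 ^ n - 1)) * norm (squaring n a)"
    proof (rule norm_\<Lambda>_le_quotient)
      fix t :: real assume t: "t \<in> {0..1}"
      have "\<bar>poly q t\<bar> * \<bar>t * poly q t\<bar> ^ (2 ^ n - 1) \<le> Q * M ^ (2 ^ n - 1)"
        using Q[of t] M(2)[OF t] t Q0 by (intro mult_mono power_mono) auto
      then show "\<bar>poly (q * r ^ (2 ^ n - 1)) t\<bar> \<le> Q * M ^ (2 ^ n - 1)"
        by (simp add: r_def abs_mult power_abs)
    qed
    also have "\<dots> = (0 * 2 ^ n + Q / M) * (M * norm a) ^ 2 ^ n"
      using M(1) power_Suc[of M "2 ^ n - 1"] by (simp add: norm_squaring[OF a] power_mult_distrib)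
    finally show "norm (\<Lambda> q a) ^ 2 ^ n \<le> (0 * 2 ^ n + Q / M) * (M * norm a) ^ 2 ^ n" .
  qed (use M in auto)
qed

text \<open>The C*-identity reduces to the self-adjoint element \<open>star c * c\<close>. That case
  divides by the bound, so it is applied to each N > M before letting N tend to M.\<close>

lemma norm_\<Lambda>_le:
  assumes M: "\<And>t. t \<in> {0..1} \<Longrightarrow> \<bar>t * poly q t\<bar> \<le> M"
  shows "norm (\<Lambda> q c) \<le> M * norm c"
proof -
  have M0: "0 \<le> M" using M[of 0] by simp
  have N: "norm (\<Lambda> q c) \<le> N * norm c" if N: "N > M" for N
  proof (rule power2_le_imp_le)
    have N0: "N > 0" using M0 N by simp
    have "(norm (\<Lambda> q c))\<^sup>2 = norm (\<Lambda> (pCons 0 (q * q)) (star c * c))"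
      by (simp add: \<Lambda>_mult flip: cstar_identity \<Lambda>_star)
    also have "\<dots> \<le> (N * N) * norm (star c * c)"
    proof (rule norm_\<Lambda>_selfadjoint_le)
      fix t :: real assume t: "t \<in> {0..1}"
      have "\<bar>t * poly q t\<bar> \<le> N" using M[OF t] N by simp
      then have "\<bar>t * poly q t\<bar> * \<bar>t * poly q t\<bar> \<le> N * N" by (intro mult_mono) auto
      then show "\<bar>t * poly (pCons 0 (q * q)) t\<bar> \<le> N * N" by (simp add: abs_mult mult_ac)
    qed (use N0 in \<open>simp_all add: star_simps\<close>)
    finally show "(norm (\<Lambda> q c))\<^sup>2 \<le> (N * norm c)\<^sup>2"
      by (simp add: cstar_identity power2_eq_square mult_ac)
  qed (use M0 N in auto)
  show ?thesis
  proof (rule tendsto_lowerbound)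
    show "((\<lambda>N. N * norm c) \<longlongrightarrow> M * norm c) (at_right M)" by (intro tendsto_intros)
    show "\<forall>\<^sub>F N in at_right M. norm (\<Lambda> q c) \<le> N * norm c"
      by (rule eventually_at_rightI[of M "M + 1"]) (auto intro: N)
  qed simp
qed

text \<open>\<open>poly_shift 1\<close> discards the constant term and divides by t, so
  \<open>L c p\<close> is the image of (p - p(0)) \<otimes> c, and \<open>L c\<close> is defined on
  all polynomials.\<close>

definition L :: "'a \<Rightarrow> real poly \<Rightarrow> 'b" where
  "L c p = \<Lambda> (poly_shift 1 p) c"

lemma L_pCons: "L c (pCons a p) = \<Lambda> p c"
proof -
  have "poly_shift 1 (pCons a p) = p" by (rule poly_eqI) (simp add: coeff_poly_shift)
  then show ?thesis by (simp add: L_def)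
qed

text \<open>The factor 2 pays for subtracting p(0).\<close>

lemma norm_L_le:
  assumes B: "\<And>t. t \<in> {0..1} \<Longrightarrow> \<bar>poly p t\<bar> \<le> B"
  shows "norm (L c p) \<le> 2 * norm c * B"
proof -
  obtain a q where p: "p = pCons a q" by (cases p)
  have "\<bar>a\<bar> \<le> B" using B[of 0] by (simp add: p)
  have "norm (\<Lambda> q c) \<le> (2 * B) * norm c"
  proof (rule norm_\<Lambda>_le)
    fix t :: real assume "t \<in> {0..1}"
    then have "\<bar>a + t * poly q t\<bar> \<le> B" using B[of t] by (simp add: p)
    then show "\<bar>t * poly q t\<bar> \<le> 2 * B" using \<open>\<bar>a\<bar> \<le> B\<close> by linarith
  qed
  then show ?thesis by (simp add: p L_pCons mult_ac)
qed

lemma sup_bounded_L: "sup_bounded (L c) (2 * norm c)"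
  unfolding sup_bounded_def
proof (intro conjI allI impI)
  fix p q :: "real poly" and r :: real
  obtain a p' b q' where "p = pCons a p'" "q = pCons b q'" by (metis pCons_cases)
  then show "L c (p + q) = L c p + L c q" "L c (Polynomial.smult r p) = r *\<^sub>R L c p"
    by (simp_all add: L_pCons \<Lambda>_add \<Lambda>_smult)
qed (auto intro: norm_L_le)

text \<open>\<open>\<Theta> f c\<close> is the image of \<open>f \<otimes> c\<close>, i.e. \<open>f(h) \<pi>(c)\<close>; only the values of \<open>f\<close> on \<open>[0,1]\<close> matter.\<close>

definition \<Theta> :: "(real \<Rightarrow> real) \<Rightarrow> 'a \<Rightarrow> 'b" where
  "\<Theta> f c = cext (L c) f"

lemmas \<Theta>_diff = cext_diff[OF sup_bounded_L, folded \<Theta>_def]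
  and \<Theta>_sum = cext_sum[OF sup_bounded_L, folded \<Theta>_def]
  and \<Theta>_poly = cext_poly[OF sup_bounded_L, folded \<Theta>_def]
  and \<Theta>_zero = cext_zero[OF sup_bounded_L, folded \<Theta>_def]
  and \<Theta>_near = cext_near[OF sup_bounded_L, folded \<Theta>_def]
  and \<Theta>_eqI = cext_eqI[OF sup_bounded_L, folded \<Theta>_def]
  and \<Theta>_bound = cext_bound[OF sup_bounded_L, folded \<Theta>_def]

text \<open>Approximation takes place on [-1,1], but \<open>norm_L_le\<close> measures polynomials
  on [0,1] only.\<close>

lemma \<Theta>_cong:
  assumes f: "continuous_on {-1..1} f" and g: "continuous_on {-1..1} g"
    and eq: "\<And>t. t \<in> {0..1} \<Longrightarrow> f t = g t"
  shows "\<Theta> f c = \<Theta> g c"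
proof -
  have "\<Theta> (\<lambda>t. f t - g t) c = 0"
  proof (rule \<Theta>_eqI)
    fix p e assume p: "near_poly (\<lambda>t. f t - g t) p e"
    have "norm (L c p) \<le> 2 * norm c * e"
    proof (rule norm_L_le)
      fix t :: real assume t: "t \<in> {0..1}"
      then have "\<bar>(f t - g t) - poly p t\<bar> \<le> e" using p by (auto simp: near_poly_def)
      then show "\<bar>poly p t\<bar> \<le> e" using eq[OF t] by simp
    qed
    then show "norm (0 - L c p) \<le> 2 * norm c * e" by simp
  qed (intro continuous_intros f g)
  then show ?thesis by (simp add: \<Theta>_diff f g)
qed

lemma \<Theta>_id: "\<Theta> (\<lambda>t. t) c = \<phi> c"
proof -
  have "poly [:0, 1:] = (\<lambda>t::real. t)" by (rule ext) simp
  then have "\<Theta> (\<lambda>t. t) c = L c [:0, 1:]" using \<Theta>_poly[of "[:0, 1:]" c] by simp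
  then show ?thesis using \<Lambda>_monom[of 1 0 c] by (simp add: L_pCons monom_0)
qed

lemma L_apply_add: "L (c + d) p = L c p + L d p"
  and L_apply_scaleC: "L (z *\<^sub>C c) p = z *\<^sub>C L c p"
  and L_star: "L (star c) p = star (L c p)"
  using linear_add[OF bounded_linear.linear[OF \<Lambda>_bounded_linear]]
  by (simp_all add: L_def \<Lambda>_scaleC \<Lambda>_star)

lemma \<Theta>_apply_add:
  assumes f: "continuous_on {-1..1} f"
  shows "\<Theta> f (c + d) = \<Theta> f c + \<Theta> f d"
proof (rule \<Theta>_eqI[OF f])
  fix p e assume p: "near_poly f p e"
  have "\<Theta> f c + \<Theta> f d - L (c + d) p = (\<Theta> f c - L c p) + (\<Theta> f d - L d p)"
    by (simp add: L_apply_add)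
  also have "norm \<dots> \<le> 2 * norm c * e + 2 * norm d * e"
    by (intro norm_triangle_le add_mono \<Theta>_near f p)
  finally show "norm (\<Theta> f c + \<Theta> f d - L (c + d) p) \<le> (2 * norm c + 2 * norm d) * e"
    by (simp add: distrib_right)
qed

lemma \<Theta>_apply_scaleC:
  assumes f: "continuous_on {-1..1} f"
  shows "\<Theta> f (z *\<^sub>C c) = z *\<^sub>C \<Theta> f c"
proof (rule \<Theta>_eqI[OF f])
  fix p e assume p: "near_poly f p e"
  have "norm (z *\<^sub>C \<Theta> f c - L (z *\<^sub>C c) p) = cmod z * norm (\<Theta> f c - L c p)"
    by (simp add: L_apply_scaleC norm_scaleC flip: scaleC_diff_right)
  also have "\<dots> \<le> cmod z * (2 * norm c * e)" by (intro mult_left_mono \<Theta>_near f p) simp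
  finally show "norm (z *\<^sub>C \<Theta> f c - L (z *\<^sub>C c) p) \<le> (cmod z * 2 * norm c) * e"
    by (simp add: mult_ac)
qed

lemma \<Theta>_apply_scaleR: "continuous_on {-1..1} f \<Longrightarrow> \<Theta> f (r *\<^sub>R c) = r *\<^sub>R \<Theta> f c"
  by (simp add: scaleR_scaleC \<Theta>_apply_scaleC)

lemma \<Theta>_apply_zero: "continuous_on {-1..1} f \<Longrightarrow> \<Theta> f 0 = 0"
  using \<Theta>_apply_scaleR[of f 0 0] by simp

lemma \<Theta>_star:
  assumes f: "continuous_on {-1..1} f"
  shows "\<Theta> f (star c) = star (\<Theta> f c)"
proof (rule \<Theta>_eqI[OF f])
  fix p e assume p: "near_poly f p e"
  have "norm (star (\<Theta> f c) - L (star c) p) = norm (\<Theta> f c - L c p)"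
    by (simp add: L_star norm_star flip: star_diff)
  also have "\<dots> \<le> 2 * norm c * e" by (intro \<Theta>_near f p)
  finally show "norm (star (\<Theta> f c) - L (star c) p) \<le> 2 * norm c * e" .
qed

text \<open>Since \<open>L\<close> ignores constant terms, it is multiplicative on polynomials
  without them; hence the conditions at 0 and the choice of vanishing approximants.\<close>

lemma \<Theta>_mult:
  assumes f: "continuous_on {-1..1} f" "f 0 = 0" and g: "continuous_on {-1..1} g" "g 0 = 0"
  shows "\<Theta> f a * \<Theta> g b = \<Theta> (\<lambda>t. f t * g t) (a * b)"
proof -
  obtain F where F: "\<And>t. t \<in> {-1..1} \<Longrightarrow> \<bar>f t\<bar> \<le> F" using continuous_bounded_on_Icc[OF f(1)] by metis
  obtain G where G: "\<And>t. t \<in> {-1..1} \<Longrightarrow> \<bar>g t\<bar> \<le> G" using continuous_bounded_on_Icc[OF g(1)] by metis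
  have fg: "continuous_on {-1..1} (\<lambda>t. f t * g t)" by (intro continuous_intros f g)
  show ?thesis
  proof (rule eq_if_norm_diff_small)
    fix e :: real assume e: "0 < e" "e < 1"
    obtain p where p: "near_poly f (pCons 0 p) e" by (rule ex_near_poly_vanishing[OF f e(1)])
    obtain q where q: "near_poly g (pCons 0 q) e" by (rule ex_near_poly_vanishing[OF g e(1)])
    have pF: "\<bar>poly (pCons 0 p) t\<bar> \<le> F + 1" if "t \<in> {-1..1}" for t
      using near_poly_bound[OF p F that] e by simp
    have F0: "0 \<le> F + 1" using pF[of 0] by simp
    have pq: "near_poly (\<lambda>t. f t * g t) (pCons 0 p * pCons 0 q) (e * G + (F + 1) * e)"
      by (rule near_poly_mult[OF p q pF G])
    have Lpq: "L a (pCons 0 p) * L b (pCons 0 q) = L (a * b) (pCons 0 p * pCons 0 q)"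
      by (simp add: L_pCons \<Lambda>_mult)
    have "\<Theta> f a * \<Theta> g b - \<Theta> (\<lambda>t. f t * g t) (a * b) = (\<Theta> f a - L a (pCons 0 p)) * \<Theta> g b
        + (L a (pCons 0 p) * (\<Theta> g b - L b (pCons 0 q))
          - (\<Theta> (\<lambda>t. f t * g t) (a * b) - L (a * b) (pCons 0 p * pCons 0 q)))"
      by (simp only: Lpq[symmetric] algebra_simps)
    also have "norm \<dots> \<le> (2 * norm a * e) * norm (\<Theta> g b) + (2 * norm a * (F + 1) * (2 * norm b * e)
        + 2 * norm (a * b) * (e * G + (F + 1) * e))"
    proof (intro norm_triangle_mono norm_triangle_le_diff[OF add_mono])
      show "norm ((\<Theta> f a - L a (pCons 0 p)) * \<Theta> g b) \<le> 2 * norm a * e * norm (\<Theta> g b)"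
        by (rule order_trans[OF norm_mult_ineq mult_right_mono[OF \<Theta>_near[OF f(1) p] norm_ge_zero]])
      have La: "norm (L a (pCons 0 p)) \<le> 2 * norm a * (F + 1)"
        by (rule sup_boundedD(3)[OF sup_bounded_L pF])
      have "0 \<le> 2 * norm a * (F + 1)" using F0 by simp
      from order_trans[OF norm_mult_ineq mult_mono[OF La \<Theta>_near[OF g(1) q] this norm_ge_zero]]
      show "norm (L a (pCons 0 p) * (\<Theta> g b - L b (pCons 0 q))) \<le> 2 * norm a * (F + 1) * (2 * norm b * e)" .
      show "norm (\<Theta> (\<lambda>t. f t * g t) (a * b) - L (a * b) (pCons 0 p * pCons 0 q)) \<le> 2 * norm (a * b) * (e * G + (F + 1) * e)"
        by (rule \<Theta>_near[OF fg pq])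
    qed
    finally show "norm (\<Theta> f a * \<Theta> g b - \<Theta> (\<lambda>t. f t * g t) (a * b))
        \<le> (2 * norm a * norm (\<Theta> g b) + 4 * norm a * norm b * (F + 1) + 2 * norm (a * b) * (G + F + 1)) * e"
      by (simp add: algebra_simps)
  qed
qed

end

section \<open>Real elementary tensors\<close>

definition c0_real :: "(real \<Rightarrow> real) \<Rightarrow> bool" where
  "c0_real f \<longleftrightarrow> continuous_on {-1..1} f \<and> (\<forall>t. t \<notin> {0<..1} \<longrightarrow> f t = 0)"

text \<open>Elementary tensors with a real function, the kind that \<Theta> handles; imaginary parts
  are absorbed into the algebra factor in \<open>span_rtensors_dense\<close>.\<close>

definition rtensor :: "(real \<Rightarrow> real) \<Rightarrow> 'a::cstar_algebra \<Rightarrow> 'a c0" where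
  "rtensor f a = Abs_c0 (\<lambda>t. f t *\<^sub>R a)"

lemma rtensor_apply:
  assumes "c0_real f"
  shows "c0_fun (rtensor f a) t = f t *\<^sub>R a"
proof -
  have "continuous_on {0..1} f"
    using assms continuous_on_subset[of "{-1..1}" f "{0..1}"] by (auto simp: c0_real_def)
  then have "continuous_on {0..1} (\<lambda>t. f t *\<^sub>R a)" by (intro continuous_intros)
  then show ?thesis
    unfolding rtensor_def by (subst c0_fun_Abs) (use assms in \<open>auto simp: c0_real_def\<close>)
qed

lemma c0_real_mult: "c0_real f \<Longrightarrow> c0_real g \<Longrightarrow> c0_real (\<lambda>t. f t * g t)"
  by (auto simp: c0_real_def intro: continuous_intros)

lemma rtensor_mult:
  "c0_real f \<Longrightarrow> c0_real g \<Longrightarrow> rtensor f a * rtensor g b = rtensor (\<lambda>t. f t * g t) (a * b)"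
  by (rule c0_eqI) (simp add: c0_times rtensor_apply c0_real_mult)

lemma c0_realI:
  assumes f: "continuous_on {0..1} f" and 0: "\<And>t. t \<notin> {0<..1} \<Longrightarrow> f t = 0"
  shows "c0_real f"
proof -
  have "continuous_on {-1..1} (\<lambda>t. f (max 0 t))"
    by (rule continuous_on_compose2[OF f]) (auto intro!: continuous_intros)
  then have "continuous_on {-1..1} f"
    by (rule continuous_on_eq) (auto simp: 0 max_def)
  then show ?thesis using 0 by (simp add: c0_real_def)
qed

definition rtensors :: "'a::cstar_algebra c0 set" where
  "rtensors = {rtensor f a |f a. c0_real f}"

lemma span_rtensors_dense: "closure (span rtensors) = (UNIV :: 'a::cstar_algebra c0 set)"
proof -
  have mem: "f \<otimes>\<^sub>C a \<in> span rtensors" for f and a :: 'a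
  proof -
    have re: "c0_real (\<lambda>t. Re (c0_fun f t))" and im: "c0_real (\<lambda>t. Im (c0_fun f t))"
      by (auto intro!: c0_realI continuous_intros c0_fun_continuous simp: c0_fun_outside)
    have "f \<otimes>\<^sub>C a = rtensor (\<lambda>t. Re (c0_fun f t)) a + rtensor (\<lambda>t. Im (c0_fun f t)) (\<i> *\<^sub>C a)"
    proof (rule c0_eqI)
      fix t
      have "c0_fun f t *\<^sub>C a = (of_real (Re (c0_fun f t)) + of_real (Im (c0_fun f t)) * \<i>) *\<^sub>C a"
        by (metis complex_eq mult.commute)
      then show "c0_fun (f \<otimes>\<^sub>C a) t
          = c0_fun (rtensor (\<lambda>t. Re (c0_fun f t)) a + rtensor (\<lambda>t. Im (c0_fun f t)) (\<i> *\<^sub>C a)) t"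
        by (simp add: c0_plus rtensor_apply re im c0_tensor.rep_eq scaleC_add_left scaleR_scaleC scaleC_scaleC)
    qed
    moreover have "rtensor (\<lambda>t. Re (c0_fun f t)) a \<in> rtensors"
      "rtensor (\<lambda>t. Im (c0_fun f t)) (\<i> *\<^sub>C a) \<in> rtensors"
      unfolding rtensors_def using re im by blast+
    ultimately show ?thesis by (simp add: span_add span_base)
  qed
  have "closure {z :: 'a c0. \<exists>n f a. z = (\<Sum>i<n::nat. f i \<otimes>\<^sub>C a i)} = UNIV"
    using c0_is_cstar_tensor_product[where 'a = 'a] unfolding is_cstar_tensor_product_def by blast
  moreover have "{z :: 'a c0. \<exists>n f a. z = (\<Sum>i<n::nat. f i \<otimes>\<^sub>C a i)} \<subseteq> span rtensors"
    by (auto intro!: span_sum mem)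
  ultimately show ?thesis using closure_mono by blast
qed

lemma bounded_linear_eq_on_rtensors:
  fixes g h :: "'a::cstar_algebra c0 \<Rightarrow> 'b::real_normed_vector"
  assumes g: "bounded_linear g" and h: "bounded_linear h"
    and eq: "\<And>f a. c0_real f \<Longrightarrow> g (rtensor f a) = h (rtensor f a)"
  shows "g F = h F"
proof -
  have "closed {F. g F = h F}"
    using g h by (intro closed_Collect_eq linear_continuous_on)
  moreover have "span rtensors \<subseteq> {F. g F = h F}"
    using linear_eq_on_span[OF bounded_linear.linear[OF g] bounded_linear.linear[OF h], of rtensors] eq
    by (auto simp: rtensors_def)
  ultimately have "{F. g F = h F} = UNIV" by (intro closed_subspace_eq_UNIV[OF _ span_rtensors_dense])
  then show ?thesis by blast
qed

section \<open>The homomorphism of an order zero map\<close>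

context cpc_order_zero_map
begin

lemma \<Theta>_orthogonal_mult:
  assumes K: "finite K" and f: "\<And>k. k \<in> K \<Longrightarrow> continuous_on {-1..1} (f k)" "\<And>k. k \<in> K \<Longrightarrow> f k 0 = 0"
    and orth: "\<And>k l t. k \<in> K \<Longrightarrow> l \<in> K \<Longrightarrow> k \<noteq> l \<Longrightarrow> f k t * f l t = 0"
  shows "(\<Sum>k\<in>K. \<Theta> (f k) (a k)) * (\<Sum>k\<in>K. \<Theta> (f k) (b k)) = (\<Sum>k\<in>K. \<Theta> (\<lambda>t. f k t * f k t) (a k * b k))"
proof -
  have zero: "\<Theta> (\<lambda>t. f k t * f l t) c = 0" if "k \<in> K" "l \<in> K" "k \<noteq> l" for k l c
  proof -
    have "(\<lambda>t. f k t * f l t) = (\<lambda>_. 0)" using orth[OF that] by (rule ext)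
    then show ?thesis by (simp only: \<Theta>_zero)
  qed
  have "(\<Sum>k\<in>K. \<Theta> (f k) (a k)) * (\<Sum>k\<in>K. \<Theta> (f k) (b k))
      = (\<Sum>k\<in>K. \<Sum>l\<in>K. \<Theta> (\<lambda>t. f k t * f l t) (a k * b l))"
    unfolding sum_product by (intro sum.cong refl \<Theta>_mult f)
  also have "\<dots> = (\<Sum>k\<in>K. \<Sum>l\<in>{k}. \<Theta> (\<lambda>t. f k t * f l t) (a k * b l))"
  proof (rule sum.cong[OF refl], rule sum.mono_neutral_right[OF K])
    fix k assume k: "k \<in> K"
    then show "{k} \<subseteq> K" by simp
    show "\<forall>l\<in>K - {k}. \<Theta> (\<lambda>t. f k t * f l t) (a k * b l) = 0"
    proof
      fix l assume "l \<in> K - {k}"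
      then show "\<Theta> (\<lambda>t. f k t * f l t) (a k * b l) = 0" using k by (intro zero) auto
    qed
  qed
  finally show ?thesis by simp
qed

text \<open>Orthogonality keeps powers diagonal: squaring the sum squares each f k and each a k.
  Bounding the summands one by one costs the factor \<open>2 * card K\<close>, which is independent
  of the exponent and disappears under the roots.\<close>

lemma norm_sum_\<Theta>_orthogonal_selfadjoint:
  assumes K: "finite K" and f: "\<And>k. k \<in> K \<Longrightarrow> continuous_on {-1..1} (f k)" "\<And>k. k \<in> K \<Longrightarrow> f k 0 = 0"
    and f1: "\<And>k t. k \<in> K \<Longrightarrow> t \<in> {-1..1} \<Longrightarrow> \<bar>f k t\<bar> \<le> 1"
    and orth: "\<And>k l t. k \<in> K \<Longrightarrow> l \<in> K \<Longrightarrow> k \<noteq> l \<Longrightarrow> f k t * f l t = 0"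
    and a: "\<And>k. k \<in> K \<Longrightarrow> star (a k) = a k" "\<And>k. k \<in> K \<Longrightarrow> norm (a k) \<le> M" and M: "0 \<le> M"
  shows "norm (\<Sum>k\<in>K. \<Theta> (f k) (a k)) \<le> M"
proof (rule le_of_power_two_power_le[where a = 0 and b = "2 * real (card K)"])
  fix n
  have sq: "squaring n (\<Sum>k\<in>K. \<Theta> (f k) (a k)) = (\<Sum>k\<in>K. \<Theta> (\<lambda>t. f k t ^ (2 ^ n)) (squaring n (a k)))"
  proof (induction n)
    case (Suc n)
    have "squaring (Suc n) (\<Sum>k\<in>K. \<Theta> (f k) (a k))
        = (\<Sum>k\<in>K. \<Theta> (\<lambda>t. f k t ^ (2 ^ n) * f k t ^ (2 ^ n)) (squaring n (a k) * squaring n (a k)))"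
      unfolding funpow.simps comp_def Suc
      by (rule \<Theta>_orthogonal_mult[OF K])
        (auto intro!: continuous_intros f simp: f(2) orth power_mult_distrib[symmetric] power_0_left)
    also have "\<dots> = (\<Sum>k\<in>K. \<Theta> (\<lambda>t. f k t ^ (2 ^ Suc n)) (squaring (Suc n) (a k)))"
      by (simp add: mult_2 flip: power_add)
    finally show ?case .
  qed simp
  have "star (\<Sum>k\<in>K. \<Theta> (f k) (a k)) = (\<Sum>k\<in>K. \<Theta> (f k) (a k))"
    by (simp add: star_sum \<Theta>_star[symmetric] f a)
  then have "norm (\<Sum>k\<in>K. \<Theta> (f k) (a k)) ^ 2 ^ n
      = norm (\<Sum>k\<in>K. \<Theta> (\<lambda>t. f k t ^ (2 ^ n)) (squaring n (a k)))"
    by (simp add: norm_squaring flip: sq)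
  also have "\<dots> \<le> (\<Sum>k\<in>K. 2 * M ^ (2 ^ n) * 1)"
  proof (rule sum_norm_le)
    fix k assume k: "k \<in> K"
    have "norm (\<Theta> (\<lambda>t. f k t ^ (2 ^ n)) (squaring n (a k))) \<le> 2 * norm (squaring n (a k)) * 1"
    proof (rule \<Theta>_bound)
      fix t :: real assume t: "t \<in> {-1..1}"
      show "\<bar>f k t ^ (2 ^ n)\<bar> \<le> 1"
        using power_le_one[OF abs_ge_zero f1[OF k t]] by (simp add: power_abs)
    qed (intro continuous_intros f k)
    also have "norm (squaring n (a k)) \<le> M ^ (2 ^ n)"
      using a[OF k] by (simp add: norm_squaring power_mono)
    finally show "norm (\<Theta> (\<lambda>t. f k t ^ (2 ^ n)) (squaring n (a k))) \<le> 2 * M ^ (2 ^ n) * 1" by simp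
  qed
  finally show "norm (\<Sum>k\<in>K. \<Theta> (f k) (a k)) ^ 2 ^ n \<le> (0 * 2 ^ n + 2 * real (card K)) * M ^ 2 ^ n"
    by (simp add: mult_ac)
qed (use M in auto)

lemma norm_sum_\<Theta>_orthogonal:
  assumes K: "finite K" and f: "\<And>k. k \<in> K \<Longrightarrow> continuous_on {-1..1} (f k)" "\<And>k. k \<in> K \<Longrightarrow> f k 0 = 0"
    and f1: "\<And>k t. k \<in> K \<Longrightarrow> t \<in> {-1..1} \<Longrightarrow> \<bar>f k t\<bar> \<le> 1"
    and orth: "\<And>k l t. k \<in> K \<Longrightarrow> l \<in> K \<Longrightarrow> k \<noteq> l \<Longrightarrow> f k t * f l t = 0"
    and a: "\<And>k. k \<in> K \<Longrightarrow> norm (a k) \<le> M" and M: "0 \<le> M"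
  shows "norm (\<Sum>k\<in>K. \<Theta> (f k) (a k)) \<le> M"
proof (rule power2_le_imp_le)
  have "(norm (\<Sum>k\<in>K. \<Theta> (f k) (a k)))\<^sup>2 = norm ((\<Sum>k\<in>K. \<Theta> (f k) (star (a k))) * (\<Sum>k\<in>K. \<Theta> (f k) (a k)))"
    by (simp add: \<Theta>_star f star_sum[symmetric] cstar_identity)
  also have "\<dots> = norm (\<Sum>k\<in>K. \<Theta> (\<lambda>t. f k t * f k t) (star (a k) * a k))"
    by (subst \<Theta>_orthogonal_mult[OF K f orth]) auto
  also have "\<dots> \<le> M\<^sup>2"
  proof (rule norm_sum_\<Theta>_orthogonal_selfadjoint[OF K])
    fix k t assume k: "k \<in> K"
    show "norm (star (a k) * a k) \<le> M\<^sup>2" using a[OF k] by (simp add: cstar_identity power_mono)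
    show "continuous_on {-1..1} (\<lambda>t. f k t * f k t)" by (intro continuous_intros f k)
    show "\<bar>f k t * f k t\<bar> \<le> 1" if "t \<in> {-1..1}"
      using mult_le_one[OF f1[OF k that] abs_ge_zero f1[OF k that]] by (simp only: abs_mult)
    show "f k t * f k t * (f l t * f l t) = 0" if "l \<in> K" "k \<noteq> l" for l
      using orth[OF k that, of t] by auto
  qed (auto simp: f(2) star_simps)
  finally show "(norm (\<Sum>k\<in>K. \<Theta> (f k) (a k)))\<^sup>2 \<le> M\<^sup>2" .
qed (rule M)

text \<open>The image of the piecewise linear interpolant of \<open>F\<close> at the nodes k/N.
  Nodes with k \<le> 0 carry the value 0 and only align the sum with the hats on [-1,1].\<close>

definition approx_hom :: "nat \<Rightarrow> 'a c0 \<Rightarrow> 'b" where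
  "approx_hom N F = (\<Sum>k=-int N..int N. \<Theta> (hat N k) (c0_fun F (of_int k / real N)))"

lemma approx_hom_add: "approx_hom N (F + G) = approx_hom N F + approx_hom N G"
  by (simp add: approx_hom_def c0_plus \<Theta>_apply_add continuous_hat sum.distrib)

lemma approx_hom_scaleC: "approx_hom N (z *\<^sub>C F) = z *\<^sub>C approx_hom N F"
proof -
  have "linear ((*\<^sub>C) z :: 'b \<Rightarrow> 'b)" by (simp add: linear_iff scaleC_add_right scaleC_scaleR)
  then show ?thesis
    by (simp add: approx_hom_def c0_scaleC \<Theta>_apply_scaleC continuous_hat linear_sum)
qed

lemma approx_hom_scaleR: "approx_hom N (r *\<^sub>R F) = r *\<^sub>R approx_hom N F"
  by (simp add: scaleR_scaleC approx_hom_scaleC)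

lemma approx_hom_diff: "approx_hom N (F - G) = approx_hom N F - approx_hom N G"
  using approx_hom_add[of N "F - G" G] by simp

lemma approx_hom_star: "approx_hom N (star F) = star (approx_hom N F)"
  by (simp add: approx_hom_def c0_star \<Theta>_star continuous_hat star_sum)

text \<open>The even and the odd hats are two families of mutually orthogonal functions, so the bound does not
  depend on \<open>N\<close>.\<close>

lemma norm_approx_hom_le: "norm (approx_hom N F) \<le> 2 * norm F"
proof -
  \<comment> \<open>Starting at 1 leaves only hats that vanish at 0, as multiplicativity of \<Theta>
    demands.\<close>
  define E where "E r = {k \<in> {1..int N}. k mod 2 = r}" for r
  have E: "norm (\<Sum>k\<in>E r. \<Theta> (hat N k) (c0_fun F (of_int k / real N))) \<le> norm F" for r
  proof (rule norm_sum_\<Theta>_orthogonal)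
    show "finite (E r)" unfolding E_def by (rule finite_subset[of _ "{1..int N}"]) auto
    fix k l t assume kl: "k \<in> E r" "l \<in> E r" "k \<noteq> l"
    then have "k mod 2 = l mod 2" by (simp add: E_def)
    then have "2 dvd k - l" using mod_eq_dvd_iff by blast
    then have "2 \<le> \<bar>k - l\<bar>" using kl(3) by (intro zdvd_imp_le) auto
    then show "hat N k t * hat N l t = 0" by (rule hat_mult_hat)
  next
    fix k assume "k \<in> E r"
    then show "hat N k 0 = 0" by (intro hat_eq_0) (simp add: E_def)
    show "norm (c0_fun F (real_of_int k / real N)) \<le> norm F" by (rule c0_norm_le)
    show "\<bar>hat N k t\<bar> \<le> 1" for t by (simp add: hat_def)
  qed (simp_all add: continuous_hat)
  have "approx_hom N F = (\<Sum>k\<in>{1..int N}. \<Theta> (hat N k) (c0_fun F (of_int k / real N)))"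
    unfolding approx_hom_def
  proof (rule sum.mono_neutral_right)
    show "\<forall>k\<in>{- int N..int N} - {1..int N}. \<Theta> (hat N k) (c0_fun F (real_of_int k / real N)) = 0"
    proof
      fix k assume "k \<in> {- int N..int N} - {1..int N}"
      then have "k \<le> 0" by auto
      then have "real_of_int k / real N \<le> 0" by (simp add: divide_nonpos_nonneg)
      then have "c0_fun F (real_of_int k / real N) = 0" by (intro c0_fun_outside) auto
      then show "\<Theta> (hat N k) (c0_fun F (real_of_int k / real N)) = 0"
        by (simp add: \<Theta>_apply_zero continuous_hat)
    qed
  qed auto
  also have "\<dots> = (\<Sum>r\<in>{0, 1}. \<Sum>k\<in>E r. \<Theta> (hat N k) (c0_fun F (of_int k / real N)))"
    unfolding E_def by (rule sum.group[symmetric]) auto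
  also have "norm \<dots> \<le> (\<Sum>r\<in>{0, 1 :: int}. norm F)" by (intro sum_norm_le E)
  finally show ?thesis by simp
qed

lemma approx_hom_rtensor:
  assumes f: "c0_real f"
  shows "(\<lambda>N. approx_hom N (rtensor f a)) \<longlonglongrightarrow> \<Theta> f a"
proof (rule LIMSEQ_I)
  fix r :: real assume r: "r > 0"
  have fc: "continuous_on {-1..1} f" using f by (simp add: c0_real_def)
  define e where "e = r / (4 * (norm a + 1))"
  have e: "e > 0" using r by (simp add: e_def add_nonneg_pos)
  obtain N0 where N0: "\<And>N t. N \<ge> N0 \<Longrightarrow> t \<in> {-1..1} \<Longrightarrow>
      \<bar>f t - (\<Sum>k=-int N..int N. f (of_int k / real N) * hat N k t)\<bar> \<le> e"
    using hat_interpolation[OF fc e] by metis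
  have "norm (approx_hom N (rtensor f a) - \<Theta> f a) < r" if N: "N \<ge> N0" for N
  proof -
    let ?g = "\<lambda>t. \<Sum>k=-int N..int N. f (of_int k / real N) * hat N k t"
    have g: "continuous_on {-1..1} ?g" by (intro continuous_intros continuous_hat)
    have "approx_hom N (rtensor f a) = \<Theta> ?g a"
      by (simp add: approx_hom_def rtensor_apply[OF f] \<Theta>_apply_scaleR continuous_hat \<Theta>_sum)
    then have "norm (approx_hom N (rtensor f a) - \<Theta> f a) = norm (\<Theta> (\<lambda>t. f t - ?g t) a)"
      by (simp only: \<Theta>_diff[OF fc g] norm_minus_commute)
    also have "\<dots> \<le> 2 * norm a * e"
      by (rule \<Theta>_bound) (auto intro!: continuous_intros fc continuous_hat N0 N)
    also have "\<dots> \<le> 2 * (norm a + 1) * e" using e by simp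
    also have "\<dots> = r / 2" by (simp add: e_def field_simps add_nonneg_eq_0_iff)
    finally show ?thesis using r by simp
  qed
  then show "\<exists>N0. \<forall>N\<ge>N0. norm (approx_hom N (rtensor f a) - \<Theta> f a) < r" by blast
qed

definition \<rho> :: "'a c0 \<Rightarrow> 'b" where
  "\<rho> F = lim (\<lambda>N. approx_hom N F)"

text \<open>Convergence holds on the dense span of real elementary tensors, and the bound 2, uniform
  in N, carries it to the whole cone.\<close>

lemma approx_hom_tendsto: "(\<lambda>N. approx_hom N F) \<longlonglongrightarrow> \<rho> F"
proof -
  have conv: "\<exists>y. (\<lambda>N. approx_hom N d) \<longlonglongrightarrow> y" if "d \<in> span rtensors" for d
    using that
  proof (induction rule: span_induct_alt)
    case base
    have "approx_hom N 0 = 0" for N using approx_hom_scaleR[of N 0 0] by simp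
    then show ?case by auto
  next
    case (step c x y)
    then obtain l f a where "(\<lambda>N. approx_hom N y) \<longlonglongrightarrow> l" "x = rtensor f a" "c0_real f"
      by (auto simp: rtensors_def)
    then have "(\<lambda>N. c *\<^sub>R approx_hom N x + approx_hom N y) \<longlonglongrightarrow> c *\<^sub>R \<Theta> f a + l"
      by (intro tendsto_intros) (simp_all add: approx_hom_rtensor)
    then show ?case by (auto simp: approx_hom_add approx_hom_scaleR)
  qed
  have "\<exists>y. (\<lambda>N. approx_hom N F) \<longlonglongrightarrow> y"
    by (rule tendsto_exists_on_dense[OF _ _ span_rtensors_dense conv, of _ 2])
      (simp_all add: norm_approx_hom_le flip: approx_hom_diff)
  then show ?thesis unfolding \<rho>_def by (auto simp: limI)
qed

lemma \<rho>_rtensor: "c0_real f \<Longrightarrow> \<rho> (rtensor f a) = \<Theta> f a"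
  using LIMSEQ_unique[OF approx_hom_tendsto approx_hom_rtensor] .

lemma \<rho>_add: "\<rho> (F + G) = \<rho> F + \<rho> G"
  using LIMSEQ_unique[OF approx_hom_tendsto[of "F + G"]] tendsto_add[OF approx_hom_tendsto approx_hom_tendsto]
  by (simp add: approx_hom_add)

lemma \<rho>_scaleC: "\<rho> (z *\<^sub>C F) = z *\<^sub>C \<rho> F"
proof (rule LIMSEQ_unique[OF approx_hom_tendsto])
  show "(\<lambda>N. approx_hom N (z *\<^sub>C F)) \<longlonglongrightarrow> z *\<^sub>C \<rho> F"
    unfolding approx_hom_scaleC
    by (intro bounded_bilinear.tendsto[OF bounded_bilinear_scaleC] tendsto_const approx_hom_tendsto)
qed

lemma \<rho>_star: "\<rho> (star F) = star (\<rho> F)"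
proof (rule LIMSEQ_unique[OF approx_hom_tendsto])
  show "(\<lambda>N. approx_hom N (star F)) \<longlonglongrightarrow> star (\<rho> F)"
    unfolding approx_hom_star by (intro bounded_linear.tendsto[OF bounded_linear_star] approx_hom_tendsto)
qed

lemma \<rho>_bounded_linear: "bounded_linear \<rho>"
proof (rule bounded_linear_intro)
  show "norm (\<rho> F) \<le> norm F * 2" for F
    by (rule Lim_bounded[OF tendsto_norm[OF approx_hom_tendsto], of 0])
      (use norm_approx_hom_le in \<open>simp add: mult.commute\<close>)
qed (simp_all add: \<rho>_add \<rho>_scaleC scaleR_scaleC)

text \<open>Both sides are bounded and linear in each variable, so agreement on elementary tensors
  is extended in one variable at a time.\<close>

lemma \<rho>_mult: "\<rho> (F * G) = \<rho> F * \<rho> G"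
proof -
  have tt: "\<rho> (rtensor f a * rtensor g b) = \<rho> (rtensor f a) * \<rho> (rtensor g b)"
    if fg: "c0_real f" "c0_real g" for f g a b
    using fg by (simp add: rtensor_mult \<rho>_rtensor c0_real_mult, subst \<Theta>_mult) (auto simp: c0_real_def)
  have left: "bounded_linear (\<lambda>G. \<rho> (F * G))" "bounded_linear (\<lambda>G. \<rho> F * \<rho> G)" for F
    by (rule bounded_linear_compose[OF \<rho>_bounded_linear bounded_linear_mult_right]
        bounded_linear_compose[OF bounded_linear_mult_right \<rho>_bounded_linear])+
  have right: "bounded_linear (\<lambda>F. \<rho> (F * G))" "bounded_linear (\<lambda>F. \<rho> F * \<rho> G)" for G
    by (rule bounded_linear_compose[OF \<rho>_bounded_linear bounded_linear_mult_left]
        bounded_linear_compose[OF bounded_linear_mult_left \<rho>_bounded_linear])+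
  have "\<rho> (rtensor f a * G) = \<rho> (rtensor f a) * \<rho> G" if "c0_real f" for f a G
    by (rule bounded_linear_eq_on_rtensors[OF left]) (rule tt[OF that])
  then show ?thesis by (rule bounded_linear_eq_on_rtensors[OF right])
qed

lemma star_hom_\<rho>: "star_hom \<rho>"
  by (simp add: star_hom_def complex_linear_def \<rho>_add \<rho>_scaleC \<rho>_mult \<rho>_star)

end

definition unit_id :: "real \<Rightarrow> real" where
  "unit_id t = (if t \<in> {0<..1} then t else 0)"

lemma c0_real_unit_id: "c0_real unit_id"
proof (rule c0_realI)
  show "continuous_on {0..1} unit_id"
    by (rule continuous_on_eq[OF continuous_on_id]) (auto simp: unit_id_def)
qed (simp add: unit_id_def)

lemma id_c0_tensor: "id_c0 \<otimes>\<^sub>C a = rtensor unit_id a"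
  by (rule c0_eqI)
    (simp add: rtensor_apply[OF c0_real_unit_id] c0_tensor.rep_eq id_c0.rep_eq scaleR_scaleC
      scaleC_zero_left unit_id_def)

lemma (in cpc_order_zero_map) \<rho>_id: "\<rho> (id_c0 \<otimes>\<^sub>C a) = \<phi> a"
proof -
  \<comment> \<open>The two functions differ to the left of 0, where \<Theta> does not look.\<close>
  have "\<Theta> unit_id a = \<Theta> (\<lambda>t. t) a"
    using c0_real_unit_id by (intro \<Theta>_cong) (auto simp: c0_real_def unit_id_def intro: continuous_intros)
  then show ?thesis by (simp add: id_c0_tensor \<rho>_rtensor[OF c0_real_unit_id] \<Theta>_id)
qed

section \<open>The correspondence\<close>

lemma rtensor_star: "c0_real f \<Longrightarrow> star (rtensor f a) = rtensor f (star a)"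
  by (rule c0_eqI) (simp add: c0_star rtensor_apply star_scaleR)

lemma rtensor_add_right: "c0_real f \<Longrightarrow> rtensor f (a + b) = rtensor f a + rtensor f b"
  by (rule c0_eqI) (simp add: c0_plus rtensor_apply scaleR_add_right)

lemma rtensor_scaleC: "c0_real f \<Longrightarrow> rtensor f (z *\<^sub>C a) = z *\<^sub>C rtensor f a"
  by (rule c0_eqI) (simp add: c0_scaleC rtensor_apply scaleC_scaleR)

lemma rtensor_zero: "c0_real f \<Longrightarrow> rtensor f 0 = 0"
  by (rule c0_eqI) (simp add: c0_zero rtensor_apply)

lemma norm_rtensor_le:
  assumes "c0_real f" "\<And>t. t \<in> {0<..1} \<Longrightarrow> \<bar>f t\<bar> \<le> B"
  shows "norm (rtensor f a) \<le> B * norm a"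
  by (rule c0_norm_leI') (simp add: rtensor_apply assms mult_right_mono)

lemma bounded_linear_rtensor:
  assumes f: "c0_real f"
  shows "bounded_linear (rtensor f)"
proof -
  obtain B where B: "\<And>t. t \<in> {-1..1} \<Longrightarrow> \<bar>f t\<bar> \<le> B"
    using continuous_bounded_on_Icc[of f] f by (auto simp: c0_real_def)
  show ?thesis
  proof (rule bounded_linear_intro)
    show "norm (rtensor f a) \<le> norm a * B" for a :: 'a
      using norm_rtensor_le[OF f B] by (simp add: mult.commute)
  qed (simp_all add: rtensor_add_right rtensor_scaleC f scaleR_scaleC)
qed

lemma bounded_linear_star_hom:
  assumes "star_hom \<sigma>"
  shows "bounded_linear \<sigma>"
  by (rule bounded_linear_intro[of _ 1]) (simp_all add: star_homD[OF assms] star_hom_norm_le[OF assms])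

section \<open>Uniqueness: a homomorphism is determined by its values on id \<otimes> a\<close>

lemma c0_real_mult_poly:
  assumes "c0_real g"
  shows "c0_real (\<lambda>t. g t * poly q t)"
  using assms by (auto simp: c0_real_def intro!: continuous_intros)

text \<open>Since (t g) \<otimes> (x y) is the product of id \<otimes> x and g \<otimes> y,
  agreement at g passes to t g, first on products and then by density. The induction generalizes
  over g because each coefficient shifts one factor t into it.\<close>

lemma star_hom_eq_on_rtensor_mult_poly:
  fixes \<sigma> \<tau> :: "'a::cstar_algebra c0 \<Rightarrow> 'b::cstar_algebra"
  assumes \<sigma>: "star_hom \<sigma>" and \<tau>: "star_hom \<tau>"
    and id: "\<And>a. \<sigma> (rtensor unit_id a) = \<tau> (rtensor unit_id a)"
  shows "c0_real g \<Longrightarrow> (\<And>a. \<sigma> (rtensor g a) = \<tau> (rtensor g a)) \<Longrightarrow>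
    \<sigma> (rtensor (\<lambda>t. g t * poly q t) a) = \<tau> (rtensor (\<lambda>t. g t * poly q t) a)"
proof (induction q arbitrary: g a)
  case 0
  have "rtensor (\<lambda>t. 0) a = 0" by (simp add: rtensor_def zero_c0_def)
  then show ?case using star_homD(5)[OF \<sigma>, of 0 0] star_homD(5)[OF \<tau>, of 0 0] by simp
next
  case (pCons c q)
  let ?h = "\<lambda>t. unit_id t * g t"
  have h: "c0_real ?h" by (rule c0_real_mult[OF c0_real_unit_id pCons.prems(1)])
  have "\<sigma> (rtensor ?h a) = \<tau> (rtensor ?h a)" for a
  proof (rule bounded_linear_eq_if_eq_on_products[where f = "\<lambda>a. \<sigma> (rtensor ?h a)" and g = "\<lambda>a. \<tau> (rtensor ?h a)"])
    show "bounded_linear (\<lambda>a. \<sigma> (rtensor ?h a))" "bounded_linear (\<lambda>a. \<tau> (rtensor ?h a))"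
      using bounded_linear_compose[OF bounded_linear_star_hom[OF \<sigma>] bounded_linear_rtensor[OF h]]
        bounded_linear_compose[OF bounded_linear_star_hom[OF \<tau>] bounded_linear_rtensor[OF h]] .
    show "\<sigma> (rtensor ?h (x * y)) = \<tau> (rtensor ?h (x * y))" for x y
      unfolding rtensor_mult[OF c0_real_unit_id pCons.prems(1), symmetric]
      by (simp add: star_homD(3)[OF \<sigma>] star_homD(3)[OF \<tau>] id pCons.prems(2))
  qed
  then have IH: "\<sigma> (rtensor (\<lambda>t. ?h t * poly q t) a) = \<tau> (rtensor (\<lambda>t. ?h t * poly q t) a)" for a
    by (rule pCons.IH[OF h])
  have eq: "rtensor (\<lambda>t. g t * poly (pCons c q) t) a = c *\<^sub>R rtensor g a + rtensor (\<lambda>t. ?h t * poly q t) a"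
  proof (rule c0_eqI)
    fix t
    have "t * g t = ?h t" using pCons.prems(1) by (simp add: unit_id_def c0_real_def)
    moreover have "g t * poly (pCons c q) t = c * g t + (t * g t) * poly q t" by (simp add: algebra_simps)
    ultimately have "g t * poly (pCons c q) t = c * g t + ?h t * poly q t" by (simp only:)
    then show "c0_fun (rtensor (\<lambda>t. g t * poly (pCons c q) t) a) t
        = c0_fun (c *\<^sub>R rtensor g a + rtensor (\<lambda>t. ?h t * poly q t) a) t"
      by (simp only: c0_plus c0_scaleR rtensor_apply[OF pCons.prems(1)] scaleR_add_left scaleR_scaleR
          rtensor_apply[OF c0_real_mult_poly[OF pCons.prems(1)]] rtensor_apply[OF c0_real_mult_poly[OF h]])
  qed
  show ?case
    unfolding eq by (simp add: star_homD[OF \<sigma>] star_homD[OF \<tau>] pCons.prems(2) IH)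
qed

text \<open>Polynomials without constant term approximate every f vanishing at 0, and contractivity
  of both homomorphisms turns closeness in the cone into closeness of the images.\<close>

lemma star_hom_c0_unique:
  fixes \<sigma> \<tau> :: "'a::cstar_algebra c0 \<Rightarrow> 'b::cstar_algebra"
  assumes \<sigma>: "star_hom \<sigma>" and \<tau>: "star_hom \<tau>"
    and id: "\<And>a. \<sigma> (id_c0 \<otimes>\<^sub>C a) = \<tau> (id_c0 \<otimes>\<^sub>C a)"
  shows "\<sigma> = \<tau>"
proof
  fix F
  show "\<sigma> F = \<tau> F"
  proof (rule bounded_linear_eq_on_rtensors[OF bounded_linear_star_hom[OF \<sigma>] bounded_linear_star_hom[OF \<tau>]])
    fix f and a :: 'a assume f: "c0_real f"
    show "\<sigma> (rtensor f a) = \<tau> (rtensor f a)"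
    proof (rule eq_if_norm_diff_small)
      fix e :: real assume e: "e > 0"
      have "continuous_on {-1..1} f" "f 0 = 0" using f by (auto simp: c0_real_def)
      then obtain q where q: "near_poly f (pCons 0 q) e" using e by (rule ex_near_poly_vanishing)
      let ?g = "\<lambda>t. unit_id t * poly q t"
      have g: "c0_real ?g" by (rule c0_real_mult_poly[OF c0_real_unit_id])
      have agree: "\<sigma> (rtensor ?g a) = \<tau> (rtensor ?g a)"
        using id by (intro star_hom_eq_on_rtensor_mult_poly[OF \<sigma> \<tau> _ c0_real_unit_id])
          (simp_all add: id_c0_tensor)
      have "norm (rtensor f a - rtensor ?g a) \<le> e * norm a"
      proof (rule c0_norm_leI')
        fix t :: real assume t: "t \<in> {0<..1}"
        have "\<bar>f t - t * poly q t\<bar> \<le> e" using q t by (auto simp: near_poly_def)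
        moreover have "unit_id t = t" using t by (simp add: unit_id_def)
        ultimately show "norm (c0_fun (rtensor f a - rtensor ?g a) t) \<le> e * norm a"
          by (simp add: c0_minus rtensor_apply[OF f] rtensor_apply[OF g] mult_right_mono
              flip: scaleR_diff_left)
      qed
      then have *: "norm (\<upsilon> (rtensor f a) - \<upsilon> (rtensor ?g a)) \<le> e * norm a" if "star_hom \<upsilon>" for \<upsilon> :: "'a c0 \<Rightarrow> 'b"
        using star_hom_norm_le[OF that, of "rtensor f a - rtensor ?g a"]
          linear_diff[OF bounded_linear.linear[OF bounded_linear_star_hom[OF that]]] by simp
      have "norm (\<sigma> (rtensor f a) - \<tau> (rtensor f a)) \<le> e * norm a + e * norm a"
        using norm_triangle_ineq4[of "\<sigma> (rtensor f a) - \<sigma> (rtensor ?g a)" "\<tau> (rtensor f a) - \<tau> (rtensor ?g a)"]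
          *[OF \<sigma>] *[OF \<tau>] by (simp add: agree)
      then show "norm (\<sigma> (rtensor f a) - \<tau> (rtensor f a)) \<le> (2 * norm a) * e" by (simp add: mult_ac)
    qed
  qed
qed

text \<open>Order zero holds because T(a) T(b) is the image of id^2 \<otimes> a b; contractivity
  reflects that id has supremum norm 1.\<close>

lemma cpc_order_zero_of_star_hom:
  fixes \<sigma> :: "'a::cstar_algebra c0 \<Rightarrow> 'b::cstar_algebra"
  assumes \<sigma>: "star_hom \<sigma>"
  shows "cpc_order_zero (\<lambda>a. \<sigma> (id_c0 \<otimes>\<^sub>C a))"
proof -
  define T where "T a = \<sigma> (rtensor unit_id a)" for a
  have T_lin: "complex_linear T"
    by (simp add: complex_linear_def T_def rtensor_add_right rtensor_scaleC c0_real_unit_id star_homD[OF \<sigma>])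
  have T_star: "star (T a) = T (star a)" for a
    by (simp add: T_def rtensor_star[OF c0_real_unit_id, symmetric] star_homD[OF \<sigma>])
  have T_zero_mult: "T a * T b = 0" if "a * b = 0" for a b
    using star_homD(5)[OF \<sigma>, of 0 0] c0_real_mult[OF c0_real_unit_id c0_real_unit_id]
    by (simp add: T_def star_homD(3)[OF \<sigma>, symmetric] rtensor_mult[OF c0_real_unit_id c0_real_unit_id] that rtensor_zero)
  have "contractive T"
    unfolding contractive_def T_def
  proof
    fix a :: 'a
    have "norm (rtensor unit_id a) \<le> 1 * norm a"
      by (rule norm_rtensor_le[OF c0_real_unit_id]) (simp add: unit_id_def)
    then show "norm (\<sigma> (rtensor unit_id a)) \<le> norm a"
      using star_hom_norm_le[OF \<sigma>, of "rtensor unit_id a"] by simp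
  qed
  moreover have "order_zero T"
    by (simp add: order_zero_def orth_def T_star T_zero_mult)
  moreover have "mat_pos n (map_mat T X)" if X: "mat_pos n X" for n X
  proof -
    obtain Y where Y: "Y \<in> carrier_mat n n" "X = mat_star Y * Y" using X by (auto simp: mat_pos_def)
    define r where "r t = (if t \<in> {0<..1} then sqrt t else 0)" for t :: real
    have r: "c0_real r"
    proof (rule c0_realI)
      have "continuous_on {0..1} sqrt" by (intro continuous_intros)
      then show "continuous_on {0..1} r" by (rule continuous_on_eq) (auto simp: r_def)
    qed (simp add: r_def)
    have rr: "(\<lambda>t. r t * r t) = unit_id" by (rule ext) (simp add: r_def unit_id_def)
    define S where "S y = \<sigma> (rtensor r y)" for y
    have S: "star (S x) * S y = T (star x * y)" for x y
      by (simp add: S_def T_def star_homD[OF \<sigma>, symmetric] rtensor_star[OF r] rtensor_mult[OF r r] rr)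
    have T_sum: "T (\<Sum>k\<in>I. x k) = (\<Sum>k\<in>I. T (x k))" for I :: "nat set" and x
      by (rule linear_sum) (use T_lin in \<open>simp add: complex_linear_def linear_iff scaleR_scaleC\<close>)
    \<comment> \<open>Applying \<open>S\<close> entrywise to a factor of \<open>X\<close> gives a
      factor of its image, by the identity for \<open>S\<close> in each summand of the matrix
      product.\<close>
    define W where "W = map_mat S Y"
    have W: "W \<in> carrier_mat n n" using Y by (simp add: W_def)
    have "map_mat T X = mat_star W * W"
    proof (rule eq_matI)
      fix i j assume "i < dim_row (mat_star W * W)" "j < dim_col (mat_star W * W)"
      then have ij: "i < n" "j < n" using W by (auto simp: mat_star_def)
      have "map_mat T X $$ (i, j) = T (X $$ (i, j))"
        using ij Y by (simp add: mat_star_def)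
      also have "\<dots> = (\<Sum>k<n. T (star (Y $$ (k, i)) * Y $$ (k, j)))"
        unfolding Y(2) mat_star_mult_entry[OF Y(1) ij] T_sum ..
      also have "\<dots> = (\<Sum>k<n. star (W $$ (k, i)) * W $$ (k, j))"
        by (rule sum.cong) (use ij Y(1) in \<open>auto simp: W_def S\<close>)
      also have "\<dots> = (mat_star W * W) $$ (i, j)" by (rule mat_star_mult_entry[OF W ij, symmetric])
      finally show "map_mat T X $$ (i, j) = (mat_star W * W) $$ (i, j)" .
    qed (use Y W in \<open>auto simp: mat_star_def\<close>)
    then show ?thesis using W by (auto simp: mat_pos_def)
  qed
  ultimately have "cpc_order_zero T"
    using T_lin by (simp add: cpc_order_zero_def completely_positive_def)
  moreover have "T = (\<lambda>a. \<sigma> (id_c0 \<otimes>\<^sub>C a))" by (simp add: fun_eq_iff T_def id_c0_tensor)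
  ultimately show ?thesis by simp
qed

section \<open>The two assignments are mutually inverse\<close>

lemma ex1_star_hom_of_cpc_order_zero:
  fixes \<phi> :: "'a::cstar_algebra \<Rightarrow> 'b::cstar_algebra"
  assumes "cpc_order_zero \<phi>"
  shows "\<exists>!\<sigma>. star_hom \<sigma> \<and> (\<forall>a. \<sigma> (id_c0 \<otimes>\<^sub>C a) = \<phi> a)"
proof -
  interpret cpc_order_zero_map \<phi> by standard (rule assms)
  show ?thesis
    using star_hom_\<rho> \<rho>_id by (intro ex1I[of _ \<rho>]) (auto intro: star_hom_c0_unique)
qed

lemma rho_of_props:
  fixes \<phi> :: "'a::cstar_algebra \<Rightarrow> 'b::cstar_algebra"
  assumes "cpc_order_zero \<phi>"
  shows "star_hom (rho_of \<phi>)" "phi_of (rho_of \<phi>) = \<phi>"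
  using theI'[OF ex1_star_hom_of_cpc_order_zero[OF assms]]
  by (simp_all add: rho_of_def phi_of_def fun_eq_iff)

lemma cpc_order_zero_phi_of: "star_hom \<sigma> \<Longrightarrow> cpc_order_zero (phi_of \<sigma>)"
  using cpc_order_zero_of_star_hom[of \<sigma>] by (simp add: phi_of_def[abs_def])

lemma rho_of_phi_of:
  assumes "star_hom \<sigma>"
  shows "rho_of (phi_of \<sigma>) = \<sigma>"
proof (rule star_hom_c0_unique[OF _ assms])
  show "star_hom (rho_of (phi_of \<sigma>))" by (intro rho_of_props cpc_order_zero_phi_of assms)
  show "rho_of (phi_of \<sigma>) (id_c0 \<otimes>\<^sub>C a) = \<sigma> (id_c0 \<otimes>\<^sub>C a)" for a
    using fun_cong[OF rho_of_props(2)[OF cpc_order_zero_phi_of[OF assms]], of a] by (simp add: phi_of_def)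
qed

theorem corollary3p1:
  shows
    "(\<forall>\<phi> :: 'a::cstar_algebra \<Rightarrow> 'b::cstar_algebra. cpc_order_zero \<phi> \<longrightarrow>
        (\<exists>!\<rho>. star_hom \<rho> \<and> (\<forall>a. \<rho> (id_c0 \<otimes>\<^sub>C a) = \<phi> a))) \<and>
     (\<forall>\<rho> :: 'a c0 \<Rightarrow> 'b. star_hom \<rho> \<longrightarrow> cpc_order_zero (\<lambda>a. \<rho> (id_c0 \<otimes>\<^sub>C a))) \<and>
     (bij_betw rho_of {\<phi> :: 'a \<Rightarrow> 'b. cpc_order_zero \<phi>} {\<rho> :: 'a c0 \<Rightarrow> 'b. star_hom \<rho>} \<and>
      bij_betw phi_of {\<rho> :: 'a c0 \<Rightarrow> 'b. star_hom \<rho>} {\<phi> :: 'a \<Rightarrow> 'b. cpc_order_zero \<phi>} \<and>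
      (\<forall>\<phi> :: 'a \<Rightarrow> 'b. cpc_order_zero \<phi> \<longrightarrow> phi_of (rho_of \<phi>) = \<phi>) \<and>
      (\<forall>\<rho> :: 'a c0 \<Rightarrow> 'b. star_hom \<rho> \<longrightarrow> rho_of (phi_of \<rho>) = \<rho>))"
proof (intro conjI)
  show "bij_betw rho_of {\<phi> :: 'a \<Rightarrow> 'b. cpc_order_zero \<phi>} {\<rho> :: 'a c0 \<Rightarrow> 'b. star_hom \<rho>}"
    by (rule bij_betw_byWitness[where f' = phi_of])
      (auto simp: rho_of_props rho_of_phi_of cpc_order_zero_phi_of)
  show "bij_betw phi_of {\<rho> :: 'a c0 \<Rightarrow> 'b. star_hom \<rho>} {\<phi> :: 'a \<Rightarrow> 'b. cpc_order_zero \<phi>}"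
    by (rule bij_betw_byWitness[where f' = rho_of])
      (auto simp: rho_of_props rho_of_phi_of cpc_order_zero_phi_of)
qed (simp_all add: ex1_star_hom_of_cpc_order_zero cpc_order_zero_of_star_hom rho_of_props rho_of_phi_of)

end
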